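(* Let $T\in\mathbb{N}$, $p\in(1,\infty)$, $q=p/(p-1)$, $P\in\mathcal{P}_p(\mathbb{R}^T)$, and fix constants $L\ge 0$ and $X_0\in\mathbb{R}$. Let $\ell\colon\mathbb{R}\to\mathbb{R}$ be convex, bounded from below and twice continuously differentiable, with $\ell''>0$ and $|\ell'(u)|\le c(1+|u|^{p-1})$ for all $u\in\mathbb{R}$ and some constant $c>0$. Let $g\colon\mathbb{R}^T\to\mathbb{R}$ be continuously differentiable with bounded derivative. Suppose that $P(X_{t-1}=X_t)=0$ for all $t=1,\dots,T$. For $Q\in\mathcal{P}_p(\mathbb{R}^T)$ set $$u(Q):=\inf_{a\in\mathcal{A}}E_Q\Big[\ell\Big(g(X)+\sum_{t=1}^T a_t(X)(X_t-X_{t-1})\Big)\Big].$$ Let $a^\ast\in\mathcal{A}$ be the unique (up to $P$-almost sure equality) optimizer for $u(P)$, set $a^\ast_{T+1}:=0$, $$Z:=g(X)+\sum_{t=1}^T a^\ast_t(X)(X_t-X_{t-1}),$$ and $$V:=\Big(\sum_{t=1}^T E_P\Big[\Big|(a^\ast_{t+1}(X)-a^\ast_t(X))\cdot E_P\big[\ell'(Z)\,|\,\mathcal{F}_t^X\big]-E_P\big[\ell'(Z)\,\partial_{x_t}g(X)\,|\,\mathcal{F}_t^X\big]\Big|^q\Big]\Big)^{1/q}.$$ Then $$\sup_{Q\in B_r(P)}u(Q)=u(P)+r\cdot V+o(r)\qquad\text{as } r\downarrow 0.$$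
   Context: $\mathcal{P}_p(\mathbb{R}^T)$ is the set of Borel probability measures on $\mathbb{R}^T$ with finite $p$-th moment. $X=(X_t)_{t=1}^T$ is the canonical process (identity map) on $\mathbb{R}^T$, and $\mathcal{F}^X_t=\sigma(X_s: 1\le s\le t)$, with $\mathcal{F}^X_0$ trivial. $\partial_{x_t}g$ is the partial derivative in the $t$-th coordinate. $\mathcal{A}$ is the set of predictable controls bounded by $L$: all $a=(a_t)_{t=1}^T$ with $a_t\colon\mathbb{R}^T\to\mathbb{R}$ Borel, $a_t(x)$ depending only on $x_1,\dots,x_{t-1}$ ($a_1$ is deterministic), and $|a_t|\le L$. On $\mathbb{R}^T\times\mathbb{R}^T$, let $X,Y$ denote the projections to the first and second coordinate. A coupling $\pi$ between $P,Q\in\mathcal{P}_p(\mathbb{R}^T)$ is a Borel probability measure on $\mathbb{R}^T\times\mathbb{R}^T$ with first marginal $P$ and second marginal $Q$. It is causal if, $\pi$-almost surely, $\pi((Y_1,\dots,Y_t)\in A\,|\,X_1,\dots,X_T)=\pi((Y_1,\dots,Y_t)\in A\,|\,X_1,\dots,X_t)$ for all Borel $A\subseteq\mathbb{R}^t$ and all $1\le t\le T$. It is bicausal if it is causal and the same condition holds with the roles of $X$ and $Y$ reversed. The adapted Wasserstein distance is $\mathcal{AW}_p(P,Q)=\inf_\pi\big(\sum_{t=1}^T E_\pi[|X_t-Y_t|^p]\big)^{1/p}$, where the infimum is over all bicausal couplings $\pi$ between $P$ and $Q$. For $r\ge 0$, $B_r(P)=\{Q\in\mathcal{P}_p(\mathbb{R}^T):\mathcal{AW}_p(P,Q)\le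 r\}$.
   Formalization: The optimizer a* need not be unique under these hypotheses (T=2, X_0=0, P Dirac at (1,2), g=0, L=1, ℓ(u)=√(1+u²)); the formal theorem instead proves that an optimizer exists and that the expansion holds with V computed from any optimizer. *)

theory Defs
  imports "HOL-Probability.Probability" "HOL-Library.Landau_Symbols"
begin

(* The time set {1..T} is a finite linearly ordered type 'n with T = CARD('n) >= 1,
   so that the path space R^T is real ^ 'n. *)

type_synonym 'n path = "(real, 'n) vec"

definition P_p :: "real \<Rightarrow> 'n::{finite,linorder} path measure set" where
  "P_p p = {Q. prob_space Q \<and> sets Q = sets borel \<and> integrable Q (\<lambda>x. norm x powr p)}"

(* X_{t-1}, where the value at the predecessor of the first time is the constant x0. *)
definition prev_val :: "real \<Rightarrow> 'n::{finite,linorder} path \<Rightarrow> 'n \<Rightarrow> real" where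
  "prev_val x0 x t = (if {..<t} = {} then x0 else x $ Max {..<t})"

(* a_{t+1}, with a_{T+1} = 0. *)
definition next_ctrl ::
  "('n::{finite,linorder} \<Rightarrow> 'n path \<Rightarrow> real) \<Rightarrow> 'n \<Rightarrow> 'n path \<Rightarrow> real" where
  "next_ctrl a t x = (if {t<..} = {} then 0 else a (Min {t<..}) x)"

(* The sigma-algebra generated by the coordinates in S of the process \<xi>. Only its space and
   its sets matter; as a measure it is null. *)
definition coord_sigma :: "('w \<Rightarrow> 'n::{finite,linorder} path) \<Rightarrow> 'n set \<Rightarrow> 'w measure" where
  "coord_sigma \<xi> S = sigma UNIV {(\<lambda>\<omega>. \<xi> \<omega> $ s) -` B | s B. s \<in> S \<and> B \<in> sets borel}"

definition natural_filtration :: "'n::{finite,linorder} \<Rightarrow> 'n path measure" where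
  "natural_filtration t = coord_sigma (\<lambda>x. x) {..t}"

definition controls ::
  "real \<Rightarrow> ('n::{finite,linorder} \<Rightarrow> 'n path \<Rightarrow> real) set" where
  "controls L = {a. \<forall>t. a t \<in> borel_measurable borel
      \<and> (\<forall>x y. (\<forall>s<t. x $ s = y $ s) \<longrightarrow> a t x = a t y)
      \<and> (\<forall>x. \<bar>a t x\<bar> \<le> L)}"

definition couplings :: "'n::{finite,linorder} path measure \<Rightarrow> 'n path measure
    \<Rightarrow> ('n path \<times> 'n path) measure set" where
  "couplings P Q = {\<pi>. prob_space \<pi> \<and> sets \<pi> = sets borel
      \<and> distr \<pi> borel fst = P \<and> distr \<pi> borel snd = Q}"

(* \<xi> plays the role of X and \<eta> that of Y. *)
definition causal ::
  "'w measure \<Rightarrow> ('w \<Rightarrow> 'n::{finite,linorder} path) \<Rightarrow> ('w \<Rightarrow> 'n path) \<Rightarrow> bool" where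
  "causal \<pi> \<xi> \<eta> \<longleftrightarrow>
    (\<forall>t. \<forall>A \<in> sets (\<Pi>\<^sub>M s\<in>{..t}. (borel :: real measure)).
      AE \<omega> in \<pi>.
        real_cond_exp \<pi> (coord_sigma \<xi> UNIV) (indicator {\<omega>. (\<lambda>s\<in>{..t}. \<eta> \<omega> $ s) \<in> A}) \<omega>
      = real_cond_exp \<pi> (coord_sigma \<xi> {..t}) (indicator {\<omega>. (\<lambda>s\<in>{..t}. \<eta> \<omega> $ s) \<in> A}) \<omega>)"

definition bicausal_couplings :: "'n::{finite,linorder} path measure \<Rightarrow> 'n path measure
    \<Rightarrow> ('n path \<times> 'n path) measure set" where
  "bicausal_couplings P Q = {\<pi> \<in> couplings P Q. causal \<pi> fst snd \<and> causal \<pi> snd fst}"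

(* The infimum in AW, the infimum in hedging_value and the supremum of hedging_value over AW_ball
   are taken in the reals. Under the hypotheses of the theorem the sets involved are nonempty and
   bounded on the relevant side, and the integrands are integrable. *)
definition AW ::
  "real \<Rightarrow> 'n::{finite,linorder} path measure \<Rightarrow> 'n path measure \<Rightarrow> real" where
  "AW p P Q = (INF \<pi> \<in> bicausal_couplings P Q.
      (\<Sum>t\<in>UNIV. \<integral>\<omega>. \<bar>fst \<omega> $ t - snd \<omega> $ t\<bar> powr p \<partial>\<pi>) powr (1 / p))"

definition AW_ball ::
  "real \<Rightarrow> 'n::{finite,linorder} path measure \<Rightarrow> real \<Rightarrow> 'n path measure set" where
  "AW_ball p P r = {Q \<in> P_p p. AW p P Q \<le> r}"

definition payoff :: "real \<Rightarrow> ('n::{finite,linorder} path \<Rightarrow> real)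
    \<Rightarrow> ('n \<Rightarrow> 'n path \<Rightarrow> real) \<Rightarrow> 'n path \<Rightarrow> real" where
  "payoff x0 g a x = g x + (\<Sum>t\<in>UNIV. a t x * (x $ t - prev_val x0 x t))"

definition hedging_value :: "real \<Rightarrow> real \<Rightarrow> (real \<Rightarrow> real)
    \<Rightarrow> ('n::{finite,linorder} path \<Rightarrow> real) \<Rightarrow> 'n path measure \<Rightarrow> real" where
  "hedging_value L x0 loss g Q = (INF a \<in> controls L. \<integral>x. loss (payoff x0 g a x) \<partial>Q)"

(* The hypotheses do not force optimizers to agree almost surely: for T = 2, x0 = 0, P the Dirac
   measure at (1,2), g = 0, L = 1 and loss u = sqrt (1 + u^2), all constant a with a_1 + a_2 = 0
   are optimal. The theorem therefore asserts existence, and the expansion for every optimizer;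
   this contains the case of a unique one. *)
definition optimal_control :: "real \<Rightarrow> real \<Rightarrow> (real \<Rightarrow> real)
    \<Rightarrow> ('n::{finite,linorder} path \<Rightarrow> real) \<Rightarrow> 'n path measure
    \<Rightarrow> ('n \<Rightarrow> 'n path \<Rightarrow> real) \<Rightarrow> bool" where
  "optimal_control L x0 loss g Q a \<longleftrightarrow>
    a \<in> controls L \<and> (\<integral>x. loss (payoff x0 g a x) \<partial>Q) = hedging_value L x0 loss g Q"

definition partial_deriv :: "'n::{finite,linorder} \<Rightarrow> ('n path \<Rightarrow> real) \<Rightarrow> 'n path \<Rightarrow> real" where
  "partial_deriv t g x = deriv (\<lambda>h. g (x + h *\<^sub>R axis t 1)) 0"

(* V, as a function of the optimizer a. *)
definition sensitivity :: "real \<Rightarrow> real \<Rightarrow> (real \<Rightarrow> real)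
    \<Rightarrow> ('n::{finite,linorder} path \<Rightarrow> real) \<Rightarrow> 'n path measure
    \<Rightarrow> ('n \<Rightarrow> 'n path \<Rightarrow> real) \<Rightarrow> real" where
  "sensitivity q x0 loss g P a =
    (\<Sum>t\<in>UNIV. \<integral>x.
        \<bar>(next_ctrl a t x - a t x)
            * real_cond_exp P (natural_filtration t) (\<lambda>y. deriv loss (payoff x0 g a y)) x
          - real_cond_exp P (natural_filtration t)
              (\<lambda>y. deriv loss (payoff x0 g a y) * partial_deriv t g y) x\<bar> powr q \<partial>P)
    powr (1 / q)"

end

theory Submission
  imports Defs
begin

text \<open>
The expansion is proved by matching upper and lower bounds; both compare the perturbed problem with a fixed
optimizer \<open>a\<close> of the unperturbed one.

For the upper bound, take an almost optimal bicausal coupling of \<open>P\<close> and \<open>Q\<close>. Conditioning \<open>a(X)\<close>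
on the past of \<open>Y\<close> gives an admissible control for \<open>Q\<close> (\<open>causal_predictable_projection\<close>), and by convexity its
loss is at most that of using \<open>a(X)\<close> on the path \<open>Y\<close>. A Taylor expansion in \<open>Y - X\<close> (\<open>cost_taylor\<close>)
leaves the pairing of the displacement at time \<open>t\<close> with the derivative of the loss in coordinate \<open>t\<close>. Causality
replaces the latter by its conditional expectation given the past up to \<open>t\<close>, and Hoelder's inequality produces the
sensitivity (\<open>coupling_estimate\<close>).

For the lower bound, displace \<open>X\<close> to \<open>X + r \<Psi>(X)\<close> with an adapted Lipschitz direction \<open>\<Psi>\<close> that nearly attains
equality in Hoelder's inequality (\<open>sensitivity_direction\<close>). For small \<open>r\<close> this map has an adapted inverse, so
the induced coupling is bicausal (\<open>perturbation_AW\<close>). The tangent inequality for the loss at the optimal position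
reduces the estimate to the effect of replacing \<open>a\<close> by another control on the displacement, which has to be
asymptotically nonnegative for nearly optimal controls (\<open>near_optimal_drift\<close>).

That last point has to cope with optimizers that are not unique. The terminal position is unique by strict
convexity. If two optimizers differ last at time \<open>t\<close>, then \<open>X\<^sub>t\<close> is determined by the strict past, and the absence
of ties forces the marginal loss to be orthogonal to the past there (\<open>loss'_orthogonal_difference\<close>). Consequently all
optimizers have the same first-order effect (\<open>direction_invariance\<close>). Nearly optimal controls accumulate at
optimizers by a minimal-norm argument in \<open>L\<^sup>2\<close> (\<open>controls_cluster_point\<close>), which also yields existence.
\<close>

section \<open>Hoelder's inequality\<close>

lemma convex_on_abs_powr:
  fixes q :: real
  assumes "q \<ge> 1"
  shows "convex_on UNIV (\<lambda>x. \<bar>x\<bar> powr q)"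
proof (rule convex_onI)
  fix t x y :: real
  assume t: "0 < t" "t < 1"
  have pos: "((1 - t) * a + t * b) powr q \<le> (1 - t) * a powr q + t * b powr q"
    if "a > 0" "b > 0" for a b
    using convex_onD[OF powr_convex[OF assms], of t a b] t that by simp
  have small: "(s * b) powr q \<le> s * b powr q" if "b \<ge> 0" "0 < s" "s < 1" for s b
  proof -
    have "s powr q \<le> s powr 1"
      using that assms powr_mono'[of 1 q s] by simp
    thus ?thesis using that by (simp add: powr_mult mult_right_mono)
  qed
  have nonneg: "((1 - t) * a + t * b) powr q \<le> (1 - t) * a powr q + t * b powr q"
    if "a \<ge> 0" "b \<ge> 0" for a b
    using pos[of a b] small[of a "1 - t"] small[of b t] that t
    by (cases "a = 0"; cases "b = 0") auto
  have "\<bar>(1 - t) *\<^sub>R x + t *\<^sub>R y\<bar> powr q \<le> ((1 - t) * \<bar>x\<bar> + t * \<bar>y\<bar>) powr q"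
    using t assms abs_triangle_ineq[of "(1 - t) * x" "t * y"]
    by (intro powr_mono2) (auto simp: abs_mult)
  also have "\<dots> \<le> (1 - t) * \<bar>x\<bar> powr q + t * \<bar>y\<bar> powr q"
    by (rule nonneg) auto
  finally show "\<bar>(1 - t) *\<^sub>R x + t *\<^sub>R y\<bar> powr q \<le> (1 - t) * \<bar>x\<bar> powr q + t * \<bar>y\<bar> powr q" .
qed simp

lemma conjugate_exponent:
  fixes p q :: real
  assumes "p > 1" "q = p / (p - 1)"
  shows "q > 1" "1 / p + 1 / q = 1" "(p - 1) * q = p" "(q - 1) * p = q"
proof -
  show "q > 1" "1 / p + 1 / q = 1" "(p - 1) * q = p"
    unfolding assms(2) using assms(1) by (simp_all add: field_simps)
  show "(q - 1) * p = q"
    unfolding assms(2) using assms(1) by (simp add: field_simps)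
qed

lemma integrable_mult_conjugate:
  fixes f g :: "'a \<Rightarrow> real"
  assumes pq: "p > 1" "q = p / (p - 1)"
    and [measurable]: "f \<in> borel_measurable M" "g \<in> borel_measurable M"
    and "integrable M (\<lambda>x. \<bar>f x\<bar> powr p)" "integrable M (\<lambda>x. \<bar>g x\<bar> powr q)"
  shows "integrable M (\<lambda>x. f x * g x)"
proof (rule Bochner_Integration.integrable_bound)
  show "integrable M (\<lambda>x. \<bar>f x\<bar> powr p / p + \<bar>g x\<bar> powr q / q)"
    using assms by auto
  show "AE x in M. norm (f x * g x) \<le> norm (\<bar>f x\<bar> powr p / p + \<bar>g x\<bar> powr q / q)"
  proof (rule AE_I2)
    fix x
    have "\<bar>f x\<bar> * \<bar>g x\<bar> \<le> \<bar>f x\<bar> powr p / p + \<bar>g x\<bar> powr q / q"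
      using conjugate_exponent[OF pq] pq by (intro Youngs_inequality) auto
    thus "norm (f x * g x) \<le> norm (\<bar>f x\<bar> powr p / p + \<bar>g x\<bar> powr q / q)"
      by (simp add: abs_mult)
  qed
qed measurable

text \<open>Hoelder's inequality on the product of \<open>M\<close> with counting measure on a finite index set, which is the
form matching the sum over times in the adapted Wasserstein distance.\<close>

lemma Holder_sum:
  fixes f g :: "'i \<Rightarrow> 'a \<Rightarrow> real"
  assumes pq: "p > 1" "q = p / (p - 1)"
    and meas [measurable]: "\<And>i. i \<in> I \<Longrightarrow> f i \<in> borel_measurable M" "\<And>i. i \<in> I \<Longrightarrow> g i \<in> borel_measurable M"
    and intf: "\<And>i. i \<in> I \<Longrightarrow> integrable M (\<lambda>x. \<bar>f i x\<bar> powr p)"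
    and intg: "\<And>i. i \<in> I \<Longrightarrow> integrable M (\<lambda>x. \<bar>g i x\<bar> powr q)"
  shows "(\<Sum>i\<in>I. \<integral>x. f i x * g i x \<partial>M)
      \<le> (\<Sum>i\<in>I. \<integral>x. \<bar>f i x\<bar> powr p \<partial>M) powr (1 / p)
        * (\<Sum>i\<in>I. \<integral>x. \<bar>g i x\<bar> powr q \<partial>M) powr (1 / q)"
proof -
  note q = conjugate_exponent[OF pq]
  define A where "A = (\<Sum>i\<in>I. \<integral>x. \<bar>f i x\<bar> powr p \<partial>M)"
  define B where "B = (\<Sum>i\<in>I. \<integral>x. \<bar>g i x\<bar> powr q \<partial>M)"
  have A0: "A \<ge> 0" and B0: "B \<ge> 0" by (auto simp: A_def B_def intro!: sum_nonneg)
  \<comment> \<open>Enlarging both norms by \<open>e\<close> makes them positive, so that Young's inequality applies without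
    a case distinction on vanishing norms.\<close>
  have *: "(\<Sum>i\<in>I. \<integral>x. f i x * g i x \<partial>M) \<le> (A powr (1 / p) + e) * (B powr (1 / q) + e)"
    if e: "e > 0" for e
  proof -
    define r where "r = A powr (1 / p) + e"
    define s where "s = B powr (1 / q) + e"
    have r: "r > 0" "A \<le> r powr p" and s: "s > 0" "B \<le> s powr q"
    proof -
      show "r > 0" "s > 0" using e by (auto simp: r_def s_def add_nonneg_pos)
      have "A = (A powr (1 / p)) powr p" using pq A0 by (simp add: powr_powr)
      also have "\<dots> \<le> r powr p" unfolding r_def using pq e by (intro powr_mono2) auto
      finally show "A \<le> r powr p" .
      have "B = (B powr (1 / q)) powr q" using q(1) B0 by (simp add: powr_powr)
      also have "\<dots> \<le> s powr q" unfolding s_def using q(1) e by (intro powr_mono2) auto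
      finally show "B \<le> s powr q" .
    qed
    have young: "f i x * g i x \<le> r * s * (\<bar>f i x\<bar> powr p / (r powr p * p) + \<bar>g i x\<bar> powr q / (s powr q * q))" for i x
    proof -
      have "f i x * g i x \<le> (r * s) * ((\<bar>f i x\<bar> / r) * (\<bar>g i x\<bar> / s))"
        using r s by (simp add: abs_mult[symmetric])
      also have "(\<bar>f i x\<bar> / r) * (\<bar>g i x\<bar> / s) \<le> (\<bar>f i x\<bar> / r) powr p / p + (\<bar>g i x\<bar> / s) powr q / q"
        using q pq r s by (intro Youngs_inequality) auto
      finally show ?thesis using r s by (simp add: powr_divide)
    qed
    have "(\<Sum>i\<in>I. \<integral>x. f i x * g i x \<partial>M)
        \<le> (\<Sum>i\<in>I. \<integral>x. r * s * (\<bar>f i x\<bar> powr p / (r powr p * p) + \<bar>g i x\<bar> powr q / (s powr q * q)) \<partial>M)"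
      using intf intg
      by (intro sum_mono integral_mono young)
        (auto intro!: integrable_mult_conjugate[OF pq] meas)
    also have "\<dots> = (\<Sum>i\<in>I. r * s * ((\<integral>x. \<bar>f i x\<bar> powr p \<partial>M) / (r powr p * p)
        + (\<integral>x. \<bar>g i x\<bar> powr q \<partial>M) / (s powr q * q)))"
      using intf intg by (intro sum.cong) simp_all
    also have "\<dots> = r * s * (A / (r powr p * p) + B / (s powr q * q))"
      unfolding A_def B_def sum_divide_distrib sum.distrib[symmetric] sum_distrib_left ..
    also have "\<dots> \<le> r * s * (1 / p + 1 / q)"
    proof -
      have "A / (r powr p * p) \<le> 1 / p" "B / (s powr q * q) \<le> 1 / q"
        using r s pq(1) q(1) by (simp_all add: field_simps)
      thus ?thesis using r s by (intro mult_left_mono add_mono) auto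
    qed
    finally show ?thesis using q(2) by (simp add: r_def s_def)
  qed
  have "((\<lambda>e. (A powr (1 / p) + e) * (B powr (1 / q) + e)) \<longlongrightarrow> (A powr (1 / p) + 0) * (B powr (1 / q) + 0))
      (at_right 0)"
    by (intro tendsto_intros)
  moreover have "\<forall>\<^sub>F e in at_right 0. (\<Sum>i\<in>I. \<integral>x. f i x * g i x \<partial>M) \<le> (A powr (1 / p) + e) * (B powr (1 / q) + e)"
    using * eventually_at_right_less[of "0::real"] by (auto elim: eventually_mono)
  ultimately show ?thesis
    using tendsto_lowerbound[of _ _ "at_right (0::real)"] by (force simp: A_def B_def)
qed

section \<open>Coordinates and the sigma-algebras generated by them\<close>

text \<open>A function on the path space that factors through the coordinates in \<open>S\<close>. Adaptedness and
predictability are expressed by this pointwise condition together with Borel measurability.\<close>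

definition depends_on :: "'n set \<Rightarrow> ('n::{finite,linorder} path \<Rightarrow> 'b) \<Rightarrow> bool" where
  "depends_on S f \<longleftrightarrow> (\<forall>x y. (\<forall>s\<in>S. x $ s = y $ s) \<longrightarrow> f x = f y)"

text \<open>The path with all coordinates outside \<open>S\<close> replaced by zero; a Borel section of the projection
to the coordinates in \<open>S\<close>.\<close>

definition keep :: "'n set \<Rightarrow> 'n::{finite,linorder} path \<Rightarrow> 'n path" where
  "keep S x = (\<chi> s. if s \<in> S then x $ s else 0)"

lemma depends_onD: "depends_on S f \<Longrightarrow> (\<And>s. s \<in> S \<Longrightarrow> x $ s = y $ s) \<Longrightarrow> f x = f y"
  by (auto simp: depends_on_def)

lemma keep_nth [simp]: "keep S x $ s = (if s \<in> S then x $ s else 0)"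
  by (simp add: keep_def)

lemma depends_on_keep: "depends_on S f \<Longrightarrow> f (keep S x) = f x"
  by (erule depends_onD) simp

lemma borel_measurable_nth_comp [measurable (raw)]:
  "f \<in> borel_measurable M \<Longrightarrow> (\<lambda>x. (f x :: real ^ 'n) $ s) \<in> borel_measurable M"
  by (rule measurable_compose[OF _ borel_measurable_nth])

lemma borel_measurable_vec:
  fixes f :: "'a \<Rightarrow> real ^ 'n"
  assumes "\<And>s. (\<lambda>x. f x $ s) \<in> borel_measurable M"
  shows "f \<in> borel_measurable M"
proof -
  have "f = (\<lambda>x. \<Sum>s\<in>UNIV. (f x $ s) *\<^sub>R axis s 1)"
    by (rule ext) (simp add: vec_eq_iff axis_def if_distrib if_distribR cong: if_cong)
  also have "\<dots> \<in> borel_measurable M"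
    using assms by measurable
  finally show ?thesis .
qed

lemma borel_measurable_keep [measurable]: "keep S \<in> borel_measurable borel"
  by (rule borel_measurable_vec) simp

lemma space_coord_sigma [simp]: "space (coord_sigma \<xi> S) = UNIV"
  by (simp add: coord_sigma_def)

lemma coord_sigma_nth:
  assumes "s \<in> S"
  shows "(\<lambda>\<omega>. \<xi> \<omega> $ s) \<in> borel_measurable (coord_sigma \<xi> S)"
proof (rule measurableI)
  fix B :: "real set" assume "B \<in> sets borel"
  thus "(\<lambda>\<omega>. \<xi> \<omega> $ s) -` B \<inter> space (coord_sigma \<xi> S) \<in> sets (coord_sigma \<xi> S)"
    using assms by (auto simp: coord_sigma_def intro!: sigma_sets.Basic)
qed simp

lemma sets_coord_sigma_vimage:
  assumes "space N = UNIV" "\<And>s. s \<in> S \<Longrightarrow> h s \<in> borel_measurable N"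
    and "\<And>s \<omega>. s \<in> S \<Longrightarrow> \<xi> \<omega> $ s = h s (\<zeta> \<omega>)" and "B \<in> sets (coord_sigma \<xi> S)"
  shows "\<exists>B'\<in>sets N. B = \<zeta> -` B'"
proof -
  have "sigma_sets UNIV {(\<lambda>\<omega>. \<xi> \<omega> $ s) -` B | s B. s \<in> S \<and> B \<in> sets borel}
      \<subseteq> sets (vimage_algebra UNIV \<zeta> N)"
  proof (rule sets.sigma_sets_subset[of _ "vimage_algebra UNIV \<zeta> N", simplified])
    show "{(\<lambda>\<omega>. \<xi> \<omega> $ s) -` B | s B. s \<in> S \<and> B \<in> sets borel} \<subseteq> sets (vimage_algebra UNIV \<zeta> N)"
    proof safe
      fix s and B :: "real set" assume s: "s \<in> S" and [measurable]: "B \<in> sets borel"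
      have "h s -` B \<in> sets N"
        using measurable_sets[OF assms(2)[OF s], of B] assms(1) by simp
      hence "\<zeta> -` (h s -` B) \<inter> UNIV \<in> sets (vimage_algebra UNIV \<zeta> N)"
        by (rule in_vimage_algebra)
      also have "\<zeta> -` (h s -` B) \<inter> UNIV = (\<lambda>\<omega>. \<xi> \<omega> $ s) -` B"
        using assms(3)[OF s] by auto
      finally show "(\<lambda>\<omega>. \<xi> \<omega> $ s) -` B \<in> sets (vimage_algebra UNIV \<zeta> N)" .
    qed
  qed
  moreover have "B \<in> sigma_sets UNIV {(\<lambda>\<omega>. \<xi> \<omega> $ s) -` B | s B. s \<in> S \<and> B \<in> sets borel}"
    using assms(4) by (auto simp: coord_sigma_def)
  ultimately show ?thesis
    by (force simp: sets_vimage_algebra2 assms(1))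
qed

lemma sets_coord_sigma_borel:
  assumes "B \<in> sets (coord_sigma \<xi> S)"
  shows "\<exists>B'\<in>sets borel. B = \<xi> -` B'"
  by (rule sets_coord_sigma_vimage[OF _ _ _ assms, of _ "\<lambda>s x. x $ s"]) auto

lemma sets_coord_sigma_natural:
  assumes "B \<in> sets (coord_sigma \<xi> S)"
  shows "\<exists>B'\<in>sets (coord_sigma (\<lambda>x. x) S). B = \<xi> -` B'"
  by (rule sets_coord_sigma_vimage[OF _ _ _ assms, of _ "\<lambda>s x. x $ s"])
    (auto intro: coord_sigma_nth[of _ _ "\<lambda>x. x"])

lemma sets_coord_sigma_PiM:
  assumes "B \<in> sets (coord_sigma \<xi> S)"
  shows "\<exists>A\<in>sets (\<Pi>\<^sub>M s\<in>S. (borel :: real measure)). B = {\<omega>. (\<lambda>s\<in>S. \<xi> \<omega> $ s) \<in> A}"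
proof -
  let ?N = "vimage_algebra UNIV (\<lambda>x :: 'b path. \<lambda>s\<in>S. x $ s) (\<Pi>\<^sub>M s\<in>S. (borel :: real measure))"
  have "(\<lambda>x. x $ s) \<in> borel_measurable ?N" if "s \<in> S" for s
  proof -
    have "(\<lambda>x. (\<lambda>s\<in>S. x $ s) s) \<in> borel_measurable ?N"
      using that by (intro measurable_compose[OF measurable_vimage_algebra1 measurable_component_singleton])
        (auto simp: space_PiM)
    thus ?thesis using that by simp
  qed
  then obtain B' where "B' \<in> sets ?N" "B = \<xi> -` B'"
    using sets_coord_sigma_vimage[OF _ _ _ assms, of ?N "\<lambda>s x. x $ s" \<xi>] by auto
  thus ?thesis
    by (subst (asm) sets_vimage_algebra2) (auto simp: space_PiM)
qed

lemma borel_measurable_coord_sigma: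
  assumes [measurable]: "f \<in> measurable borel N" and "depends_on S f"
  shows "(\<lambda>\<omega>. f (\<xi> \<omega>)) \<in> measurable (coord_sigma \<xi> S) N"
proof -
  have "(\<lambda>\<omega>. keep S (\<xi> \<omega>)) \<in> borel_measurable (coord_sigma \<xi> S)"
  proof (rule borel_measurable_vec)
    show "(\<lambda>\<omega>. keep S (\<xi> \<omega>) $ s) \<in> borel_measurable (coord_sigma \<xi> S)" for s
      by (cases "s \<in> S") (simp_all add: coord_sigma_nth)
  qed
  hence "(\<lambda>\<omega>. f (keep S (\<xi> \<omega>))) \<in> measurable (coord_sigma \<xi> S) N"
    by measurable
  thus ?thesis using assms(2) by (simp add: depends_on_keep)
qed

text \<open>A function measurable with respect to the \<open>\<sigma>\<close>-algebra generated by coordinates cannot distinguish two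
points at which these coordinates agree. This pointwise (not just almost sure) factorization is what
turns conditional expectations into admissible controls.\<close>

lemma coord_sigma_saturated:
  fixes f :: "'w \<Rightarrow> 'b::t1_space"
  assumes "f \<in> borel_measurable (coord_sigma \<xi> S)" "\<And>s. s \<in> S \<Longrightarrow> \<xi> \<omega> $ s = \<xi> \<omega>' $ s"
  shows "f \<omega> = f \<omega>'"
proof -
  have "f -` {f \<omega>} \<in> sets (coord_sigma \<xi> S)"
    using measurable_sets[OF assms(1), of "{f \<omega>}"] by simp
  hence "f -` {f \<omega>} \<in> sigma_sets UNIV {(\<lambda>\<omega>. \<xi> \<omega> $ s) -` B | s B. s \<in> S \<and> B \<in> sets borel}"
    by (simp add: coord_sigma_def)
  hence "\<omega> \<in> f -` {f \<omega>} \<longleftrightarrow> \<omega>' \<in> f -` {f \<omega>}"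
    by (induction rule: sigma_sets.induct) (use assms(2) in auto)
  thus ?thesis by simp
qed

lemma subalgebra_coord_sigma:
  assumes [measurable]: "\<xi> \<in> borel_measurable M" and "space M = UNIV"
  shows "subalgebra M (coord_sigma \<xi> S)"
  unfolding subalgebra_def
proof safe
  fix B assume "B \<in> sets (coord_sigma \<xi> S)"
  then obtain B' where "B' \<in> sets borel" "B = \<xi> -` B'" using sets_coord_sigma_borel by blast
  thus "B \<in> sets M" using measurable_sets[OF assms(1), of B'] assms(2) by simp
qed (auto simp: assms)

lemma subalgebra_coord_sigma_mono:
  assumes "S \<subseteq> S'"
  shows "subalgebra (coord_sigma \<xi> S') (coord_sigma \<xi> S)"
  unfolding subalgebra_def coord_sigma_def using assms
  by (auto intro!: sigma_sets_mono' del: subsetI) blast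

lemma depends_on_natural:
  fixes f :: "'n::{finite,linorder} path \<Rightarrow> real"
  assumes "f \<in> borel_measurable (coord_sigma (\<lambda>x. x) S)"
  shows "f \<in> borel_measurable borel" "depends_on S f"
proof -
  show "f \<in> borel_measurable borel"
    using measurable_from_subalg[OF subalgebra_coord_sigma assms, of borel] by simp
  show "depends_on S f"
    unfolding depends_on_def using coord_sigma_saturated[OF assms] by blast
qed

section \<open>Causality\<close>

text \<open>Causality says that \<open>\<eta>\<close> up to time \<open>t\<close> is conditionally independent of the whole of \<open>\<xi>\<close> given
\<open>\<xi>\<close> up to time \<open>t\<close>. Hence a functional \<open>k\<close> of \<open>\<xi>\<close> that is orthogonal to the past of \<open>\<xi>\<close>
is also orthogonal to the past of \<open>\<eta>\<close>.\<close>

lemma causal_integral_eq_0: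
  fixes \<xi> \<eta> :: "'w \<Rightarrow> 'n::{finite,linorder} path" and k \<theta> :: "'w \<Rightarrow> real"
  assumes "prob_space \<pi>" "space \<pi> = UNIV"
    and [measurable]: "\<xi> \<in> borel_measurable \<pi>" "\<eta> \<in> borel_measurable \<pi>"
    and causal: "causal \<pi> \<xi> \<eta>"
    and k: "k \<in> borel_measurable (coord_sigma \<xi> UNIV)" "integrable \<pi> k"
    and k0: "AE \<omega> in \<pi>. real_cond_exp \<pi> (coord_sigma \<xi> {..t}) k \<omega> = 0"
    and th: "\<theta> \<in> borel_measurable (coord_sigma \<eta> {..t})" "integrable \<pi> (\<lambda>\<omega>. \<theta> \<omega> * k \<omega>)"
  shows "(\<integral>\<omega>. \<theta> \<omega> * k \<omega> \<partial>\<pi>) = 0"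
proof -
  interpret prob_space \<pi> by fact
  have sub: "finite_measure_subalgebra \<pi> (coord_sigma \<xi> S)" "finite_measure_subalgebra \<pi> (coord_sigma \<eta> S)" for S
    by (unfold_locales, rule subalgebra_coord_sigma; simp add: assms)+
  interpret E: finite_measure_subalgebra \<pi> "coord_sigma \<eta> {..t}" by (rule sub)
  interpret X: finite_measure_subalgebra \<pi> "coord_sigma \<xi> {..t}" by (rule sub)
  interpret U: finite_measure_subalgebra \<pi> "coord_sigma \<xi> UNIV" by (rule sub)
  have [measurable]: "k \<in> borel_measurable \<pi>" "\<theta> \<in> borel_measurable \<pi>"
    using k th measurable_from_subalg[OF U.subalg] measurable_from_subalg[OF E.subalg] by auto
  have "AE \<omega> in \<pi>. real_cond_exp \<pi> (coord_sigma \<eta> {..t}) k \<omega> = 0"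
  proof (rule E.real_cond_exp_charact)
    fix B assume B: "B \<in> sets (coord_sigma \<eta> {..t})"
    then obtain A where A: "A \<in> sets (\<Pi>\<^sub>M s\<in>{..t}. (borel :: real measure))"
      "B = {\<omega>. (\<lambda>s\<in>{..t}. \<eta> \<omega> $ s) \<in> A}"
      using sets_coord_sigma_PiM by blast
    have [measurable]: "B \<in> sets \<pi>" using B E.subalg by (auto simp: subalgebra_def)
    have int: "integrable \<pi> (\<lambda>\<omega>. k \<omega> * indicator B \<omega>)"
      using integrable_mult_indicator[OF _ k(2), of B] by (simp add: mult.commute)
    let ?w = "real_cond_exp \<pi> (coord_sigma \<xi> {..t}) (indicator B)"
    have eq: "AE \<omega> in \<pi>. real_cond_exp \<pi> (coord_sigma \<xi> UNIV) (indicator B) \<omega> = ?w \<omega>"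
      using causal A unfolding causal_def by blast
    have wb: "AE \<omega> in \<pi>. 0 \<le> ?w \<omega>" "AE \<omega> in \<pi>. ?w \<omega> \<le> 1"
      by (intro X.real_cond_exp_ge_c X.real_cond_exp_le_c integrable_real_indicator; simp add: less_top[symmetric])+
    have [measurable]: "?w \<in> borel_measurable \<pi>" by simp
    have intw: "integrable \<pi> (\<lambda>\<omega>. ?w \<omega> * k \<omega>)"
    proof (rule Bochner_Integration.integrable_bound[OF k(2)])
      show "AE \<omega> in \<pi>. norm (?w \<omega> * k \<omega>) \<le> norm (k \<omega>)"
        using wb by eventually_elim (simp add: abs_mult mult_left_le_one_le)
    qed measurable
    have "(\<integral>\<omega>. k \<omega> * indicator B \<omega> \<partial>\<pi>) = (\<integral>\<omega>. k \<omega> * real_cond_exp \<pi> (coord_sigma \<xi> UNIV) (indicator B) \<omega> \<partial>\<pi>)"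
      using int k by (intro U.real_cond_exp_intg(2)[symmetric]) auto
    also have "\<dots> = (\<integral>\<omega>. ?w \<omega> * k \<omega> \<partial>\<pi>)"
      using eq by (intro integral_cong_AE) auto
    also have "\<dots> = (\<integral>\<omega>. ?w \<omega> * real_cond_exp \<pi> (coord_sigma \<xi> {..t}) k \<omega> \<partial>\<pi>)"
      using intw by (intro X.real_cond_exp_intg(2)[symmetric]) auto
    also have "\<dots> = (\<integral>\<omega>. 0 \<partial>\<pi>)"
      using k0 by (intro integral_cong_AE) auto
    finally show "(\<integral>\<omega>\<in>B. k \<omega> \<partial>\<pi>) = (\<integral>\<omega>\<in>B. 0 \<partial>\<pi>)"
      by (simp add: set_lebesgue_integral_def mult.commute)
  qed (use k in auto)
  hence "(\<integral>\<omega>. \<theta> \<omega> * real_cond_exp \<pi> (coord_sigma \<eta> {..t}) k \<omega> \<partial>\<pi>) = (\<integral>\<omega>. 0 \<partial>\<pi>)"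
    by (intro integral_cong_AE) auto
  moreover have "(\<integral>\<omega>. \<theta> \<omega> * real_cond_exp \<pi> (coord_sigma \<eta> {..t}) k \<omega> \<partial>\<pi>) = (\<integral>\<omega>. \<theta> \<omega> * k \<omega> \<partial>\<pi>)"
    using th by (intro E.real_cond_exp_intg) auto
  ultimately show ?thesis by simp
qed

text \<open>If \<open>\<eta>\<close> is an adapted function of \<open>\<xi>\<close>, both conditional probabilities equal the indicator itself.\<close>

lemma causal_graph:
  fixes \<xi> \<eta> :: "'w \<Rightarrow> 'n::{finite,linorder} path"
  assumes "prob_space \<pi>" "space \<pi> = UNIV"
    and [measurable]: "\<xi> \<in> borel_measurable \<pi>" "\<eta> \<in> borel_measurable \<pi>" "\<Phi> \<in> borel_measurable borel"
    and dep: "\<And>t. depends_on {..t} (\<lambda>x. \<Phi> x $ t)"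
    and graph: "AE \<omega> in \<pi>. \<eta> \<omega> = \<Phi> (\<xi> \<omega>)"
  shows "causal \<pi> \<xi> \<eta>"
  unfolding causal_def
proof safe
  interpret prob_space \<pi> by fact
  have sub: "finite_measure_subalgebra \<pi> (coord_sigma \<xi> S)" for S
    by (unfold_locales, rule subalgebra_coord_sigma; simp add: assms)+
  fix t :: 'n and A assume A [measurable]: "A \<in> sets (\<Pi>\<^sub>M s\<in>{..t}. (borel :: real measure))"
  let ?I = "\<lambda>\<omega>. indicator {\<omega>. (\<lambda>s\<in>{..t}. \<eta> \<omega> $ s) \<in> A} \<omega> :: real"
  let ?J = "\<lambda>\<omega>. indicator {x. (\<lambda>s\<in>{..t}. \<Phi> x $ s) \<in> A} (\<xi> \<omega>) :: real"
  have m1: "(\<lambda>x. \<lambda>s\<in>{..t}. \<Phi> x $ s) \<in> measurable borel (\<Pi>\<^sub>M s\<in>{..t}. (borel :: real measure))"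
    by (rule measurable_restrict) simp
  have m2: "(\<lambda>\<omega>. \<lambda>s\<in>{..t}. \<eta> \<omega> $ s) \<in> measurable \<pi> (\<Pi>\<^sub>M s\<in>{..t}. (borel :: real measure))"
    by (rule measurable_restrict) simp
  have J: "?J \<in> borel_measurable (coord_sigma \<xi> {..t})"
  proof (rule borel_measurable_coord_sigma)
    have "{x. (\<lambda>s\<in>{..t}. \<Phi> x $ s) \<in> A} \<in> sets borel"
      using measurable_sets[OF m1 A] by (simp add: vimage_def)
    thus "indicat_real {x. (\<lambda>s\<in>{..t}. \<Phi> x $ s) \<in> A} \<in> borel_measurable borel" by simp
    have "(\<lambda>s\<in>{..t}. \<Phi> x $ s) = (\<lambda>s\<in>{..t}. \<Phi> y $ s)" if "\<forall>s\<in>{..t}. x $ s = y $ s" for x y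
      using that dep by (intro restrict_ext) (auto intro!: depends_onD[OF dep])
    thus "depends_on {..t} (indicat_real {x. (\<lambda>s\<in>{..t}. \<Phi> x $ s) \<in> A})"
      unfolding depends_on_def indicator_def mem_Collect_eq by metis
  qed
  have AEIJ: "AE \<omega> in \<pi>. ?I \<omega> = ?J \<omega>"
    using graph by eventually_elim (simp add: indicator_def)
  have [measurable]: "{\<omega>. (\<lambda>s\<in>{..t}. \<eta> \<omega> $ s) \<in> A} \<in> sets \<pi>"
    using measurable_sets[OF m2 A] assms(2) by (simp add: vimage_def)
  have *: "AE \<omega> in \<pi>. real_cond_exp \<pi> (coord_sigma \<xi> S) ?I \<omega> = ?J \<omega>" if S: "{..t} \<subseteq> S" for S
  proof -
    interpret finite_measure_subalgebra \<pi> "coord_sigma \<xi> S" by (rule sub)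
    have JS: "?J \<in> borel_measurable (coord_sigma \<xi> S)"
      using measurable_from_subalg[OF subalgebra_coord_sigma_mono[OF S] J] .
    have [measurable]: "?J \<in> borel_measurable \<pi>"
      by (rule measurable_from_subalg[OF subalg JS])
    have "integrable \<pi> ?J"
      by (rule integrable_const_bound[of _ 1]) (auto simp: indicator_def)
    hence "AE \<omega> in \<pi>. real_cond_exp \<pi> (coord_sigma \<xi> S) ?J \<omega> = ?J \<omega>"
      using JS by (rule real_cond_exp_F_meas)
    moreover have "AE \<omega> in \<pi>. real_cond_exp \<pi> (coord_sigma \<xi> S) ?I \<omega> = real_cond_exp \<pi> (coord_sigma \<xi> S) ?J \<omega>"
      using AEIJ by (intro real_cond_exp_cong) auto
    ultimately show ?thesis by eventually_elim simp
  qed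
  show "AE \<omega> in \<pi>. real_cond_exp \<pi> (coord_sigma \<xi> UNIV) ?I \<omega> = real_cond_exp \<pi> (coord_sigma \<xi> {..t}) ?I \<omega>"
    using *[OF subset_UNIV] *[OF order_refl] by eventually_elim simp
qed

lemma causal_indep:
  fixes \<xi> \<eta> :: "'w \<Rightarrow> 'n::{finite,linorder} path"
  assumes "prob_space \<pi>" "space \<pi> = UNIV"
    and [measurable]: "\<xi> \<in> borel_measurable \<pi>" "\<eta> \<in> borel_measurable \<pi>"
    and indep: "\<And>A B. A \<in> sets borel \<Longrightarrow> B \<in> sets borel \<Longrightarrow>
      measure \<pi> (\<xi> -` A \<inter> \<eta> -` B) = measure \<pi> (\<xi> -` A) * measure \<pi> (\<eta> -` B)"
  shows "causal \<pi> \<xi> \<eta>"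
  unfolding causal_def
proof safe
  interpret prob_space \<pi> by fact
  fix t :: 'n and A assume A [measurable]: "A \<in> sets (\<Pi>\<^sub>M s\<in>{..t}. (borel :: real measure))"
  have m: "(\<lambda>x. \<lambda>s\<in>{..t}. x $ s) \<in> measurable (borel :: 'n path measure) (\<Pi>\<^sub>M s\<in>{..t}. (borel :: real measure))"
    by (rule measurable_restrict) simp
  define B where "B = {x :: 'n path. (\<lambda>s\<in>{..t}. x $ s) \<in> A}"
  have B [measurable]: "B \<in> sets borel"
    using measurable_sets[OF m A] by (simp add: B_def vimage_def)
  have eB: "{\<omega>. (\<lambda>s\<in>{..t}. \<eta> \<omega> $ s) \<in> A} = \<eta> -` B" by (auto simp: B_def)
  have [measurable]: "\<eta> -` B \<in> sets \<pi>"
    using measurable_sets[OF assms(4) B] assms(2) by simp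
  have *: "AE \<omega> in \<pi>. real_cond_exp \<pi> (coord_sigma \<xi> S) (indicator (\<eta> -` B)) \<omega> = measure \<pi> (\<eta> -` B)" for S
  proof -
    interpret finite_measure_subalgebra \<pi> "coord_sigma \<xi> S"
      by (unfold_locales, rule subalgebra_coord_sigma; simp add: assms)
    show ?thesis
    proof (rule real_cond_exp_charact)
      fix C assume "C \<in> sets (coord_sigma \<xi> S)"
      then obtain C' where C': "C' \<in> sets borel" "C = \<xi> -` C'" using sets_coord_sigma_borel by blast
      have [measurable]: "C \<in> sets \<pi>"
        using measurable_sets[OF assms(3) C'(1)] assms(2) C' by simp
      have "(\<integral>\<omega>\<in>C. indicat_real (\<eta> -` B) \<omega> \<partial>\<pi>) = measure \<pi> (C \<inter> \<eta> -` B)"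
        by (simp add: set_lebesgue_integral_def flip: indicator_inter_arith)
      also have "\<dots> = (\<integral>\<omega>\<in>C. measure \<pi> (\<eta> -` B) \<partial>\<pi>)"
        using indep[OF C'(1) B] C'(2) assms(2) by (simp add: set_lebesgue_integral_def)
      finally show "(\<integral>\<omega>\<in>C. indicat_real (\<eta> -` B) \<omega> \<partial>\<pi>) = (\<integral>\<omega>\<in>C. measure \<pi> (\<eta> -` B) \<partial>\<pi>)" .
    qed (auto simp: less_top[symmetric])
  qed
  show "AE \<omega> in \<pi>. real_cond_exp \<pi> (coord_sigma \<xi> UNIV) (indicator {\<omega>. (\<lambda>s\<in>{..t}. \<eta> \<omega> $ s) \<in> A}) \<omega>
      = real_cond_exp \<pi> (coord_sigma \<xi> {..t}) (indicator {\<omega>. (\<lambda>s\<in>{..t}. \<eta> \<omega> $ s) \<in> A}) \<omega>"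
    unfolding eB using *[of UNIV] *[of "{..t}"] by eventually_elim simp
qed

section \<open>Couplings and the adapted Wasserstein distance\<close>

lemma couplingsD:
  assumes "\<pi> \<in> couplings P Q"
  shows "prob_space \<pi>" "sets \<pi> = sets borel" "space \<pi> = UNIV"
    "fst \<in> borel_measurable \<pi>" "snd \<in> borel_measurable \<pi>"
    "distr \<pi> borel fst = P" "distr \<pi> borel snd = Q"
proof -
  show "prob_space \<pi>" and s: "sets \<pi> = sets borel" and "distr \<pi> borel fst = P" "distr \<pi> borel snd = Q"
    using assms by (auto simp: couplings_def)
  show "space \<pi> = UNIV" using sets_eq_imp_space_eq[OF s] by simp
  show "fst \<in> borel_measurable \<pi>" "snd \<in> borel_measurable \<pi>"
    by (simp_all add: measurable_cong_sets[OF s refl] borel_measurable_continuous_onI continuous_intros)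
qed

lemma P_pD:
  assumes "Q \<in> P_p p"
  shows "prob_space Q" "sets Q = sets borel" "space Q = UNIV" "integrable Q (\<lambda>x. norm x powr p)"
  using assms sets_eq_imp_space_eq[of Q borel] by (auto simp: P_p_def)

text \<open>An adapted transport map with an adapted left inverse induces a bicausal coupling.\<close>

lemma graph_bicausal:
  fixes \<Phi> \<Theta> :: "'n::{finite,linorder} path \<Rightarrow> 'n path"
  assumes "prob_space P" and P [measurable_cong]: "sets P = sets borel"
    and [measurable]: "\<Phi> \<in> borel_measurable borel" "\<Theta> \<in> borel_measurable borel"
    and dep: "\<And>t. depends_on {..t} (\<lambda>x. \<Phi> x $ t)" "\<And>t. depends_on {..t} (\<lambda>y. \<Theta> y $ t)"
    and inv: "\<And>x. \<Theta> (\<Phi> x) = x"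
  shows "distr P borel (\<lambda>x. (x, \<Phi> x)) \<in> bicausal_couplings P (distr P borel \<Phi>)"
proof -
  interpret prob_space P by fact
  let ?f = "\<lambda>x. (x, \<Phi> x)"
  let ?\<pi> = "distr P borel ?f"
  have [measurable]: "fst \<in> borel_measurable (borel :: ('n path \<times> 'n path) measure)"
    "snd \<in> borel_measurable (borel :: ('n path \<times> 'n path) measure)"
    by (simp_all add: borel_measurable_continuous_onI continuous_intros)
  have f [measurable]: "?f \<in> borel_measurable P"
    by (simp add: borel_prod[symmetric])
  have "prob_space ?\<pi>" by (rule prob_space_distr) simp
  moreover have "?\<pi> \<in> couplings P (distr P borel \<Phi>)"
    using \<open>prob_space ?\<pi>\<close> distr_id2[OF P[symmetric]]
    by (simp add: couplings_def distr_distr comp_def id_def)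
  moreover have "causal ?\<pi> fst snd"
    by (rule causal_graph[OF \<open>prob_space ?\<pi>\<close>, where \<Phi> = \<Phi>]) (simp_all add: dep AE_distr_iff)
  moreover have "causal ?\<pi> snd fst"
    by (rule causal_graph[OF \<open>prob_space ?\<pi>\<close>, where \<Phi> = \<Theta>]) (simp_all add: dep inv AE_distr_iff)
  ultimately show ?thesis by (simp add: bicausal_couplings_def)
qed

text \<open>The independent coupling is bicausal; in particular the infimum defining the adapted
Wasserstein distance ranges over a nonempty set.\<close>

lemma product_bicausal:
  fixes P Q :: "'n::{finite,linorder} path measure"
  assumes "prob_space P" "prob_space Q" and P: "sets P = sets borel" and Q: "sets Q = sets borel"
  shows "P \<Otimes>\<^sub>M Q \<in> bicausal_couplings P Q"
proof -
  interpret P: prob_space P by fact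
  interpret Q: prob_space Q by fact
  interpret PQ: pair_prob_space P Q ..
  have s [measurable_cong]: "sets (P \<Otimes>\<^sub>M Q) = sets borel"
    unfolding borel_prod[symmetric] by (rule sets_pair_measure_cong[OF P Q])
  have sp: "space P = UNIV" "space Q = UNIV" "space (P \<Otimes>\<^sub>M Q) = UNIV"
    using sets_eq_imp_space_eq[OF P] sets_eq_imp_space_eq[OF Q] sets_eq_imp_space_eq[OF s] by auto
  have m: "fst \<in> borel_measurable (P \<Otimes>\<^sub>M Q)" "snd \<in> borel_measurable (P \<Otimes>\<^sub>M Q)"
    using measurable_fst[of P Q] measurable_snd[of P Q]
    by (simp_all add: measurable_cong_sets[OF refl P] measurable_cong_sets[OF refl Q])
  have rect: "measure (P \<Otimes>\<^sub>M Q) (A \<times> B) = measure P A * measure Q B"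
    if "A \<in> sets borel" "B \<in> sets borel" for A B
    using that P Q by (simp add: measure_def Q.emeasure_pair_measure_Times enn2real_mult)
  have one: "measure P UNIV = 1" "measure Q UNIV = 1"
    using P.prob_space Q.prob_space sp by simp_all
  have fst: "measure (P \<Otimes>\<^sub>M Q) (fst -` A) = measure P A" if "A \<in> sets borel" for A
    using rect[OF that, of UNIV] Q.prob_space sp by (simp add: vimage_fst)
  have snd: "measure (P \<Otimes>\<^sub>M Q) (snd -` A) = measure Q A" if "A \<in> sets borel" for A
    using rect[OF _ that, of UNIV] P.prob_space sp by (simp add: vimage_snd)
  have "distr (P \<Otimes>\<^sub>M Q) borel fst = P"
    by (rule measure_eqI)
      (simp_all add: P emeasure_distr m sp PQ.emeasure_eq_measure P.emeasure_eq_measure fst)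
  moreover have "distr (P \<Otimes>\<^sub>M Q) borel snd = Q"
    by (rule measure_eqI)
      (simp_all add: Q emeasure_distr m sp PQ.emeasure_eq_measure Q.emeasure_eq_measure snd)
  ultimately have "P \<Otimes>\<^sub>M Q \<in> couplings P Q"
    using PQ.prob_space_axioms s by (simp add: couplings_def)
  moreover have "causal (P \<Otimes>\<^sub>M Q) fst snd"
    using rect one
    by (intro causal_indep) (simp_all add: PQ.prob_space_axioms m sp vimage_fst vimage_snd Times_Int_Times)
  moreover have "causal (P \<Otimes>\<^sub>M Q) snd fst"
    using rect one
    by (intro causal_indep) (simp_all add: PQ.prob_space_axioms m sp vimage_fst vimage_snd Times_Int_Times)
  ultimately show ?thesis by (simp add: bicausal_couplings_def)
qed

lemma AW_le:
  assumes "\<pi> \<in> bicausal_couplings P Q"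
  shows "AW p P Q \<le> (\<Sum>t\<in>UNIV. \<integral>\<omega>. \<bar>fst \<omega> $ t - snd \<omega> $ t\<bar> powr p \<partial>\<pi>) powr (1 / p)"
  unfolding AW_def by (rule cINF_lower[OF _ assms]) (auto intro!: bdd_belowI2[of _ 0])

lemma AW_less_imp_coupling:
  assumes "Q \<in> P_p p" "P \<in> P_p p" "AW p P Q < r"
  obtains \<pi> where "\<pi> \<in> bicausal_couplings P Q"
    "(\<Sum>t\<in>UNIV. \<integral>\<omega>. \<bar>fst \<omega> $ t - snd \<omega> $ t\<bar> powr p \<partial>\<pi>) powr (1 / p) < r"
proof -
  have "bicausal_couplings P Q \<noteq> {}"
    using product_bicausal[of P Q] assms P_pD by blast
  moreover have "bdd_below ((\<lambda>\<pi>. (\<Sum>t\<in>UNIV. \<integral>\<omega>. \<bar>fst \<omega> $ t - snd \<omega> $ t\<bar> powr p \<partial>\<pi>) powr (1 / p)) ` bicausal_couplings P Q)"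
    by (auto intro!: bdd_belowI2[of _ 0])
  ultimately show ?thesis using assms(3) that unfolding AW_def
    by (subst (asm) cINF_less_iff) auto
qed

text \<open>Conditional expectations of functions of \<open>\<xi>\<close> can be computed under the law of \<open>\<xi>\<close>.\<close>

lemma real_cond_exp_image:
  fixes \<xi> :: "'w \<Rightarrow> 'n::{finite,linorder} path" and k :: "'n path \<Rightarrow> real"
  assumes "prob_space \<pi>" "space \<pi> = UNIV" and [measurable]: "\<xi> \<in> borel_measurable \<pi>"
    and P: "distr \<pi> borel \<xi> = P" and k: "integrable P k"
  shows "AE \<omega> in \<pi>. real_cond_exp \<pi> (coord_sigma \<xi> S) (\<lambda>\<omega>. k (\<xi> \<omega>)) \<omega>
    = real_cond_exp P (coord_sigma (\<lambda>x. x) S) k (\<xi> \<omega>)"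
proof -
  interpret prob_space \<pi> by fact
  interpret P: prob_space P unfolding P[symmetric] by (rule prob_space_distr) simp
  have sP [measurable_cong]: "sets P = sets borel" and spP: "space P = UNIV"
    unfolding P[symmetric] by simp_all
  interpret finite_measure_subalgebra \<pi> "coord_sigma \<xi> S"
    by (unfold_locales, rule subalgebra_coord_sigma; simp add: assms)
  interpret S: finite_measure_subalgebra P "coord_sigma (\<lambda>x. x) S"
    by (unfold_locales, rule subalgebra_coord_sigma; simp add: spP)
  let ?H = "real_cond_exp P (coord_sigma (\<lambda>x. x) S) k"
  have [measurable]: "k \<in> borel_measurable borel"
    using borel_measurable_integrable[OF k] by (simp add: measurable_cong_sets[OF sP refl])
  have H: "?H \<in> borel_measurable borel" "depends_on S ?H"
    using depends_on_natural[of ?H S] by simp_all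
  note [measurable] = H(1)
  have intH: "integrable P ?H" using k by (rule S.real_cond_exp_int)
  have push: "(\<integral>\<omega>. f (\<xi> \<omega>) \<partial>\<pi>) = (\<integral>x. f x \<partial>P)" "integrable \<pi> (\<lambda>\<omega>. f (\<xi> \<omega>)) \<longleftrightarrow> integrable P f"
    if "f \<in> borel_measurable borel" for f :: "'n path \<Rightarrow> real"
    using that unfolding P[symmetric] by (simp_all add: integral_distr integrable_distr_eq)
  show ?thesis
  proof (rule real_cond_exp_charact)
    fix B assume "B \<in> sets (coord_sigma \<xi> S)"
    then obtain B' where B': "B' \<in> sets (coord_sigma (\<lambda>x. x) S)" "B = \<xi> -` B'"
      using sets_coord_sigma_natural by blast
    hence [measurable]: "B' \<in> sets borel" using S.subalg by (auto simp: subalgebra_def sP)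
    have eq: "indicator B \<omega> = (indicator B' (\<xi> \<omega>) :: real)" for \<omega>
      by (simp add: B' indicator_def)
    have "(\<integral>\<omega>\<in>B. k (\<xi> \<omega>) \<partial>\<pi>) = (\<integral>x\<in>B'. k x \<partial>P)"
      unfolding set_lebesgue_integral_def eq by (rule push) simp
    also have "\<dots> = (\<integral>x\<in>B'. ?H x \<partial>P)"
      by (rule S.real_cond_exp_intA[OF k B'(1)])
    also have "\<dots> = (\<integral>\<omega>\<in>B. ?H (\<xi> \<omega>) \<partial>\<pi>)"
      unfolding set_lebesgue_integral_def eq by (rule push(1)[symmetric]) simp
    finally show "(\<integral>\<omega>\<in>B. k (\<xi> \<omega>) \<partial>\<pi>) = (\<integral>\<omega>\<in>B. ?H (\<xi> \<omega>) \<partial>\<pi>)" .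
  next
    show "integrable \<pi> (\<lambda>\<omega>. k (\<xi> \<omega>))" "integrable \<pi> (\<lambda>\<omega>. ?H (\<xi> \<omega>))"
      using k intH by (simp_all add: push)
    show "(\<lambda>\<omega>. ?H (\<xi> \<omega>)) \<in> borel_measurable (coord_sigma \<xi> S)"
      by (rule borel_measurable_coord_sigma) (simp_all add: H)
  qed
qed

lemma depends_on_UNIV [simp]: "depends_on UNIV f"
  unfolding depends_on_def by (metis UNIV_I vec_eq_iff)

lemma causal_integral_cond_exp:
  fixes \<xi> \<eta> :: "'w \<Rightarrow> 'n::{finite,linorder} path" and k :: "'n path \<Rightarrow> real"
  assumes "prob_space \<pi>" "space \<pi> = UNIV"
    and [measurable]: "\<xi> \<in> borel_measurable \<pi>" "\<eta> \<in> borel_measurable \<pi>"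
    and causal: "causal \<pi> \<xi> \<eta>"
    and P: "distr \<pi> borel \<xi> = P" and k: "integrable P k"
    and th: "\<theta> \<in> borel_measurable (coord_sigma \<eta> {..t})"
    and int: "integrable \<pi> (\<lambda>\<omega>. \<theta> \<omega> * k (\<xi> \<omega>))"
      "integrable \<pi> (\<lambda>\<omega>. \<theta> \<omega> * real_cond_exp P (coord_sigma (\<lambda>x. x) {..t}) k (\<xi> \<omega>))"
  shows "(\<integral>\<omega>. \<theta> \<omega> * k (\<xi> \<omega>) \<partial>\<pi>)
    = (\<integral>\<omega>. \<theta> \<omega> * real_cond_exp P (coord_sigma (\<lambda>x. x) {..t}) k (\<xi> \<omega>) \<partial>\<pi>)"
proof -
  interpret prob_space \<pi> by fact
  interpret P: prob_space P unfolding P[symmetric] by (rule prob_space_distr) simp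
  have sP [measurable_cong]: "sets P = sets borel" and spP: "space P = UNIV"
    unfolding P[symmetric] by simp_all
  interpret finite_measure_subalgebra \<pi> "coord_sigma \<xi> {..t}"
    by (unfold_locales, rule subalgebra_coord_sigma; simp add: assms)
  interpret S: finite_measure_subalgebra P "coord_sigma (\<lambda>x. x) {..t}"
    by (unfold_locales, rule subalgebra_coord_sigma; simp add: spP)
  let ?H = "real_cond_exp P (coord_sigma (\<lambda>x. x) {..t}) k"
  have [measurable]: "k \<in> borel_measurable borel"
    using borel_measurable_integrable[OF k] by (simp add: measurable_cong_sets[OF sP refl])
  have H: "?H \<in> borel_measurable borel" "depends_on {..t} ?H"
    using depends_on_natural[of ?H "{..t}"] by simp_all
  note [measurable] = H(1)
  have "integrable P ?H" using k by (rule S.real_cond_exp_int)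
  hence i: "integrable \<pi> (\<lambda>\<omega>. k (\<xi> \<omega>))" "integrable \<pi> (\<lambda>\<omega>. ?H (\<xi> \<omega>))"
    using k unfolding P[symmetric] by (simp_all add: integrable_distr_eq)
  have "AE \<omega> in \<pi>. real_cond_exp \<pi> (coord_sigma \<xi> {..t}) (\<lambda>\<omega>. ?H (\<xi> \<omega>)) \<omega> = ?H (\<xi> \<omega>)"
    by (rule real_cond_exp_F_meas[OF i(2)]) (rule borel_measurable_coord_sigma[OF H])
  hence z: "AE \<omega> in \<pi>. real_cond_exp \<pi> (coord_sigma \<xi> {..t}) (\<lambda>\<omega>. k (\<xi> \<omega>) - ?H (\<xi> \<omega>)) \<omega> = 0"
    using real_cond_exp_diff[OF i] real_cond_exp_image[OF assms(1-3) P k, of "{..t}"]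
    by eventually_elim simp
  have "(\<integral>\<omega>. \<theta> \<omega> * (k (\<xi> \<omega>) - ?H (\<xi> \<omega>)) \<partial>\<pi>) = 0"
  proof (rule causal_integral_eq_0[OF assms(1-5) _ _ z th])
    show "(\<lambda>\<omega>. k (\<xi> \<omega>) - ?H (\<xi> \<omega>)) \<in> borel_measurable (coord_sigma \<xi> UNIV)"
      by (rule borel_measurable_coord_sigma) simp_all
  qed (use i int in \<open>simp_all add: right_diff_distrib\<close>)
  thus ?thesis using int by (simp add: right_diff_distrib)
qed

lemma controlsD:
  assumes "a \<in> controls L"
  shows "a t \<in> borel_measurable borel" "depends_on {..<t} (a t)" "\<bar>a t x\<bar> \<le> L"
  using assms by (auto simp: controls_def depends_on_def)

lemma controlsI:
  fixes a :: "'n::{finite,linorder} \<Rightarrow> 'n path \<Rightarrow> real"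
  assumes "\<And>t. a t \<in> borel_measurable borel" "\<And>t. depends_on {..<t} (a t)" "\<And>t x. \<bar>a t x\<bar> \<le> L"
  shows "a \<in> controls L"
  unfolding controls_def
proof (intro CollectI allI conjI impI)
  fix t :: 'n and x y :: "'n path" assume "\<forall>s<t. x $ s = y $ s"
  thus "a t x = a t y" using depends_onD[OF assms(2), of t x y] by simp
qed (use assms in auto)

lemma depends_on_mono: "S \<subseteq> S' \<Longrightarrow> depends_on S f \<Longrightarrow> depends_on S' f"
  unfolding depends_on_def by (meson subsetD)

lemma lessThan_eq_atMost_Max:
  fixes t :: "'n::{finite,linorder}"
  assumes "{..<t} \<noteq> {}"
  shows "{..<t} = {..Max {..<t}}"
proof -
  have "Max {..<t} < t" using Max_in[of "{..<t}"] assms by simp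
  thus ?thesis by (auto intro: Max_ge)
qed

text \<open>A control for the first marginal is transported to one for the second by conditioning on the
second process. By causality, conditioning on all of \<open>Y\<close> and on its past gives the same result, so
\<open>b\<close> is predictable and represents \<open>a(X)\<close> against every integrable functional of \<open>Y\<close>.\<close>

lemma causal_predictable_projection:
  fixes a :: "'n::{finite,linorder} \<Rightarrow> 'n path \<Rightarrow> real"
  assumes \<pi>: "\<pi> \<in> couplings P Q" and causal: "causal \<pi> snd fst"
    and a: "a \<in> controls L"
  obtains b where "b \<in> controls L"
    "\<And>t k. integrable Q k \<Longrightarrow>
      (\<integral>\<omega>. a t (fst \<omega>) * k (snd \<omega>) \<partial>\<pi>) = (\<integral>\<omega>. b t (snd \<omega>) * k (snd \<omega>) \<partial>\<pi>)"
proof -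
  note c = couplingsD[OF \<pi>]
  note [measurable_cong] = c(2) and [measurable] = c(4,5)
  interpret prob_space \<pi> by (rule c)
  interpret Q: prob_space Q unfolding c(7)[symmetric] by (rule prob_space_distr) simp
  have sQ [measurable_cong]: "sets Q = sets borel" unfolding c(7)[symmetric] by simp
  note [measurable] = controlsD(1)[OF a]
  define good where "good t b \<longleftrightarrow> b \<in> borel_measurable borel \<and> depends_on {..<t} b \<and> (\<forall>x. \<bar>b x\<bar> \<le> L) \<and>
      (\<forall>k. integrable Q k \<longrightarrow> (\<integral>\<omega>. a t (fst \<omega>) * k (snd \<omega>) \<partial>\<pi>) = (\<integral>\<omega>. b (snd \<omega>) * k (snd \<omega>) \<partial>\<pi>))" for t b
  have "\<exists>b. good t b" for t
  proof (cases "{..<t} = {}")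
    case True
    hence "a t x = a t y" for x y
      using depends_onD[OF controlsD(2)[OF a], of t x y] by blast
    hence "a t (fst \<omega>) = a t (snd \<omega>)" for \<omega> by blast
    thus ?thesis unfolding good_def using controlsD[OF a] by (intro exI[of _ "a t"]) auto
  next
    case False
    define s where "s = Max {..<t}"
    have ts: "{..<t} = {..s}" unfolding s_def by (rule lessThan_eq_atMost_Max[OF False])
    interpret S: finite_measure_subalgebra \<pi> "coord_sigma snd {..s}"
      by (unfold_locales, rule subalgebra_coord_sigma; simp add: c)
    have ia: "integrable \<pi> (\<lambda>\<omega>. a t (fst \<omega>))"
      by (rule integrable_const_bound[of _ L]) (auto simp: controlsD[OF a])
    define f0 where "f0 = real_cond_exp \<pi> (coord_sigma snd {..s}) (\<lambda>\<omega>. a t (fst \<omega>))"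
    define f where "f \<omega> = max (- L) (min L (f0 \<omega>))" for \<omega>
    \<comment> \<open>\<open>f\<close> does not depend on the first component, so any value, here zero, may be inserted there.\<close>
    define b where "b y = f (0, y)" for y
    have f0 [measurable]: "f0 \<in> borel_measurable (coord_sigma snd {..s})" "f0 \<in> borel_measurable \<pi>"
      by (simp_all add: f0_def)
    have f [measurable]: "f \<in> borel_measurable (coord_sigma snd {..s})" "f \<in> borel_measurable \<pi>"
      unfolding f_def by measurable
    have fb: "f \<omega> = b (snd \<omega>)" for \<omega>
      unfolding b_def by (rule coord_sigma_saturated[OF f(1)]) simp
    have "f \<in> borel_measurable borel"
      using f(2) by (simp add: measurable_cong_sets[OF c(2) refl])
    hence b1 [measurable]: "b \<in> borel_measurable borel"
      unfolding b_def by (rule measurable_compose[rotated])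
        (auto intro!: borel_measurable_continuous_onI continuous_intros)
    have b2: "depends_on {..<t} b"
      unfolding depends_on_def ts b_def using coord_sigma_saturated[OF f(1)] by (metis snd_conv)
    have L: "L \<ge> 0" using controlsD(3)[OF a, of t 0] by simp
    have b3: "\<bar>b x\<bar> \<le> L" for x
      using L by (auto simp: b_def f_def)
    have "AE \<omega> in \<pi>. - L \<le> f0 \<omega>" "AE \<omega> in \<pi>. f0 \<omega> \<le> L"
    proof -
      have "- L \<le> a t x" "a t x \<le> L" for x
        using controlsD(3)[OF a, of t x] by auto
      thus "AE \<omega> in \<pi>. - L \<le> f0 \<omega>" "AE \<omega> in \<pi>. f0 \<omega> \<le> L"
        unfolding f0_def by (simp_all add: S.real_cond_exp_ge_c[OF ia] S.real_cond_exp_le_c[OF ia])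
    qed
    hence ff0: "AE \<omega> in \<pi>. f0 \<omega> = b (snd \<omega>)"
      by eventually_elim (simp add: fb[symmetric] f_def)
    \<comment> \<open>Causality replaces \<open>k\<close> by its conditional expectation \<open>?K\<close> given the past of \<open>Y\<close>; then the
      conditional expectation is moved first to \<open>a\<close> and finally off \<open>k\<close>.\<close>
    have "(\<integral>\<omega>. a t (fst \<omega>) * k (snd \<omega>) \<partial>\<pi>) = (\<integral>\<omega>. b (snd \<omega>) * k (snd \<omega>) \<partial>\<pi>)" if k: "integrable Q k" for k
    proof -
      have [measurable]: "k \<in> borel_measurable borel"
        using borel_measurable_integrable[OF k] by (simp add: measurable_cong_sets[OF sQ refl])
      have ik: "integrable \<pi> (\<lambda>\<omega>. k (snd \<omega>))"
        using k unfolding c(7)[symmetric] by (simp add: integrable_distr_eq)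
      have bdd: "integrable \<pi> (\<lambda>\<omega>. h \<omega> * u \<omega>)"
        if "integrable \<pi> u" "h \<in> borel_measurable \<pi>" "\<And>\<omega>. \<bar>h \<omega>\<bar> \<le> L" for h u :: "_ \<Rightarrow> real"
      proof (rule Bochner_Integration.integrable_bound)
        show "integrable \<pi> (\<lambda>\<omega>. L * u \<omega>)" using that by simp
        show "(\<lambda>\<omega>. h \<omega> * u \<omega>) \<in> borel_measurable \<pi>" using that by auto
        show "AE \<omega> in \<pi>. norm (h \<omega> * u \<omega>) \<le> norm (L * u \<omega>)"
          using that(3) L by (auto simp: abs_mult intro!: mult_right_mono)
      qed
      have i1: "integrable \<pi> (\<lambda>\<omega>. a t (fst \<omega>) * k (snd \<omega>))"
        by (intro bdd ik) (auto simp: controlsD[OF a])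
      let ?H = "real_cond_exp Q (coord_sigma (\<lambda>x. x) {..s}) k"
      let ?K = "real_cond_exp \<pi> (coord_sigma snd {..s}) (\<lambda>\<omega>. k (snd \<omega>))"
      have HK: "AE \<omega> in \<pi>. ?K \<omega> = ?H (snd \<omega>)"
        using real_cond_exp_image[OF c(1,3,5,7) k] .
      have Hm [measurable]: "?H \<in> borel_measurable borel"
        using depends_on_natural(1)[of ?H "{..s}"] by simp
      have iK: "integrable \<pi> ?K" using ik by (rule S.real_cond_exp_int)
      have i2: "integrable \<pi> (\<lambda>\<omega>. a t (fst \<omega>) * ?K \<omega>)"
        by (intro bdd iK) (auto simp: controlsD[OF a])
      have "integrable \<pi> (\<lambda>\<omega>. a t (fst \<omega>) * ?H (snd \<omega>))"
        by (rule integrable_cong_AE_imp[OF i2]) (use HK in \<open>auto elim: eventually_mono\<close>)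
      hence "(\<integral>\<omega>. a t (fst \<omega>) * k (snd \<omega>) \<partial>\<pi>) = (\<integral>\<omega>. a t (fst \<omega>) * ?H (snd \<omega>) \<partial>\<pi>)"
        using controlsD[OF a, of t]
        by (intro causal_integral_cond_exp[OF c(1,3,5,4) causal c(7) k _ i1] borel_measurable_coord_sigma)
          (simp_all add: ts)
      also have "\<dots> = (\<integral>\<omega>. ?K \<omega> * a t (fst \<omega>) \<partial>\<pi>)"
        using HK by (intro integral_cong_AE) (auto elim: eventually_mono)
      also have "\<dots> = (\<integral>\<omega>. ?K \<omega> * f0 \<omega> \<partial>\<pi>)"
        unfolding f0_def using i2 by (intro S.real_cond_exp_intg(2)[symmetric]) (simp_all add: mult.commute)
      also have "\<dots> = (\<integral>\<omega>. f \<omega> * ?K \<omega> \<partial>\<pi>)"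
        using ff0 by (intro integral_cong_AE) (auto elim!: eventually_mono simp: fb)
      also have "\<dots> = (\<integral>\<omega>. f \<omega> * k (snd \<omega>) \<partial>\<pi>)"
        using b3 by (intro S.real_cond_exp_intg(2) bdd ik f) (simp_all add: fb)
      finally show ?thesis by (simp add: fb)
    qed
    thus ?thesis unfolding good_def using b1 b2 b3 by blast
  qed
  hence "\<exists>b. \<forall>t. good t (b t)" by (intro choice) blast
  then obtain b where "good t (b t)" for t by blast
  thus ?thesis using that[of b] controlsI[of b L] unfolding good_def by blast
qed

section \<open>The hedging problem: growth and Taylor estimates\<close>

lemma prev_val_add: "prev_val x0 (x + d) t = prev_val x0 x t + prev_val 0 d t"
  by (simp add: prev_val_def)

lemma prev_val_scaleR: "prev_val 0 (r *\<^sub>R d) t = r * prev_val 0 d t"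
  by (simp add: prev_val_def)

lemma abs_prev_val_le: "\<bar>prev_val x0 x t\<bar> \<le> \<bar>x0\<bar> + norm x"
  using component_le_norm_cart[of x "Max {..<t}"] by (auto simp: prev_val_def)

lemma abs_increment_le:
  "\<bar>x $ t - prev_val x0 x t\<bar> \<le> (\<bar>x0\<bar> + 2) * (1 + norm x)"
proof -
  have "\<bar>x $ t - prev_val x0 x t\<bar> \<le> norm x + (\<bar>x0\<bar> + norm x)"
    using component_le_norm_cart[of x t] abs_prev_val_le[of x0 x t] by linarith
  also have "\<dots> \<le> (\<bar>x0\<bar> + 2) * (1 + norm x)" by (simp add: algebra_simps)
  finally show ?thesis .
qed

lemma borel_measurable_prev_val [measurable (raw)]:
  "f \<in> borel_measurable M \<Longrightarrow> (\<lambda>x. prev_val x0 (f x) t) \<in> borel_measurable M"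
  by (simp add: prev_val_def)

lemma depends_on_prev_val: "depends_on {..<t} (\<lambda>x. prev_val x0 x t)"
  unfolding depends_on_def prev_val_def using Max_in[of "{..<t}"] by auto

text \<open>The value following time \<open>t\<close>, zero after the last time.\<close>

definition next_val :: "('n::{finite,linorder} \<Rightarrow> real) \<Rightarrow> 'n \<Rightarrow> real" where
  "next_val \<alpha> t = (if {t<..} = {} then 0 else \<alpha> (Min {t<..}))"

lemma next_ctrl_eq: "next_ctrl a t x = next_val (\<lambda>s. a s x) t"
  by (simp add: next_ctrl_def next_val_def)

text \<open>Summation by parts turns increments of the path into increments of the control.\<close>

lemma summation_by_parts:
  fixes d :: "'n::{finite,linorder} path" and \<alpha> :: "'n \<Rightarrow> real"
  shows "(\<Sum>t\<in>UNIV. \<alpha> t * (d $ t - prev_val 0 d t)) = (\<Sum>t\<in>UNIV. d $ t * (\<alpha> t - next_val \<alpha> t))"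
proof -
  have Min_Max: "Min {Max {..<t}<..} = t" if "{..<t} \<noteq> {}" for t :: 'n
  proof (rule Min_eqI)
    show "t \<in> {Max {..<t}<..}" using Max_in[of "{..<t}"] that by simp
    show "t \<le> y" if "y \<in> {Max {..<t}<..}" for y
    proof (rule ccontr)
      assume "\<not> t \<le> y"
      hence "y \<le> Max {..<t}" by (intro Max_ge) auto
      thus False using that by simp
    qed
  qed simp
  have Max_Min: "Max {..<Min {t<..}} = t" if "{t<..} \<noteq> {}" for t :: 'n
  proof (rule Max_eqI)
    show "t \<in> {..<Min {t<..}}" using Min_in[of "{t<..}"] that by simp
    show "y \<le> t" if "y \<in> {..<Min {t<..}}" for y
    proof (rule ccontr)
      assume "\<not> y \<le> t"
      hence "Min {t<..} \<le> y" by (intro Min_le) auto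
      thus False using that by simp
    qed
  qed simp
  have "(\<Sum>t\<in>UNIV. \<alpha> t * prev_val 0 d t) = (\<Sum>t\<in>{t. {..<t} \<noteq> {}}. \<alpha> t * d $ Max {..<t})"
    by (rule sum.mono_neutral_cong_right) (auto simp: prev_val_def)
  also have "\<dots> = (\<Sum>t\<in>{t. {t<..} \<noteq> {}}. d $ t * \<alpha> (Min {t<..}))"
  proof (rule sum.reindex_bij_witness[of _ "\<lambda>t. Min {t<..}" "\<lambda>t. Max {..<t}"])
    fix t :: 'n assume "t \<in> {t. {..<t} \<noteq> {}}"
    hence t: "{..<t} \<noteq> {}" by simp
    show "Min {Max {..<t}<..} = t" by (rule Min_Max[OF t])
    have "t \<in> {Max {..<t}<..}" using Max_in[of "{..<t}"] t by simp
    thus "Max {..<t} \<in> {t. {t<..} \<noteq> {}}" by blast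
    show "d $ Max {..<t} * \<alpha> (Min {Max {..<t}<..}) = \<alpha> t * d $ Max {..<t}"
      by (simp add: Min_Max[OF t])
  next
    fix t :: 'n assume "t \<in> {t. {t<..} \<noteq> {}}"
    hence t: "{t<..} \<noteq> {}" by simp
    show "Max {..<Min {t<..}} = t" by (rule Max_Min[OF t])
    have "t \<in> {..<Min {t<..}}" using Min_in[of "{t<..}"] t by simp
    thus "Min {t<..} \<in> {t. {..<t} \<noteq> {}}" by blast
  qed
  also have "\<dots> = (\<Sum>t\<in>UNIV. d $ t * next_val \<alpha> t)"
    by (rule sum.mono_neutral_cong_left) (auto simp: next_val_def)
  finally show ?thesis by (simp add: right_diff_distrib sum_subtractf mult.commute)
qed

lemma powr_add_le:
  fixes u v r :: real
  assumes "u \<ge> 0" "v \<ge> 0" "r \<ge> 0"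
  shows "(u + v) powr r \<le> 2 powr r * (u powr r + v powr r)"
proof -
  have "(u + v) powr r \<le> (2 * max u v) powr r"
    using assms by (intro powr_mono2) auto
  also have "\<dots> = 2 powr r * max u v powr r"
    using assms by (simp add: powr_mult)
  also have "max u v powr r \<le> u powr r + v powr r"
    by (auto simp: max_def)
  finally show ?thesis by simp
qed

text \<open>The standing assumptions; positivity of the second derivative makes the loss strictly convex.\<close>

locale hedging =
  fixes p q L X0 c :: real
    and P :: "'n::{finite,linorder} path measure"
    and loss :: "real \<Rightarrow> real"
    and g :: "'n path \<Rightarrow> real"
    and g' :: "'n path \<Rightarrow> 'n path \<Rightarrow>\<^sub>L real"
  assumes p: "p > 1" and q: "q = p / (p - 1)"
    and P: "P \<in> P_p p"
    and L: "L \<ge> 0"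
    and bdd_loss: "bdd_below (range loss)"
    and loss_diff: "\<And>u. loss differentiable (at u)"
    and loss'_diff: "\<And>u. deriv loss differentiable (at u)"
    and loss''_pos: "\<And>u. deriv (deriv loss) u > 0"
    and c: "c > 0"
    and loss'_growth: "\<And>u. \<bar>deriv loss u\<bar> \<le> c * (1 + \<bar>u\<bar> powr (p - 1))"
    and g_deriv: "\<And>x. (g has_derivative blinfun_apply (g' x)) (at x)"
    and g'_cont: "continuous_on UNIV g'"
    and g'_bdd: "bounded (range g')"
    and no_ties: "\<And>t. measure P {x. prev_val X0 x t = x $ t} = 0"
begin

lemma loss_deriv: "(loss has_real_derivative deriv loss u) (at u)"
  using loss_diff[of u] by (simp add: DERIV_deriv_iff_real_differentiable)

lemma loss'_deriv: "(deriv loss has_real_derivative deriv (deriv loss) u) (at u)"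
  using loss'_diff[of u] by (simp add: DERIV_deriv_iff_real_differentiable)

lemma loss_cont: "continuous_on UNIV loss" and loss'_cont: "continuous_on UNIV (deriv loss)"
  using loss_diff loss'_diff
  by (auto intro!: differentiable_imp_continuous_on differentiable_at_imp_differentiable_on)

lemma loss'_strict_mono:
  assumes "u < v"
  shows "deriv loss u < deriv loss v"
  using assms
proof (rule DERIV_pos_imp_increasing)
  show "\<exists>y. (deriv loss has_real_derivative y) (at x) \<and> 0 < y" for x
    by (rule exI[of _ "deriv (deriv loss) x"]) (rule conjI[OF loss'_deriv loss''_pos])
qed

lemma loss_above_tangent:
  assumes "u \<noteq> v"
  shows "loss v > loss u + deriv loss u * (v - u)"
proof (cases "u < v")
  case True
  obtain z where z: "u < z" "z < v" "loss v - loss u = (v - u) * deriv loss z"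
    using MVT2[OF True, of loss "deriv loss"] loss_deriv by blast
  have "(v - u) * deriv loss u < (v - u) * deriv loss z"
    using loss'_strict_mono[OF z(1)] True by simp
  thus ?thesis using z(3) by (simp add: algebra_simps)
next
  case False
  hence uv: "v < u" using assms by simp
  obtain z where z: "v < z" "z < u" "loss u - loss v = (u - v) * deriv loss z"
    using MVT2[OF uv, of loss "deriv loss"] loss_deriv by blast
  have "(u - v) * deriv loss z < (u - v) * deriv loss u"
    using loss'_strict_mono[OF z(2)] uv by simp
  thus ?thesis using z(3) by (simp add: algebra_simps)
qed

lemma loss_ge_tangent: "loss v \<ge> loss u + deriv loss u * (v - u)"
  using loss_above_tangent[of u v] by (cases "u = v") auto

text \<open>The terminal position as a jointly continuous function of a vector \<open>\<alpha>\<close> of control values and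
a path \<open>y\<close>. Separating the two arguments gives estimates that are uniform in the control values, although
controls are merely measurable in the path.\<close>

definition gain :: "'n path \<times> 'n path \<Rightarrow> real" where
  "gain = (\<lambda>(\<alpha>, y). g y + (\<Sum>t\<in>UNIV. \<alpha> $ t * (y $ t - prev_val X0 y t)))"

text \<open>The vector of all control values at a given path.\<close>

definition ctrl_vec :: "('n \<Rightarrow> 'n path \<Rightarrow> real) \<Rightarrow> 'n path \<Rightarrow> 'n path" where
  "ctrl_vec a x = (\<chi> t. a t x)"

text \<open>The compact set of admissible control values.\<close>

definition cube :: "'n path set" where "cube = {\<alpha>. \<forall>t. \<bar>\<alpha> $ t\<bar> \<le> L}"

lemma payoff_eq_gain: "payoff X0 g a x = gain (ctrl_vec a x, x)"
  by (simp add: payoff_def gain_def ctrl_vec_def)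

lemma ctrl_vec_cube: "a \<in> controls L \<Longrightarrow> ctrl_vec a x \<in> cube"
  by (simp add: cube_def ctrl_vec_def controlsD)

lemma compact_cube: "compact cube"
proof -
  have "cube = cbox (\<chi> t. - L) (\<chi> t. L)"
    by (auto simp: cube_def mem_box_cart abs_le_iff minus_le_iff)
  thus ?thesis by simp
qed

lemma bounded_linear_increment: "bounded_linear (\<lambda>d :: 'n path. d $ t - prev_val 0 d t)"
  by (cases "{..<t} = {}")
    (auto simp: prev_val_def intro!: bounded_linear_sub bounded_linear_vec_nth)

text \<open>The increment of a path at time \<open>t\<close> as a bounded linear functional; the first increment is the first
coordinate.\<close>

definition increment_blinfun :: "'n \<Rightarrow> 'n path \<Rightarrow>\<^sub>L real" where
  "increment_blinfun t = Blinfun (\<lambda>d. d $ t - prev_val 0 d t)"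

lemma increment_blinfun_apply [simp]: "blinfun_apply (increment_blinfun t) d = d $ t - prev_val 0 d t"
  unfolding increment_blinfun_def by (simp add: bounded_linear_Blinfun_apply bounded_linear_increment)

text \<open>The derivatives of \<^term>\<open>gain\<close> and of the loss of \<^term>\<open>gain\<close> in the path
argument, for fixed control values.\<close>

definition gain' :: "'n path \<times> 'n path \<Rightarrow> 'n path \<Rightarrow>\<^sub>L real" where
  "gain' = (\<lambda>(\<alpha>, y). g' y + (\<Sum>t\<in>UNIV. \<alpha> $ t *\<^sub>R increment_blinfun t))"

definition cost' :: "'n path \<times> 'n path \<Rightarrow> 'n path \<Rightarrow>\<^sub>L real" where
  "cost' z = deriv loss (gain z) *\<^sub>R gain' z"

lemma gain'_apply:
  "blinfun_apply (gain' (\<alpha>, y)) d = blinfun_apply (g' y) d + (\<Sum>t\<in>UNIV. \<alpha> $ t * (d $ t - prev_val 0 d t))"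
  by (simp add: gain'_def blinfun.add_left blinfun.sum_left blinfun.scaleR_left)

lemma g_cont: "continuous_on UNIV g"
  using g_deriv by (meson has_derivative_continuous continuous_at_imp_continuous_on)

lemma gain_cont: "continuous_on UNIV gain"
proof -
  have "continuous_on UNIV (\<lambda>z :: 'n path \<times> 'n path. prev_val X0 (snd z) t)" for t
    by (cases "{..<t} = {}") (auto simp: prev_val_def intro!: continuous_intros)
  thus ?thesis unfolding gain_def case_prod_beta
    by (auto intro!: continuous_intros continuous_on_compose2[OF g_cont])
qed

lemma cost'_cont: "continuous_on UNIV cost'"
  unfolding cost'_def gain'_def case_prod_beta
  by (intro continuous_intros continuous_on_compose2[OF loss'_cont gain_cont]
      continuous_on_compose2[OF g'_cont]) auto

lemma gain_add: "gain (\<alpha>, x + d) = gain (\<alpha>, x) + (g (x + d) - g x) + (\<Sum>t\<in>UNIV. \<alpha> $ t * (d $ t - prev_val 0 d t))"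
  unfolding gain_def prod.case prev_val_add[of X0 x d]
  by (simp add: algebra_simps sum.distrib sum_subtractf)

lemma cost_deriv:
  "((\<lambda>s. loss (gain (\<alpha>, x + s *\<^sub>R d))) has_real_derivative blinfun_apply (cost' (\<alpha>, x + s *\<^sub>R d)) d) (at s)"
proof -
  have "((\<lambda>s. g (x + s *\<^sub>R d)) has_derivative (\<lambda>h. blinfun_apply (g' (x + s *\<^sub>R d)) (h *\<^sub>R d))) (at s)"
    by (rule has_derivative_compose[OF _ g_deriv]) (auto intro!: derivative_eq_intros)
  hence g1: "((\<lambda>s. g (x + s *\<^sub>R d)) has_real_derivative blinfun_apply (g' (x + s *\<^sub>R d)) d) (at s)"
    unfolding has_field_derivative_def by (rule has_derivative_eq_rhs)
      (simp add: fun_eq_iff blinfun.scaleR_right)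
  have eq: "gain (\<alpha>, x + s *\<^sub>R d) = g (x + s *\<^sub>R d) + (gain (\<alpha>, x) - g x) + s * (\<Sum>t\<in>UNIV. \<alpha> $ t * (d $ t - prev_val 0 d t))" for s
    unfolding gain_add by (simp add: prev_val_scaleR sum_distrib_left algebra_simps)
  have "((\<lambda>s. gain (\<alpha>, x + s *\<^sub>R d)) has_real_derivative blinfun_apply (gain' (\<alpha>, x + s *\<^sub>R d)) d) (at s)"
    unfolding eq gain'_apply by (auto intro!: derivative_eq_intros g1)
  from DERIV_chain2[OF loss_deriv this] show ?thesis
    by (simp add: cost'_def blinfun.scaleR_left)
qed

lemma cost_mean_value:
  "\<exists>s\<in>{0<..<1}. loss (gain (\<alpha>, x + d)) - loss (gain (\<alpha>, x)) = blinfun_apply (cost' (\<alpha>, x + s *\<^sub>R d)) d"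
  using MVT2[of 0 1 "\<lambda>s. loss (gain (\<alpha>, x + s *\<^sub>R d))" "\<lambda>s. blinfun_apply (cost' (\<alpha>, x + s *\<^sub>R d)) d"]
    cost_deriv[of \<alpha> x d] by auto

lemma gain_bound:
  obtains A where "A > 0" "\<And>\<alpha> x. \<alpha> \<in> cube \<Longrightarrow> \<bar>gain (\<alpha>, x)\<bar> \<le> A * (1 + norm x)"
    "\<And>\<alpha> x. \<alpha> \<in> cube \<Longrightarrow> norm (gain' (\<alpha>, x)) \<le> A"
proof -
  obtain B where B: "\<And>x. norm (g' x) \<le> B" using g'_bdd by (auto simp: bounded_iff)
  have B0: "B \<ge> 0" using B[of 0] norm_ge_zero order_trans by blast
  have g_bound: "\<bar>g x\<bar> \<le> \<bar>g 0\<bar> + B * norm x" for x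
  proof -
    have "norm (g x - g 0) \<le> B * norm (x - 0)"
      by (rule differentiable_bound[of UNIV g "\<lambda>x. blinfun_apply (g' x)"])
        (use g_deriv B in \<open>auto simp: norm_blinfun.rep_eq[symmetric]\<close>)
    thus ?thesis by simp
  qed
  define N where "N = real CARD('n)"
  define A where "A = 1 + \<bar>g 0\<bar> + B + N * (L * (\<bar>X0\<bar> + 2)) + (\<Sum>t\<in>UNIV. L * norm (increment_blinfun t))"
  have pos: "0 \<le> N * (L * (\<bar>X0\<bar> + 2))" "0 \<le> (\<Sum>t\<in>UNIV. L * norm (increment_blinfun t))"
    using L by (auto simp: N_def intro!: sum_nonneg mult_nonneg_nonneg)
  show thesis
  proof (rule that[of A])
    show "A > 0" using B0 pos by (simp add: A_def add_pos_nonneg)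
    fix \<alpha> x assume \<alpha>: "\<alpha> \<in> cube"
    have "\<bar>\<alpha> $ t * (x $ t - prev_val X0 x t)\<bar> \<le> L * ((\<bar>X0\<bar> + 2) * (1 + norm x))" for t
      unfolding abs_mult using \<alpha> L abs_increment_le by (intro mult_mono) (auto simp: cube_def)
    hence "\<bar>\<Sum>t\<in>UNIV. \<alpha> $ t * (x $ t - prev_val X0 x t)\<bar> \<le> (\<Sum>t\<in>(UNIV::'n set). L * ((\<bar>X0\<bar> + 2) * (1 + norm x)))"
      by (intro order_trans[OF sum_abs] sum_mono)
    also have "\<dots> = N * (L * (\<bar>X0\<bar> + 2)) * (1 + norm x)" by (simp add: N_def)
    finally have "\<bar>gain (\<alpha>, x)\<bar> \<le> (\<bar>g 0\<bar> + B * norm x) + N * (L * (\<bar>X0\<bar> + 2)) * (1 + norm x)"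
      using g_bound[of x] by (simp add: gain_def)
    also have "\<dots> \<le> (\<bar>g 0\<bar> + B) * (1 + norm x) + N * (L * (\<bar>X0\<bar> + 2)) * (1 + norm x)"
      using B0 by (simp add: algebra_simps)
    also have "\<dots> = (\<bar>g 0\<bar> + B + N * (L * (\<bar>X0\<bar> + 2))) * (1 + norm x)" by (simp add: algebra_simps)
    also have "\<dots> \<le> A * (1 + norm x)"
      using pos by (intro mult_right_mono) (auto simp: A_def)
    finally show "\<bar>gain (\<alpha>, x)\<bar> \<le> A * (1 + norm x)" .
    have "norm (\<Sum>t\<in>UNIV. \<alpha> $ t *\<^sub>R increment_blinfun t) \<le> (\<Sum>t\<in>UNIV. L * norm (increment_blinfun t))"
      using \<alpha> by (intro order_trans[OF norm_sum] sum_mono) (auto simp: cube_def intro!: mult_right_mono)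
    hence "norm (gain' (\<alpha>, x)) \<le> B + (\<Sum>t\<in>UNIV. L * norm (increment_blinfun t))"
      unfolding gain'_def using B[of x] by (auto intro!: norm_triangle_le add_mono)
    also have "\<dots> \<le> A" using pos by (simp add: A_def)
    finally show "norm (gain' (\<alpha>, x)) \<le> A" .
  qed
qed

lemma growth_bounds:
  obtains C where "C > 0"
    "\<And>\<alpha> x. \<alpha> \<in> cube \<Longrightarrow> \<bar>gain (\<alpha>, x)\<bar> \<le> C * (1 + norm x)"
    "\<And>\<alpha> x. \<alpha> \<in> cube \<Longrightarrow> \<bar>deriv loss (gain (\<alpha>, x))\<bar> \<le> C * (1 + norm x) powr (p - 1)"
    "\<And>\<alpha> x. \<alpha> \<in> cube \<Longrightarrow> norm (gain' (\<alpha>, x)) \<le> C"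
    "\<And>\<alpha> x. \<alpha> \<in> cube \<Longrightarrow> norm (cost' (\<alpha>, x)) \<le> C * (1 + norm x) powr (p - 1)"
    "\<And>\<alpha> x. \<alpha> \<in> cube \<Longrightarrow> \<bar>loss (gain (\<alpha>, x))\<bar> \<le> C * (1 + norm x) powr p"
proof -
  obtain A where A: "A > 0" "\<And>\<alpha> x. \<alpha> \<in> cube \<Longrightarrow> \<bar>gain (\<alpha>, x)\<bar> \<le> A * (1 + norm x)"
    "\<And>\<alpha> x. \<alpha> \<in> cube \<Longrightarrow> norm (gain' (\<alpha>, x)) \<le> A"
    using gain_bound by blast
  define D where "D = c * (1 + A powr (p - 1))"
  have D: "D > 0" using c by (simp add: D_def add_pos_nonneg)
  have loss': "\<bar>deriv loss u\<bar> \<le> D * (1 + norm x) powr (p - 1)" if "\<bar>u\<bar> \<le> A * (1 + norm x)" for u and x :: "'n path"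
  proof -
    have "\<bar>u\<bar> powr (p - 1) \<le> A powr (p - 1) * (1 + norm x) powr (p - 1)"
      using that p A(1) powr_mono2[of "p - 1" "\<bar>u\<bar>" "A * (1 + norm x)"] by (simp add: powr_mult)
    moreover have "1 \<le> (1 + norm x) powr (p - 1)" using p by (intro ge_one_powr_ge_zero) auto
    ultimately have "1 + \<bar>u\<bar> powr (p - 1) \<le> (1 + A powr (p - 1)) * (1 + norm x) powr (p - 1)"
      by (simp add: algebra_simps)
    hence "c * (1 + \<bar>u\<bar> powr (p - 1)) \<le> D * (1 + norm x) powr (p - 1)"
      unfolding D_def using c by simp
    thus ?thesis using loss'_growth[of u] by simp
  qed
  have lossb: "\<bar>loss (gain (\<alpha>, x))\<bar> \<le> (\<bar>loss 0\<bar> + A * D) * (1 + norm x) powr p" if \<alpha>: "\<alpha> \<in> cube" for \<alpha> x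
  proof -
    let ?u = "gain (\<alpha>, x)"
    have "norm (loss ?u - loss 0) \<le> D * (1 + norm x) powr (p - 1) * norm (?u - 0)"
    proof (rule field_differentiable_bound[of "{- (A * (1 + norm x))..A * (1 + norm x)}" loss "deriv loss"])
      show "(loss has_field_derivative deriv loss z) (at z within {- (A * (1 + norm x))..A * (1 + norm x)})" for z
        using loss_deriv has_field_derivative_at_within by blast
      show "norm (deriv loss z) \<le> D * (1 + norm x) powr (p - 1)" if "z \<in> {- (A * (1 + norm x))..A * (1 + norm x)}" for z
        using loss'[of z x] that by (auto simp: abs_le_iff)
      show "?u \<in> {- (A * (1 + norm x))..A * (1 + norm x)}" using A(2)[OF \<alpha>, of x] by (auto simp: abs_le_iff)
      show "0 \<in> {- (A * (1 + norm x))..A * (1 + norm x)}" using A(1) by simp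
    qed simp
    also have "\<dots> \<le> D * (1 + norm x) powr (p - 1) * (A * (1 + norm x))"
      using A(2)[OF \<alpha>, of x] D by (intro mult_left_mono) auto
    also have "\<dots> = A * D * (1 + norm x) powr p"
      using powr_add[of "1 + norm x" "p - 1" 1] by simp
    finally have "\<bar>loss ?u\<bar> \<le> \<bar>loss 0\<bar> + A * D * (1 + norm x) powr p" by simp
    moreover have "\<bar>loss 0\<bar> \<le> \<bar>loss 0\<bar> * (1 + norm x) powr p"
      using p ge_one_powr_ge_zero[of "1 + norm x" p] mult_left_mono[of 1 "(1 + norm x) powr p" "\<bar>loss 0\<bar>"] by simp
    ultimately show ?thesis by (simp add: algebra_simps)
  qed
  define C where "C = A + D + A * D + (\<bar>loss 0\<bar> + A * D)"
  have le: "A \<le> C" "D \<le> C" "A * D \<le> C" "\<bar>loss 0\<bar> + A * D \<le> C" "C > 0"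
    using A(1) D by (auto simp: C_def add_pos_pos add_pos_nonneg)
  show thesis
  proof (rule that[of C])
    show "C > 0" by fact
    fix \<alpha> x assume \<alpha>: "\<alpha> \<in> cube"
    show "\<bar>gain (\<alpha>, x)\<bar> \<le> C * (1 + norm x)"
      using A(2)[OF \<alpha>, of x] mult_right_mono[OF le(1), of "1 + norm x"] by simp
    have l': "\<bar>deriv loss (gain (\<alpha>, x))\<bar> \<le> D * (1 + norm x) powr (p - 1)"
      by (rule loss'[OF A(2)[OF \<alpha>]])
    thus "\<bar>deriv loss (gain (\<alpha>, x))\<bar> \<le> C * (1 + norm x) powr (p - 1)"
      using mult_right_mono[OF le(2), of "(1 + norm x) powr (p - 1)"] by simp
    show "norm (gain' (\<alpha>, x)) \<le> C" using A(3)[OF \<alpha>, of x] le(1) by simp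
    have "norm (cost' (\<alpha>, x)) \<le> D * (1 + norm x) powr (p - 1) * A"
      unfolding cost'_def norm_scaleR using l' A(3)[OF \<alpha>, of x] D by (intro mult_mono) auto
    also have "\<dots> = A * D * (1 + norm x) powr (p - 1)" by simp
    finally show "norm (cost' (\<alpha>, x)) \<le> C * (1 + norm x) powr (p - 1)"
      using mult_right_mono[OF le(3), of "(1 + norm x) powr (p - 1)"] by simp
    show "\<bar>loss (gain (\<alpha>, x))\<bar> \<le> C * (1 + norm x) powr p"
      using lossb[OF \<alpha>, of x] mult_right_mono[OF le(4), of "(1 + norm x) powr p"] by simp
  qed
qed

lemma cost_lipschitz:
  obtains C where "C > 0"
    "\<And>\<alpha> x d. \<alpha> \<in> cube \<Longrightarrow> \<bar>loss (gain (\<alpha>, x + d)) - loss (gain (\<alpha>, x))\<bar> \<le> C * (1 + norm x + norm d) powr (p - 1) * norm d"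
proof -
  obtain C where C: "C > 0" "\<And>\<alpha> x. \<alpha> \<in> cube \<Longrightarrow> norm (cost' (\<alpha>, x)) \<le> C * (1 + norm x) powr (p - 1)"
    using growth_bounds by metis
  show thesis
  proof (rule that[OF C(1)])
    fix \<alpha> x d assume \<alpha>: "\<alpha> \<in> cube"
    obtain s where s: "s \<in> {0<..<1}" "loss (gain (\<alpha>, x + d)) - loss (gain (\<alpha>, x)) = blinfun_apply (cost' (\<alpha>, x + s *\<^sub>R d)) d"
      using cost_mean_value by blast
    have "norm (s *\<^sub>R d) \<le> norm d" using s(1) by (simp add: mult_left_le_one_le)
    hence "norm (x + s *\<^sub>R d) \<le> norm x + norm d"
      using norm_triangle_ineq[of x "s *\<^sub>R d"] by linarith
    hence "(1 + norm (x + s *\<^sub>R d)) powr (p - 1) \<le> (1 + norm x + norm d) powr (p - 1)"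
      using p by (intro powr_mono2) auto
    hence "C * (1 + norm (x + s *\<^sub>R d)) powr (p - 1) \<le> C * (1 + norm x + norm d) powr (p - 1)"
      using C(1) by simp
    hence "norm (cost' (\<alpha>, x + s *\<^sub>R d)) \<le> C * (1 + norm x + norm d) powr (p - 1)"
      by (rule order_trans[OF C(2)[OF \<alpha>]])
    hence "norm (blinfun_apply (cost' (\<alpha>, x + s *\<^sub>R d)) d) \<le> C * (1 + norm x + norm d) powr (p - 1) * norm d"
      by (intro order_trans[OF norm_blinfun] mult_right_mono) auto
    thus "\<bar>loss (gain (\<alpha>, x + d)) - loss (gain (\<alpha>, x))\<bar> \<le> C * (1 + norm x + norm d) powr (p - 1) * norm d"
      using s(2) by simp
  qed
qed

text \<open>First-order Taylor expansion in the path with a remainder adapted to \<open>L\<^sup>p\<close>-displacements. On a compact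
set of paths and for small displacements the remainder is controlled by uniform continuity of the derivative;
large displacements are absorbed into \<open>norm d powr p\<close>, which is of higher order because \<open>p > 1\<close>; large paths
contribute the tail term, whose constant \<open>C\<close> does not depend on \<open>e\<close> and \<open>K\<close>.\<close>

lemma cost_taylor:
  obtains C where "C > 0"
    "\<And>e K. e > 0 \<Longrightarrow> K \<ge> 0 \<Longrightarrow> \<exists>D\<ge>0. \<forall>\<alpha>\<in>cube. \<forall>x d.
      \<bar>loss (gain (\<alpha>, x + d)) - loss (gain (\<alpha>, x)) - blinfun_apply (cost' (\<alpha>, x)) d\<bar>
        \<le> norm d * (e + C * ((1 + norm x) powr (p - 1) * indicator {x. norm x > K} x)) + D * norm d powr p"
proof -
  obtain C0 where C0: "C0 > 0" "\<And>\<alpha> x. \<alpha> \<in> cube \<Longrightarrow> norm (cost' (\<alpha>, x)) \<le> C0 * (1 + norm x) powr (p - 1)"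
    using growth_bounds by metis
  define C where "C = 2 powr p * C0"
  have C: "C > 0" using C0 by (simp add: C_def)
  show thesis
  proof (rule that[OF C])
    fix e K :: real assume e: "e > 0" and K: "K \<ge> 0"
    have "uniformly_continuous_on (cube \<times> cball 0 (K + 1)) cost'"
      by (intro compact_uniformly_continuous continuous_on_subset[OF cost'_cont] compact_Times compact_cube) auto
    then obtain \<delta> where \<delta>: "\<delta> > 0" "\<And>z z'. z \<in> cube \<times> cball 0 (K + 1) \<Longrightarrow> z' \<in> cube \<times> cball 0 (K + 1) \<Longrightarrow>
        dist z' z < \<delta> \<Longrightarrow> dist (cost' z') (cost' z) < e"
      using e unfolding uniformly_continuous_on_def by metis
    define \<eta> where "\<eta> = min 1 (\<delta> / 2)"
    have \<eta>: "\<eta> > 0" "\<eta> \<le> 1" "\<eta> < \<delta>" using \<delta>(1) by (auto simp: \<eta>_def)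
    define D where "D = C * (1 + ((1 + K) / \<eta>) powr (p - 1))"
    have CD: "C \<le> D" using C by (simp add: D_def)
    show "\<exists>D\<ge>0. \<forall>\<alpha>\<in>cube. \<forall>x d.
      \<bar>loss (gain (\<alpha>, x + d)) - loss (gain (\<alpha>, x)) - blinfun_apply (cost' (\<alpha>, x)) d\<bar>
        \<le> norm d * (e + C * ((1 + norm x) powr (p - 1) * indicator {x. norm x > K} x)) + D * norm d powr p"
    proof (intro exI[of _ D] conjI ballI allI)
      show "D \<ge> 0" using C CD by simp
      fix \<alpha> x d assume \<alpha>: "\<alpha> \<in> cube"
      obtain s where s: "s \<in> {0<..<1}" "loss (gain (\<alpha>, x + d)) - loss (gain (\<alpha>, x)) = blinfun_apply (cost' (\<alpha>, x + s *\<^sub>R d)) d"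
        using cost_mean_value by blast
      have sd: "norm (s *\<^sub>R d) \<le> norm d" using s(1) by (simp add: mult_left_le_one_le)
      hence xsd: "norm (x + s *\<^sub>R d) \<le> norm x + norm d"
        using norm_triangle_ineq[of x "s *\<^sub>R d"] by linarith
      have dp: "norm d * norm d powr (p - 1) = norm d powr p"
        using powr_mult_base[of "norm d" "p - 1"] by simp
      let ?err = "\<bar>loss (gain (\<alpha>, x + d)) - loss (gain (\<alpha>, x)) - blinfun_apply (cost' (\<alpha>, x)) d\<bar>"
      have err: "?err \<le> norm (cost' (\<alpha>, x + s *\<^sub>R d) - cost' (\<alpha>, x)) * norm d"
        unfolding s(2) using norm_blinfun[of "cost' (\<alpha>, x + s *\<^sub>R d) - cost' (\<alpha>, x)" d]
        by (simp add: blinfun.diff_left)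
      show "?err \<le> norm d * (e + C * ((1 + norm x) powr (p - 1) * indicator {x. norm x > K} x)) + D * norm d powr p"
      proof (cases "norm x \<le> K \<and> norm d \<le> \<eta>")
        case True
        have "dist (cost' (\<alpha>, x + s *\<^sub>R d)) (cost' (\<alpha>, x)) < e"
        proof (rule \<delta>(2))
          show "(\<alpha>, x) \<in> cube \<times> cball 0 (K + 1)" using \<alpha> True by simp
          show "(\<alpha>, x + s *\<^sub>R d) \<in> cube \<times> cball 0 (K + 1)" using \<alpha> True xsd \<eta> by simp
          show "dist (\<alpha>, x + s *\<^sub>R d) (\<alpha>, x) < \<delta>"
            using sd True \<eta> by (simp add: dist_Pair_Pair dist_norm)
        qed
        hence "?err \<le> e * norm d"
          by (intro order_trans[OF err] mult_right_mono) (auto simp: dist_norm)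
        moreover have "0 \<le> D * norm d powr p" using C CD by simp
        ultimately show ?thesis using True by (simp add: mult.commute)
      next
        case False
        have "(1 + norm x) powr (p - 1) \<le> (1 + norm x + norm d) powr (p - 1)"
          "(1 + norm (x + s *\<^sub>R d)) powr (p - 1) \<le> (1 + norm x + norm d) powr (p - 1)"
          using p xsd by (intro powr_mono2; simp)+
        hence "norm (cost' (\<alpha>, x + s *\<^sub>R d)) \<le> C0 * (1 + norm x + norm d) powr (p - 1)"
          "norm (cost' (\<alpha>, x)) \<le> C0 * (1 + norm x + norm d) powr (p - 1)"
          using C0(2)[OF \<alpha>, of "x + s *\<^sub>R d"] C0(2)[OF \<alpha>, of x] C0(1)
          by (smt (verit) mult_left_mono)+
        hence "norm (cost' (\<alpha>, x + s *\<^sub>R d) - cost' (\<alpha>, x)) \<le> 2 * C0 * (1 + norm x + norm d) powr (p - 1)"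
          using norm_triangle_ineq4[of "cost' (\<alpha>, x + s *\<^sub>R d)" "cost' (\<alpha>, x)"] by linarith
        also have "(1 + norm x + norm d) powr (p - 1) \<le> 2 powr (p - 1) * ((1 + norm x) powr (p - 1) + norm d powr (p - 1))"
          using p by (intro powr_add_le) auto
        also have "2 * C0 * (2 powr (p - 1) * ((1 + norm x) powr (p - 1) + norm d powr (p - 1)))
            = C * ((1 + norm x) powr (p - 1) + norm d powr (p - 1))"
          using powr_mult_base[of 2 "p - 1"] by (simp add: C_def)
        finally have bd: "?err \<le> C * ((1 + norm x) powr (p - 1) + norm d powr (p - 1)) * norm d"
          using C0(1) by (intro order_trans[OF err] mult_right_mono) auto
        also have "\<dots> = norm d * (C * (1 + norm x) powr (p - 1)) + C * norm d powr p"
          by (simp add: algebra_simps dp)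
        finally have bd: "?err \<le> norm d * (C * (1 + norm x) powr (p - 1)) + C * norm d powr p" .
        show ?thesis
        proof (cases "norm x > K")
          case True
          have "norm d * (C * (1 + norm x) powr (p - 1)) \<le> norm d * (e + C * (1 + norm x) powr (p - 1))"
            using e by (intro mult_left_mono) auto
          moreover have "C * norm d powr p \<le> D * norm d powr p" using CD by (intro mult_right_mono) auto
          ultimately show ?thesis using bd True by simp
        next
          case xK: False
          hence d: "norm d > \<eta>" using False by simp
          have "1 + norm x \<le> ((1 + K) / \<eta>) * norm d"
          proof -
            have "(1 + norm x) * \<eta> \<le> (1 + K) * norm d" using xK d K \<eta> by (intro mult_mono) auto
            thus ?thesis using \<eta> by (simp add: field_simps)
          qed
          hence "(1 + norm x) powr (p - 1) \<le> (((1 + K) / \<eta>) * norm d) powr (p - 1)"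
            using p by (intro powr_mono2) auto
          hence "(1 + norm x) powr (p - 1) \<le> ((1 + K) / \<eta>) powr (p - 1) * norm d powr (p - 1)"
            by (simp only: powr_mult)
          hence "norm d * (C * (1 + norm x) powr (p - 1)) \<le> norm d * (C * (((1 + K) / \<eta>) powr (p - 1) * norm d powr (p - 1)))"
            using C by (intro mult_left_mono) auto
          also have "\<dots> = C * ((1 + K) / \<eta>) powr (p - 1) * norm d powr p" by (simp flip: dp)
          finally have "?err \<le> D * norm d powr p" using bd by (simp add: D_def algebra_simps)
          thus ?thesis using xK e by (simp add: add_increasing)
        qed
      qed
    qed
  qed
qed

end

section \<open>First-order conditions\<close>

text \<open>A sequence with summable increments in \<open>L\<^sup>1\<close> converges almost everywhere.\<close>

lemma AE_convergent_of_summable_increments: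
  fixes f :: "nat \<Rightarrow> 'a \<Rightarrow> real"
  assumes int: "\<And>j. integrable M (f j)"
    and sum: "summable (\<lambda>j. \<integral>x. \<bar>f (Suc j) x - f j x\<bar> \<partial>M)"
  shows "AE x in M. convergent (\<lambda>j. f j x)"
proof -
  have [measurable]: "f j \<in> borel_measurable M" for j using int by auto
  have "(\<integral>\<^sup>+x. (\<Sum>j. ennreal \<bar>f (Suc j) x - f j x\<bar>) \<partial>M) = (\<Sum>j. \<integral>\<^sup>+x. ennreal \<bar>f (Suc j) x - f j x\<bar> \<partial>M)"
    by (rule nn_integral_suminf) simp
  also have "\<dots> = (\<Sum>j. ennreal (\<integral>x. \<bar>f (Suc j) x - f j x\<bar> \<partial>M))"
    using int by (intro suminf_cong nn_integral_eq_integral) auto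
  also have "\<dots> = ennreal (\<Sum>j. \<integral>x. \<bar>f (Suc j) x - f j x\<bar> \<partial>M)"
    by (rule suminf_ennreal2[OF _ sum]) simp
  finally have "(\<integral>\<^sup>+x. (\<Sum>j. ennreal \<bar>f (Suc j) x - f j x\<bar>) \<partial>M) \<noteq> \<infinity>" by simp
  hence "AE x in M. (\<Sum>j. ennreal \<bar>f (Suc j) x - f j x\<bar>) \<noteq> \<infinity>"
    by (intro nn_integral_PInf_AE) simp_all
  thus ?thesis
  proof eventually_elim
    case (elim x)
    hence "summable (\<lambda>j. \<bar>f (Suc j) x - f j x\<bar>)"
      by (intro summable_suminf_not_top) auto
    hence "summable (\<lambda>j. f (Suc j) x - f j x)" by (rule summable_rabs_cancel)
    hence "convergent (\<lambda>n. (\<Sum>j<n. f (Suc j) x - f j x) + f 0 x)"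
      by (intro convergent_add convergent_const) (simp add: summable_iff_convergent)
    thus "convergent (\<lambda>j. f j x)" by (simp add: sum_lessThan_telescope[of "\<lambda>j. f j x"])
  qed
qed

lemma depends_on_compose2:
  assumes "depends_on S f" "depends_on S h"
  shows "depends_on S (\<lambda>x. F (f x) (h x))"
  using assms unfolding depends_on_def by metis

lemma depends_on_compose:
  assumes "depends_on S f"
  shows "depends_on S (\<lambda>x. F (f x))"
  using assms unfolding depends_on_def by metis

lemma depends_on_const: "depends_on S (\<lambda>x. k)"
  by (simp add: depends_on_def)

lemma depends_on_nth: "t \<in> S \<Longrightarrow> depends_on S (\<lambda>x. x $ t)"
  by (simp add: depends_on_def)

lemma depends_on_sum:
  "(\<And>i. i \<in> I \<Longrightarrow> depends_on S (f i)) \<Longrightarrow> depends_on S (\<lambda>x. \<Sum>i\<in>I. f i x)"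
  unfolding depends_on_def by (auto intro!: sum.cong)

context hedging
begin

sublocale P: prob_space P
  using P by (rule P_pD)

lemma sets_P [measurable_cong, simp]: "sets P = sets borel"
  and space_P [simp]: "space P = UNIV"
  using P by (auto dest: P_pD)

lemma prob_UNIV [simp]: "P.prob UNIV = 1"
  using P.prob_space by simp

lemma g_borel [measurable]: "g \<in> borel_measurable borel"
  and loss_borel [measurable]: "loss \<in> borel_measurable borel"
  and loss'_borel [measurable]: "deriv loss \<in> borel_measurable borel"
  using g_cont loss_cont loss'_cont by (auto intro: borel_measurable_continuous_onI)

lemma payoff_borel [measurable (raw)]:
  assumes "a \<in> controls L" and [measurable]: "f \<in> borel_measurable N"
  shows "(\<lambda>x. payoff X0 g a (f x)) \<in> borel_measurable N"
proof -
  note [measurable] = controlsD(1)[OF assms(1)]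
  show ?thesis unfolding payoff_def by measurable
qed

lemma integrable_growth:
  fixes f :: "'n path \<Rightarrow> real"
  assumes Q: "Q \<in> P_p p" and "f \<in> borel_measurable borel"
    and bound: "\<And>x. \<bar>f x\<bar> \<le> C * (1 + norm x) powr p"
  shows "integrable Q f"
proof (rule Bochner_Integration.integrable_bound)
  interpret Q: prob_space Q using Q by (rule P_pD)
  show "integrable Q (\<lambda>x. \<bar>C\<bar> * (2 powr p * (1 + norm x powr p)))"
    using P_pD(4)[OF Q] by simp
  show "f \<in> borel_measurable Q" using assms(2) by (simp add: measurable_cong_sets[OF P_pD(2)[OF Q] refl])
  show "AE x in Q. norm (f x) \<le> norm (\<bar>C\<bar> * (2 powr p * (1 + norm x powr p)))"
  proof (rule AE_I2)
    fix x :: "'n path"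
    have "\<bar>f x\<bar> \<le> \<bar>C\<bar> * (1 + norm x) powr p"
      by (rule order_trans[OF bound mult_right_mono]) auto
    also have "\<dots> \<le> \<bar>C\<bar> * (2 powr p * (1 powr p + norm x powr p))"
      using p by (intro mult_left_mono powr_add_le) auto
    finally show "norm (f x) \<le> norm (\<bar>C\<bar> * (2 powr p * (1 + norm x powr p)))" by simp
  qed
qed

lemma powr_growth_mult: "(1 + norm x) powr (p - 1) * (1 + norm x) = (1 + norm x) powr p" for x :: "'n path"
  using powr_mult_base[of "1 + norm x" "p - 1"] by (simp add: mult.commute)

lemma payoff_growth:
  obtains C where "C > 0" "\<And>a x. a \<in> controls L \<Longrightarrow> \<bar>payoff X0 g a x\<bar> \<le> C * (1 + norm x)"
    "\<And>a x. a \<in> controls L \<Longrightarrow> \<bar>deriv loss (payoff X0 g a x)\<bar> \<le> C * (1 + norm x) powr (p - 1)"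
    "\<And>a x. a \<in> controls L \<Longrightarrow> \<bar>loss (payoff X0 g a x)\<bar> \<le> C * (1 + norm x) powr p"
  using growth_bounds ctrl_vec_cube unfolding payoff_eq_gain by metis

lemma integrable_loss:
  assumes "Q \<in> P_p p" "a \<in> controls L"
  shows "integrable Q (\<lambda>x. loss (payoff X0 g a x))"
proof -
  obtain C where "\<And>x. \<bar>loss (payoff X0 g a x)\<bar> \<le> C * (1 + norm x) powr p"
    using payoff_growth assms(2) by metis
  thus ?thesis using assms by (intro integrable_growth[OF assms(1)]) auto
qed

lemma loss'_mult_growth:
  assumes w: "\<And>x. \<bar>w x\<bar> \<le> B * (1 + norm x)"
  obtains C where "\<And>a x. a \<in> controls L \<Longrightarrow> \<bar>deriv loss (payoff X0 g a x) * w x\<bar> \<le> C * (1 + norm x) powr p"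
proof -
  obtain C where C: "C > 0"
    "\<And>a x. a \<in> controls L \<Longrightarrow> \<bar>deriv loss (payoff X0 g a x)\<bar> \<le> C * (1 + norm x) powr (p - 1)"
    using payoff_growth by metis
  show thesis
  proof (rule that[of "C * B"])
    fix a :: "'n \<Rightarrow> 'n path \<Rightarrow> real" and x assume a: "a \<in> controls L"
    have "\<bar>deriv loss (payoff X0 g a x) * w x\<bar> \<le> (C * (1 + norm x) powr (p - 1)) * (B * (1 + norm x))"
      unfolding abs_mult using C(1) C(2)[OF a, of x] w[of x] by (intro mult_mono) auto
    also have "\<dots> = C * B * ((1 + norm x) powr (p - 1) * (1 + norm x))" by simp
    finally show "\<bar>deriv loss (payoff X0 g a x) * w x\<bar> \<le> C * B * (1 + norm x) powr p"
      by (simp only: powr_growth_mult)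
  qed
qed

lemma integrable_loss'_mult:
  assumes Q: "Q \<in> P_p p" and a: "a \<in> controls L" and w [measurable]: "w \<in> borel_measurable borel"
    and wb: "\<And>x. \<bar>w x\<bar> \<le> B * (1 + norm x)"
  shows "integrable Q (\<lambda>x. deriv loss (payoff X0 g a x) * w x)"
proof -
  obtain C where "\<And>a x. a \<in> controls L \<Longrightarrow> \<bar>deriv loss (payoff X0 g a x) * w x\<bar> \<le> C * (1 + norm x) powr p"
    using loss'_mult_growth[OF wb] by blast
  thus ?thesis using a by (intro integrable_growth[OF Q]) auto
qed

text \<open>The objective of the hedging problem.\<close>

definition expected_loss :: "'n path measure \<Rightarrow> ('n \<Rightarrow> 'n path \<Rightarrow> real) \<Rightarrow> real" where
  "expected_loss Q a = (\<integral>x. loss (payoff X0 g a x) \<partial>Q)"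

lemma zero_control: "(\<lambda>t x. 0) \<in> controls L"
  using L by (auto simp: controls_def)

lemma bdd_below_expected_loss:
  assumes "Q \<in> P_p p"
  shows "bdd_below (expected_loss Q ` controls L)"
proof -
  interpret Q: prob_space Q using assms by (rule P_pD)
  obtain m where m: "\<And>u. m \<le> loss u" using bdd_loss by (auto simp: bdd_below_def)
  show ?thesis
  proof (rule bdd_belowI2)
    fix a :: "'n \<Rightarrow> 'n path \<Rightarrow> real" assume a: "a \<in> controls L"
    have "(\<integral>x. m \<partial>Q) \<le> expected_loss Q a"
      unfolding expected_loss_def using m by (intro integral_mono integrable_loss assms a) auto
    thus "m \<le> expected_loss Q a" by (simp add: Q.prob_space)
  qed
qed

lemma hedging_value_le:
  assumes "Q \<in> P_p p" "a \<in> controls L"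
  shows "hedging_value L X0 loss g Q \<le> expected_loss Q a"
  unfolding hedging_value_def expected_loss_def[symmetric]
  by (rule cINF_lower[OF bdd_below_expected_loss]) fact+

lemma hedging_value_greatest:
  assumes "\<And>a. a \<in> controls L \<Longrightarrow> v \<le> expected_loss Q a"
  shows "v \<le> hedging_value L X0 loss g Q"
  unfolding hedging_value_def expected_loss_def[symmetric]
  using zero_control assms by (intro cINF_greatest) auto

lemma hedging_value_approx:
  assumes "Q \<in> P_p p" "e > 0"
  shows "\<exists>a\<in>controls L. expected_loss Q a < hedging_value L X0 loss g Q + e"
proof (rule ccontr)
  assume "\<not> ?thesis"
  hence "hedging_value L X0 loss g Q + e \<le> hedging_value L X0 loss g Q"
    by (intro hedging_value_greatest) (auto simp: not_less)
  thus False using assms by simp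
qed

abbreviation optimal :: "('n \<Rightarrow> 'n path \<Rightarrow> real) \<Rightarrow> bool" where
  "optimal a \<equiv> optimal_control L X0 loss g P a"

lemma optimalD:
  assumes "optimal a"
  shows "a \<in> controls L" "expected_loss P a = hedging_value L X0 loss g P"
  using assms by (auto simp: optimal_control_def expected_loss_def)

text \<open>Interpolation between two controls with predictable weights \<open>\<phi>\<close>; weights in the unit interval
preserve the bound on the controls.\<close>

definition mix :: "('n \<Rightarrow> 'n path \<Rightarrow> real) \<Rightarrow> ('n \<Rightarrow> 'n path \<Rightarrow> real) \<Rightarrow> ('n \<Rightarrow> 'n path \<Rightarrow> real) \<Rightarrow> 'n \<Rightarrow> 'n path \<Rightarrow> real" where
  "mix \<phi> a b t x = a t x + \<phi> t x * (b t x - a t x)"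

lemma mix_controls:
  assumes a: "a \<in> controls L" and b: "b \<in> controls L"
    and \<phi> [measurable]: "\<And>t. \<phi> t \<in> borel_measurable borel" and dep: "\<And>t. depends_on {..<t} (\<phi> t)"
    and \<phi>01: "\<And>t x. 0 \<le> \<phi> t x" "\<And>t x. \<phi> t x \<le> 1"
  shows "mix \<phi> a b \<in> controls L"
proof (rule controlsI)
  note [measurable] = controlsD(1)[OF a] controlsD(1)[OF b]
  show "mix \<phi> a b t \<in> borel_measurable borel" for t
    unfolding mix_def by measurable
  show "depends_on {..<t} (mix \<phi> a b t)" for t
    using dep[of t] controlsD(2)[OF a, of t] controlsD(2)[OF b, of t]
    unfolding depends_on_def mix_def by metis
  show "\<bar>mix \<phi> a b t x\<bar> \<le> L" for t x
  proof -
    have "mix \<phi> a b t x = (1 - \<phi> t x) * a t x + \<phi> t x * b t x" by (simp add: mix_def algebra_simps)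
    also have "\<bar>\<dots>\<bar> \<le> (1 - \<phi> t x) * L + \<phi> t x * L"
      using \<phi>01[of t x] controlsD(3)[OF a, of t x] controlsD(3)[OF b, of t x]
      by (intro order_trans[OF abs_triangle_ineq] add_mono) (auto simp: abs_mult intro!: mult_left_mono)
    also have "\<dots> = L" by (simp add: algebra_simps)
    finally show ?thesis .
  qed
qed

lemma payoff_mix:
  "payoff X0 g (mix \<phi> a b) x - payoff X0 g a x
    = (\<Sum>t\<in>UNIV. \<phi> t x * (b t x - a t x) * (x $ t - prev_val X0 x t))"
  by (simp add: payoff_def mix_def algebra_simps sum.distrib sum_subtractf)

lemma payoff_mix_const:
  "payoff X0 g (mix (\<lambda>_ _. s) a b) x = payoff X0 g a x + s * (payoff X0 g b x - payoff X0 g a x)"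
  by (simp add: payoff_def mix_def algebra_simps sum.distrib sum_subtractf sum_distrib_left)

lemma payoff_diff_growth:
  assumes "a \<in> controls L" "b \<in> controls L"
  obtains B where "\<And>x. \<bar>payoff X0 g b x - payoff X0 g a x\<bar> \<le> B * (1 + norm x)"
proof -
  obtain C where C: "\<And>a x. a \<in> controls L \<Longrightarrow> \<bar>payoff X0 g a x\<bar> \<le> C * (1 + norm x)"
    using payoff_growth by metis
  show thesis
    by (rule that[of "2 * C"]) (use C[OF assms(1)] C[OF assms(2)] in \<open>smt (verit) distrib_right\<close>)
qed

text \<open>The variational inequality at an optimizer, obtained by letting \<open>s \<rightarrow> 0\<close> in
\<open>a + s (b - a)\<close>.\<close>

lemma first_order_condition:
  assumes opt: "optimal a" and b: "b \<in> controls L"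
  shows "0 \<le> (\<integral>x. deriv loss (payoff X0 g a x) * (payoff X0 g b x - payoff X0 g a x) \<partial>P)"
proof -
  note a = optimalD(1)[OF opt]
  define w where "w x = payoff X0 g b x - payoff X0 g a x" for x
  have w [measurable]: "w \<in> borel_measurable borel" unfolding w_def using a b by measurable
  obtain B where B: "\<And>x. \<bar>w x\<bar> \<le> B * (1 + norm x)"
    unfolding w_def using payoff_diff_growth[OF a b] by blast
  obtain C where C: "\<And>a x. a \<in> controls L \<Longrightarrow> \<bar>deriv loss (payoff X0 g a x) * w x\<bar> \<le> C * (1 + norm x) powr p"
    using loss'_mult_growth[OF B] by blast
  define s where "s n = 1 / (real n + 1)" for n
  have s: "0 < s n" "s n \<le> 1" for n by (auto simp: s_def field_simps)
  have s_lim: "s \<longlonglongrightarrow> 0" unfolding s_def by real_asymp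
  define h where "h n = mix (\<lambda>_ _. s n) a b" for n
  have h: "h n \<in> controls L" for n
    unfolding h_def using s by (intro mix_controls a b) (auto simp: depends_on_const less_imp_le)
  have hw: "payoff X0 g (h n) x = payoff X0 g a x + s n * w x" for n x
    by (simp add: h_def w_def payoff_mix_const)
  have pos: "0 \<le> (\<integral>x. deriv loss (payoff X0 g (h n) x) * w x \<partial>P)" for n
  proof -
    have "expected_loss P (h n) - s n * (\<integral>x. deriv loss (payoff X0 g (h n) x) * w x \<partial>P)
        = (\<integral>x. loss (payoff X0 g (h n) x) - s n * (deriv loss (payoff X0 g (h n) x) * w x) \<partial>P)"
      using integrable_loss[OF P h, of n] integrable_loss'_mult[OF P h w B, of n]
      by (simp add: expected_loss_def)
    also have "\<dots> \<le> expected_loss P a"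
      unfolding expected_loss_def
    proof (rule integral_mono)
      show "loss (payoff X0 g (h n) x) - s n * (deriv loss (payoff X0 g (h n) x) * w x) \<le> loss (payoff X0 g a x)" for x
        using loss_ge_tangent[of "payoff X0 g (h n) x" "payoff X0 g a x"] by (simp add: hw algebra_simps)
    qed (use integrable_loss[OF P h, of n] integrable_loss'_mult[OF P h w B, of n] integrable_loss[OF P a] in auto)
    also have "\<dots> \<le> expected_loss P (h n)"
      using hedging_value_le[OF P h] optimalD(2)[OF opt] by simp
    finally show ?thesis using s(1)[of n] by (simp add: zero_le_mult_iff)
  qed
  have "(\<lambda>n. \<integral>x. deriv loss (payoff X0 g (h n) x) * w x \<partial>P) \<longlonglongrightarrow> (\<integral>x. deriv loss (payoff X0 g a x) * w x \<partial>P)"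
  proof (rule integral_dominated_convergence)
    show "integrable P (\<lambda>x. C * (1 + norm x) powr p)"
      by (rule integrable_growth[OF P, of _ "\<bar>C\<bar>"]) (auto simp: abs_mult)
    show "(\<lambda>x. deriv loss (payoff X0 g a x) * w x) \<in> borel_measurable P"
      "(\<lambda>x. deriv loss (payoff X0 g (h n) x) * w x) \<in> borel_measurable P" for n
      using a h by measurable
    show "AE x in P. norm (deriv loss (payoff X0 g (h n) x) * w x) \<le> C * (1 + norm x) powr p" for n
      using C[OF h] by simp
    show "AE x in P. (\<lambda>n. deriv loss (payoff X0 g (h n) x) * w x) \<longlonglongrightarrow> deriv loss (payoff X0 g a x) * w x"
    proof (rule AE_I2)
      fix x
      have "(\<lambda>n. payoff X0 g a x + s n * w x) \<longlonglongrightarrow> payoff X0 g a x + 0 * w x"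
        by (intro tendsto_intros s_lim)
      thus "(\<lambda>n. deriv loss (payoff X0 g (h n) x) * w x) \<longlonglongrightarrow> deriv loss (payoff X0 g a x) * w x"
        unfolding hw by (intro tendsto_intros continuous_on_tendsto_compose[OF loss'_cont]) auto
    qed
  qed
  thus ?thesis using pos unfolding w_def by (intro LIMSEQ_le_const) auto
qed

text \<open>Strict convexity makes the terminal position of an optimizer unique, even when the control is not.\<close>

lemma optimal_payoff_unique:
  assumes a: "optimal a" and b: "optimal b"
  shows "AE x in P. payoff X0 g b x = payoff X0 g a x"
proof -
  note ca = optimalD(1)[OF a] and cb = optimalD(1)[OF b]
  define w where "w x = payoff X0 g b x - payoff X0 g a x" for x
  have w [measurable]: "w \<in> borel_measurable borel" unfolding w_def using ca cb by measurable
  obtain B where B: "\<And>x. \<bar>w x\<bar> \<le> B * (1 + norm x)"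
    unfolding w_def using payoff_diff_growth[OF ca cb] by blast
  let ?D = "\<lambda>x. loss (payoff X0 g b x) - loss (payoff X0 g a x) - deriv loss (payoff X0 g a x) * w x"
  note int = integrable_loss[OF P ca] integrable_loss[OF P cb] integrable_loss'_mult[OF P ca w B]
  have D: "?D x \<ge> 0" for x
    using loss_ge_tangent[of "payoff X0 g a x" "payoff X0 g b x"] by (simp add: w_def)
  have "(\<integral>x. ?D x \<partial>P) = expected_loss P b - expected_loss P a - (\<integral>x. deriv loss (payoff X0 g a x) * w x \<partial>P)"
    using int by (simp add: expected_loss_def)
  also have "\<dots> \<le> 0"
    using first_order_condition[OF a cb] optimalD(2)[OF a] optimalD(2)[OF b] by (simp add: w_def)
  finally have "(\<integral>x. ?D x \<partial>P) = 0"
    by (rule antisym) (rule Bochner_Integration.integral_nonneg, rule D)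
  hence "AE x in P. ?D x = 0"
    using int D by (subst (asm) integral_nonneg_eq_0_iff_AE) auto
  thus ?thesis
  proof eventually_elim
    case (elim x)
    show ?case
    proof (rule ccontr)
      assume "payoff X0 g b x \<noteq> payoff X0 g a x"
      hence "?D x > 0" using loss_above_tangent[of "payoff X0 g a x" "payoff X0 g b x"] by (simp add: w_def)
      thus False using elim by simp
    qed
  qed
qed

text \<open>Where two optimizers differ at time \<open>t\<close>, moving from either one towards the other is admissible.
The two variational inequalities have opposite signs, so the first-order condition holds with equality there.\<close>

lemma componentwise_first_order_condition:
  assumes a: "optimal a" and b: "optimal b"
    and \<phi> [measurable]: "\<phi> \<in> borel_measurable borel" and dep: "depends_on {..<t} \<phi>" and bdd: "\<And>x. \<bar>\<phi> x\<bar> \<le> B"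
  shows "(\<integral>x. deriv loss (payoff X0 g a x) * ((b t x - a t x) * \<phi> x * (x $ t - prev_val X0 x t)) \<partial>P) = 0"
proof -
  note ca = optimalD(1)[OF a] and cb = optimalD(1)[OF b]
  note [measurable] = controlsD(1)[OF ca] controlsD(1)[OF cb]
  have int: "integrable P (\<lambda>x. deriv loss (payoff X0 g a x) * ((b t x - a t x) * \<psi> x * (x $ t - prev_val X0 x t)))"
    if [measurable]: "\<psi> \<in> borel_measurable borel" and bdd: "\<And>x. \<bar>\<psi> x\<bar> \<le> K" for \<psi> K
  proof (rule integrable_loss'_mult[OF P ca])
    fix x
    have K: "K \<ge> 0" using bdd[of x] by simp
    have "\<bar>(b t x - a t x) * \<psi> x * (x $ t - prev_val X0 x t)\<bar> \<le> (2 * L) * K * ((\<bar>X0\<bar> + 2) * (1 + norm x))"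
      unfolding abs_mult
    proof (intro mult_mono)
      show "\<bar>b t x - a t x\<bar> \<le> 2 * L" using controlsD(3)[OF ca, of t x] controlsD(3)[OF cb, of t x] by linarith
      show "\<bar>x $ t - prev_val X0 x t\<bar> \<le> (\<bar>X0\<bar> + 2) * (1 + norm x)" by (rule abs_increment_le)
    qed (use L K bdd in auto)
    thus "\<bar>(b t x - a t x) * \<psi> x * (x $ t - prev_val X0 x t)\<bar> \<le> (2 * L * K * (\<bar>X0\<bar> + 2)) * (1 + norm x)"
      by (simp add: mult.assoc)
  qed measurable
  have unit: "(\<integral>x. deriv loss (payoff X0 g a x) * ((b t x - a t x) * \<psi> x * (x $ t - prev_val X0 x t)) \<partial>P) = 0"
    if \<psi> [measurable]: "\<psi> \<in> borel_measurable borel" and dep: "depends_on {..<t} \<psi>" and \<psi>01: "\<And>x. 0 \<le> \<psi> x" "\<And>x. \<psi> x \<le> 1" for \<psi>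
  proof (rule antisym)
    let ?\<phi> = "\<lambda>s x. if s = t then \<psi> x else 0"
    have \<phi>: "?\<phi> s \<in> borel_measurable borel" "depends_on {..<s} (?\<phi> s)" "0 \<le> ?\<phi> s x" "?\<phi> s x \<le> 1" for s x
      using dep \<psi>01 by (cases "s = t"; simp add: depends_on_const)+
    have m: "mix ?\<phi> a b \<in> controls L" "mix ?\<phi> b a \<in> controls L"
      by (rule mix_controls; fact ca cb \<phi>)+
    have diff: "payoff X0 g (mix ?\<phi> a b) x - payoff X0 g a x = (b t x - a t x) * \<psi> x * (x $ t - prev_val X0 x t)"
      "payoff X0 g (mix ?\<phi> b a) x - payoff X0 g b x = - ((b t x - a t x) * \<psi> x * (x $ t - prev_val X0 x t))" for x
      unfolding payoff_mix by (simp_all add: if_distrib if_distribR algebra_simps cong: if_cong)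
    show "0 \<le> (\<integral>x. deriv loss (payoff X0 g a x) * ((b t x - a t x) * \<psi> x * (x $ t - prev_val X0 x t)) \<partial>P)"
      using first_order_condition[OF a m(1)] unfolding diff .
    have "0 \<le> (\<integral>x. deriv loss (payoff X0 g b x) * - ((b t x - a t x) * \<psi> x * (x $ t - prev_val X0 x t)) \<partial>P)"
      using first_order_condition[OF b m(2)] unfolding diff .
    also have "\<dots> = (\<integral>x. - (deriv loss (payoff X0 g a x) * ((b t x - a t x) * \<psi> x * (x $ t - prev_val X0 x t))) \<partial>P)"
      using optimal_payoff_unique[OF a b] ca cb by (intro integral_cong_AE) (auto elim: eventually_mono)
    finally show "(\<integral>x. deriv loss (payoff X0 g a x) * ((b t x - a t x) * \<psi> x * (x $ t - prev_val X0 x t)) \<partial>P) \<le> 0"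
      by simp
  qed
  have B: "B \<ge> 0" using bdd[of 0] by simp
  define B' where "B' = B + 1"
  have B': "B' > 0" "\<bar>\<phi> x\<bar> \<le> B'" for x using B bdd[of x] by (auto simp: B'_def)
  \<comment> \<open>A bounded weight is an affine image of a weight with values in the unit interval.\<close>
  define \<psi> where "\<psi> x = (\<phi> x / B' + 1) / 2" for x
  have \<psi>: "\<psi> \<in> borel_measurable borel" "depends_on {..<t} \<psi>" "\<And>x. 0 \<le> \<psi> x" "\<And>x. \<psi> x \<le> 1"
  proof -
    show "\<psi> \<in> borel_measurable borel" unfolding \<psi>_def by measurable
    show "depends_on {..<t} \<psi>" unfolding \<psi>_def by (rule depends_on_compose[OF dep])
    show "0 \<le> \<psi> x" "\<psi> x \<le> 1" for x
      using B'(1) B'(2)[of x] by (auto simp: \<psi>_def field_simps abs_le_iff)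
  qed
  have eq: "deriv loss (payoff X0 g a x) * ((b t x - a t x) * \<phi> x * (x $ t - prev_val X0 x t))
      = 2 * B' * (deriv loss (payoff X0 g a x) * ((b t x - a t x) * \<psi> x * (x $ t - prev_val X0 x t)))
        - B' * (deriv loss (payoff X0 g a x) * ((b t x - a t x) * 1 * (x $ t - prev_val X0 x t)))" for x
  proof -
    have "\<phi> x = 2 * B' * \<psi> x - B'" using B'(1) by (simp add: \<psi>_def field_simps)
    thus ?thesis by algebra
  qed
  have one: "(\<lambda>x :: 'n path. 1 :: real) \<in> borel_measurable borel" "depends_on {..<t} (\<lambda>x :: 'n path. 1 :: real)"
    by (simp_all add: depends_on_const)
  note u1 = unit[OF \<psi>] and u2 = unit[OF one] and i1 = int[OF \<psi>(1), of 1] and i2 = int[OF one(1), of 1]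
  have "(\<integral>x. deriv loss (payoff X0 g a x) * ((b t x - a t x) * \<phi> x * (x $ t - prev_val X0 x t)) \<partial>P)
    = 2 * B' * (\<integral>x. deriv loss (payoff X0 g a x) * ((b t x - a t x) * \<psi> x * (x $ t - prev_val X0 x t)) \<partial>P)
      - B' * (\<integral>x. deriv loss (payoff X0 g a x) * ((b t x - a t x) * 1 * (x $ t - prev_val X0 x t)) \<partial>P)"
    unfolding eq using i1 i2 \<psi>(3,4) by (subst Bochner_Integration.integral_diff) auto
  also have "\<dots> = 0" using u1 u2 by simp
  finally show ?thesis .
qed

end

section \<open>Comparison of optimizers\<close>

lemma integral_tendsto_indicator_mult:
  fixes f g :: "'a \<Rightarrow> real"
  assumes "integrable M f" "\<And>n::nat. A n \<in> sets M"
    and "AE x in M. (\<lambda>n. indicator (A n) x * f x) \<longlonglongrightarrow> g x" and "g \<in> borel_measurable M"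
  shows "(\<lambda>n. \<integral>x. indicator (A n) x * f x \<partial>M) \<longlonglongrightarrow> (\<integral>x. g x \<partial>M)"
proof (rule integral_dominated_convergence[where w = "\<lambda>x. \<bar>f x\<bar>"])
  show "(\<lambda>x. indicator (A n) x * f x) \<in> borel_measurable M" for n
    using assms(1,2) by auto
  show "AE x in M. norm (indicator (A n) x * f x) \<le> \<bar>f x\<bar>" for n
    by (auto simp: indicator_def)
qed (use assms in auto)

lemma depends_on_mult:
  fixes f h :: "_ \<Rightarrow> real"
  shows "depends_on S f \<Longrightarrow> depends_on S h \<Longrightarrow> depends_on S (\<lambda>x. f x * h x)"
  by (rule depends_on_compose2)

lemma depends_on_diff:
  fixes f h :: "_ \<Rightarrow> real"
  shows "depends_on S f \<Longrightarrow> depends_on S h \<Longrightarrow> depends_on S (\<lambda>x. f x - h x)"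
  by (rule depends_on_compose2)

context hedging
begin

context
  fixes a b :: "'n \<Rightarrow> 'n path \<Rightarrow> real"
  assumes a: "optimal a" and b: "optimal b"
begin

text \<open>Consider the event that \<open>t\<close> is the last time at which two optimizers differ. Their terminal positions
agree, so the sum of \<open>d s\<close> times the increment over \<open>s \<le> t\<close> vanishes there and the value at time
\<open>t\<close> is determined by the strict past. Every \<open>\<theta>\<close> known at time \<open>t\<close> thus coincides almost surely on this event with a
predictable \<open>\<theta>'\<close>, to which the first-order condition applies after division by the partial sum \<open>S\<close>. This
sum does not vanish there because increments are almost surely nonzero.\<close>

lemma loss'_orthogonal_last_difference:
  assumes \<theta> [measurable]: "\<theta> \<in> borel_measurable borel" and dep: "depends_on {..t} \<theta>"
    and bdd: "\<And>x. \<bar>\<theta> x\<bar> \<le> B * (1 + norm x)"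
    and later: "\<And>\<eta> B. \<eta> \<in> borel_measurable borel \<Longrightarrow> depends_on {..t} \<eta> \<Longrightarrow> (\<And>x. \<bar>\<eta> x\<bar> \<le> B * (1 + norm x)) \<Longrightarrow>
      (\<integral>x. deriv loss (payoff X0 g a x) * (indicator {x. \<exists>s>t. a s x \<noteq> b s x} x * \<eta> x) \<partial>P) = 0"
  shows "(\<integral>x. deriv loss (payoff X0 g a x) * (indicator {x. a t x \<noteq> b t x \<and> (\<forall>s>t. a s x = b s x)} x * \<theta> x) \<partial>P) = 0"
proof -
  note ca = optimalD(1)[OF a] and cb = optimalD(1)[OF b]
  note [measurable] = controlsD(1)[OF ca] controlsD(1)[OF cb]
  have depa: "depends_on {..<t} (a t)" "depends_on {..<t} (b t)"
    using controlsD(2)[OF ca] controlsD(2)[OF cb] by auto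
  let ?M = "\<lambda>x. deriv loss (payoff X0 g a x)"
  let ?E = "{x. a t x \<noteq> b t x \<and> (\<forall>s>t. a s x = b s x)}"
  define d where "d s x = b s x - a s x" for s x
  define S where "S x = (\<Sum>s\<in>{..<t}. d s x * (x $ s - prev_val X0 x s))" for x
  \<comment> \<open>\<open>R\<close> reconstructs the value at time \<open>t\<close> from the strict past.\<close>
  define R where "R x = (\<chi> s. if s = t then prev_val X0 x t - S x / d t x else x $ s)" for x
  define \<theta>' where "\<theta>' x = \<theta> (R x)" for x
  have [measurable]: "d s \<in> borel_measurable borel" for s unfolding d_def by measurable
  have [measurable]: "S \<in> borel_measurable borel" unfolding S_def by measurable
  have "R \<in> borel_measurable borel"
  proof (rule borel_measurable_vec)
    show "(\<lambda>x. R x $ s) \<in> borel_measurable borel" for s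
      by (cases "s = t") (simp_all add: R_def)
  qed
  note [measurable] = this
  have [measurable]: "\<theta>' \<in> borel_measurable borel" unfolding \<theta>'_def by measurable
  have depd: "depends_on {..<t} (d t)"
    unfolding d_def by (rule depends_on_diff[OF depa(2,1)])
  have depS: "depends_on {..<t} S"
    unfolding S_def
  proof (rule depends_on_sum)
    fix s assume s: "s \<in> {..<t}"
    have "depends_on {..<t} (d s)"
    proof -
      have "{..<s} \<subseteq> {..<t}" using s by auto
      note depends_on_mono[OF this]
      from this[OF controlsD(2)[OF cb]] this[OF controlsD(2)[OF ca]]
      show ?thesis unfolding d_def by (rule depends_on_diff)
    qed
    moreover have "depends_on {..<t} (\<lambda>x. prev_val X0 x s)"
      using s by (intro depends_on_mono[OF _ depends_on_prev_val]) auto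
    ultimately show "depends_on {..<t} (\<lambda>x. d s x * (x $ s - prev_val X0 x s))"
      using s by (intro depends_on_mult depends_on_diff depends_on_nth)
  qed
  have dep\<theta>': "depends_on {..<t} \<theta>'"
    unfolding depends_on_def \<theta>'_def
  proof (intro allI impI depends_onD[OF dep])
    fix x y :: "'n path" and s assume eq: "\<forall>s\<in>{..<t}. x $ s = y $ s" and s: "s \<in> {..t}"
    have "S x = S y" "d t x = d t y" "prev_val X0 x t = prev_val X0 y t"
      using depends_onD[OF depS, of x y] depends_onD[OF depd, of x y] depends_onD[OF depends_on_prev_val, of t x y X0] eq
      by auto
    thus "R x $ s = R y $ s" using eq s by (auto simp: R_def)
  qed
  have split: "(\<Sum>s\<in>UNIV. d s x * (x $ s - prev_val X0 x s)) = S x + d t x * (x $ t - prev_val X0 x t)"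
    if "\<And>s. s > t \<Longrightarrow> d s x = 0" for x
  proof -
    have "(\<Sum>s\<in>UNIV. d s x * (x $ s - prev_val X0 x s)) = (\<Sum>s\<in>insert t {..<t}. d s x * (x $ s - prev_val X0 x s))"
      using that by (intro sum.mono_neutral_right) (auto simp: not_less le_less)
    thus ?thesis by (simp add: S_def add.commute)
  qed
  have pay: "payoff X0 g b x - payoff X0 g a x = (\<Sum>s\<in>UNIV. d s x * (x $ s - prev_val X0 x s))" for x
    by (simp add: payoff_def d_def algebra_simps sum.distrib sum_subtractf)
  have ties: "AE x in P. x $ t - prev_val X0 x t \<noteq> 0"
  proof -
    have "{x. prev_val X0 x t = x $ t} \<in> null_sets P"
      using no_ties[of t] by (simp add: null_sets_def P.emeasure_eq_measure)
    from AE_not_in[OF this] show ?thesis by eventually_elim auto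
  qed
  have key: "AE x in P. x \<in> ?E \<longrightarrow> S x \<noteq> 0 \<and> R x = x \<and> d t x * (x $ t - prev_val X0 x t) = - S x"
    using ties optimal_payoff_unique[OF a b]
  proof eventually_elim
    case (elim x)
    show ?case
    proof
      assume x: "x \<in> ?E"
      hence "S x + d t x * (x $ t - prev_val X0 x t) = 0"
        using split[of x] pay[of x] elim by (simp add: d_def)
      hence eq: "d t x * (x $ t - prev_val X0 x t) = - S x" by simp
      have "d t x \<noteq> 0" using x by (simp add: d_def)
      hence "S x \<noteq> 0" "x $ t = prev_val X0 x t - S x / d t x"
        using eq elim by (auto simp: field_simps)
      thus "S x \<noteq> 0 \<and> R x = x \<and> d t x * (x $ t - prev_val X0 x t) = - S x"
        using eq by (simp add: R_def vec_eq_iff)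
    qed
  qed
  \<comment> \<open>Truncation makes the weight \<open>\<theta>' / S\<close> bounded.\<close>
  define A where "A n = {x. \<bar>S x\<bar> * real n > 1 \<and> \<bar>\<theta>' x\<bar> \<le> real n}" for n
  have [measurable]: "A n \<in> sets borel" for n unfolding A_def by measurable
  have [measurable]: "{x. \<exists>s>t. a s x \<noteq> b s x} \<in> sets borel" "?E \<in> sets borel" by measurable
  have int: "integrable P (\<lambda>x. ?M x * (indicator ?E x * \<theta> x))"
    by (rule integrable_loss'_mult[OF P ca, where B = B])
      (use bdd order_trans[OF _ bdd] in \<open>auto simp: indicator_def\<close>)
  have zero: "(\<integral>x. indicator (A n) x * (?M x * (indicator ?E x * \<theta> x)) \<partial>P) = 0" for n
  proof -
    define \<phi> where "\<phi> x = (if d t x \<noteq> 0 \<and> x \<in> A n then \<theta>' x / S x else 0)" for x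
    have [measurable]: "\<phi> \<in> borel_measurable borel" unfolding \<phi>_def by measurable
    have dep\<phi>: "depends_on {..<t} \<phi>"
      unfolding \<phi>_def A_def using depd depS dep\<theta>' unfolding depends_on_def by (metis (mono_tags, lifting) mem_Collect_eq)
    have \<phi>_bdd: "\<bar>\<phi> x\<bar> \<le> real n * real n" for x
    proof (cases "d t x \<noteq> 0 \<and> x \<in> A n")
      case True
      hence S: "\<bar>S x\<bar> * real n > 1" and th: "\<bar>\<theta>' x\<bar> \<le> real n" by (auto simp: A_def)
      hence "\<bar>S x\<bar> > 0" by (cases "S x = 0") auto
      have "\<bar>\<theta>' x\<bar> \<le> real n * 1" using th by simp
      also have "\<dots> \<le> real n * (\<bar>S x\<bar> * real n)" using S by (intro mult_left_mono) auto
      finally show ?thesis using True \<open>\<bar>S x\<bar> > 0\<close> by (simp add: \<phi>_def field_simps)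
    qed (auto simp: \<phi>_def)
    define \<eta> where "\<eta> x = d t x * \<phi> x * (x $ t - prev_val X0 x t)" for x
    have [measurable]: "\<eta> \<in> borel_measurable borel" unfolding \<eta>_def by measurable
    have dep\<eta>: "depends_on {..t} \<eta>"
    proof -
      have "depends_on {..t} (d t)" "depends_on {..t} \<phi>" "depends_on {..t} (\<lambda>x. prev_val X0 x t)"
        using depd dep\<phi> depends_on_prev_val[of t X0] by (auto elim!: depends_on_mono[rotated])
      thus ?thesis
        unfolding \<eta>_def by (intro depends_on_mult depends_on_diff depends_on_nth) auto
    qed
    define K where "K = 2 * L * (real n * real n) * (\<bar>X0\<bar> + 2)"
    have \<eta>_bdd: "\<bar>\<eta> x\<bar> \<le> K * (1 + norm x)" for x
    proof -
      have "\<bar>\<eta> x\<bar> \<le> (2 * L) * (real n * real n) * ((\<bar>X0\<bar> + 2) * (1 + norm x))"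
        unfolding \<eta>_def abs_mult
      proof (intro mult_mono \<phi>_bdd)
        show "\<bar>d t x\<bar> \<le> 2 * L" unfolding d_def
          using controlsD(3)[OF ca, of t x] controlsD(3)[OF cb, of t x] by linarith
        show "\<bar>x $ t - prev_val X0 x t\<bar> \<le> (\<bar>X0\<bar> + 2) * (1 + norm x)" by (rule abs_increment_le)
      qed (use L in auto)
      thus ?thesis by (simp add: K_def mult.assoc)
    qed
    have i1: "integrable P (\<lambda>x. ?M x * \<eta> x)"
      by (rule integrable_loss'_mult[OF P ca _ \<eta>_bdd]) simp
    have i2: "integrable P (\<lambda>x. ?M x * (indicator {x. \<exists>s>t. a s x \<noteq> b s x} x * \<eta> x))"
      by (rule integrable_loss'_mult[OF P ca, where B = K])
        (use \<eta>_bdd order_trans[OF abs_ge_zero \<eta>_bdd] in \<open>auto simp: indicator_def\<close>)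
    have "(\<integral>x. ?M x * \<eta> x \<partial>P) = 0"
      unfolding \<eta>_def d_def
      by (rule componentwise_first_order_condition[OF a b _ dep\<phi> \<phi>_bdd]) simp
    moreover have "(\<integral>x. ?M x * (indicator {x. \<exists>s>t. a s x \<noteq> b s x} x * \<eta> x) \<partial>P) = 0"
      by (rule later[OF _ dep\<eta> \<eta>_bdd]) simp
    ultimately have "0 = (\<integral>x. ?M x * \<eta> x - ?M x * (indicator {x. \<exists>s>t. a s x \<noteq> b s x} x * \<eta> x) \<partial>P)"
      using i1 i2 by simp
    also have "\<dots> = (\<integral>x. - (indicator (A n) x * (?M x * (indicator ?E x * \<theta> x))) \<partial>P)"
    proof (rule integral_cong_AE)
      show "AE x in P. ?M x * \<eta> x - ?M x * (indicator {x. \<exists>s>t. a s x \<noteq> b s x} x * \<eta> x)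
          = - (indicator (A n) x * (?M x * (indicator ?E x * \<theta> x)))"
        using key
      proof eventually_elim
        case (elim x)
        consider "x \<in> ?E" | "d t x = 0" | "\<exists>s>t. a s x \<noteq> b s x"
          unfolding d_def mem_Collect_eq by fastforce
        thus ?case
        proof cases
          case 1
          hence x: "S x \<noteq> 0" "\<theta>' x = \<theta> x" "d t x * (x $ t - prev_val X0 x t) = - S x" "d t x \<noteq> 0"
            using elim by (auto simp: \<theta>'_def d_def)
          have "\<eta> x = \<phi> x * (d t x * (x $ t - prev_val X0 x t))" by (simp add: \<eta>_def)
          also have "\<dots> = - (indicator (A n) x * \<theta> x)"
            unfolding x(3) using x by (simp add: \<phi>_def indicator_def)
          finally show ?thesis using 1 by (auto simp: indicator_def)
        next
          case 2
          thus ?thesis by (simp add: \<eta>_def d_def indicator_def)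
        next
          case 3
          hence "x \<notin> ?E" by auto
          thus ?thesis using 3 by (simp add: indicator_def)
        qed
      qed
    qed (use ca in measurable)
    finally show ?thesis by simp
  qed
  have "(\<lambda>n. \<integral>x. indicator (A n) x * (?M x * (indicator ?E x * \<theta> x)) \<partial>P)
      \<longlonglongrightarrow> (\<integral>x. ?M x * (indicator ?E x * \<theta> x) \<partial>P)"
  proof (rule integral_tendsto_indicator_mult[OF int])
    show "AE x in P. (\<lambda>n. indicator (A n) x * (?M x * (indicator ?E x * \<theta> x))) \<longlonglongrightarrow> ?M x * (indicator ?E x * \<theta> x)"
      using key
    proof eventually_elim
      case (elim x)
      show ?case
      proof (cases "x \<in> ?E")
        case True
        hence S: "S x \<noteq> 0" using elim by simp
        obtain m :: nat where m: "1 / \<bar>S x\<bar> < real m" "\<bar>\<theta>' x\<bar> < real m"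
          using reals_Archimedean2[of "max (1 / \<bar>S x\<bar>) \<bar>\<theta>' x\<bar>"] by auto
        have "x \<in> A n" if "n \<ge> m" for n
        proof -
          have "1 / \<bar>S x\<bar> < real n" "\<bar>\<theta>' x\<bar> \<le> real n" using m that by linarith+
          thus ?thesis using S by (simp add: A_def field_simps)
        qed
        hence "\<forall>\<^sub>F n in sequentially. ?M x * (indicator ?E x * \<theta> x) = indicator (A n) x * (?M x * (indicator ?E x * \<theta> x))"
          by (auto simp: eventually_sequentially intro!: exI[of _ m])
        thus ?thesis by (rule Lim_transform_eventually[OF tendsto_const])
      qed simp
    qed
  qed (use int in auto)
  thus ?thesis using zero LIMSEQ_unique[OF tendsto_const] by fastforce
qed

text \<open>Backward induction over time: the marginal loss is orthogonal to the past on the event that the two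
optimizers differ at some time from \<open>t\<close> on.\<close>

lemma loss'_orthogonal_difference:
  assumes "\<theta> \<in> borel_measurable borel" "depends_on {..t} \<theta>" "\<And>x. \<bar>\<theta> x\<bar> \<le> B * (1 + norm x)"
  shows "(\<integral>x. deriv loss (payoff X0 g a x) * (indicator {x. \<exists>s\<ge>t. a s x \<noteq> b s x} x * \<theta> x) \<partial>P) = 0"
  using assms
proof (induction t arbitrary: \<theta> B rule: measure_induct_rule[where f = "\<lambda>t. card {t<..}"])
  case (less t)
  note [measurable] = less.prems(1)
  note ca = optimalD(1)[OF a] and cb = optimalD(1)[OF b]
  note [measurable] = controlsD(1)[OF ca] controlsD(1)[OF cb]
  let ?M = "\<lambda>x. deriv loss (payoff X0 g a x)"
  have later: "(\<integral>x. ?M x * (indicator {x. \<exists>s>t. a s x \<noteq> b s x} x * \<eta> x) \<partial>P) = 0"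
    if \<eta>: "\<eta> \<in> borel_measurable borel" "depends_on {..t} \<eta>" "\<And>x. \<bar>\<eta> x\<bar> \<le> B * (1 + norm x)" for \<eta> B
  proof (cases "{t<..} = {}")
    case True
    hence "\<not> t < s" for s by (metis emptyE greaterThan_iff)
    thus ?thesis by simp
  next
    case False
    define t' where "t' = Min {t<..}"
    have t': "t < t'" using Min_in[of "{t<..}"] False by (simp add: t'_def)
    have t'_le: "t' \<le> s \<longleftrightarrow> t < s" for s
      using t' unfolding t'_def by (auto intro: Min_le dest: less_le_trans)
    have "card {t'<..} < card {t<..}"
      using t' by (intro psubset_card_mono) auto
    moreover have "depends_on {..t'} \<eta>"
      by (rule depends_on_mono[OF _ \<eta>(2)]) (use t' in auto)
    ultimately show ?thesis
      using less.IH[of t' \<eta> B] \<eta> by (simp add: t'_le)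
  qed
  have bd: "\<bar>indicator A x * \<theta> x\<bar> \<le> B * (1 + norm x)" for A x
    using less.prems(3)[of x] order_trans[OF abs_ge_zero less.prems(3)[of x]] by (auto simp: indicator_def)
  have eq: "?M x * (indicator {x. \<exists>s\<ge>t. a s x \<noteq> b s x} x * \<theta> x)
      = ?M x * (indicator {x. \<exists>s>t. a s x \<noteq> b s x} x * \<theta> x)
        + ?M x * (indicator {x. a t x \<noteq> b t x \<and> (\<forall>s>t. a s x = b s x)} x * \<theta> x)" for x
    by (auto simp: indicator_def le_less)
  have "(\<integral>x. ?M x * (indicator {x. \<exists>s\<ge>t. a s x \<noteq> b s x} x * \<theta> x) \<partial>P)
      = (\<integral>x. ?M x * (indicator {x. \<exists>s>t. a s x \<noteq> b s x} x * \<theta> x) \<partial>P)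
        + (\<integral>x. ?M x * (indicator {x. a t x \<noteq> b t x \<and> (\<forall>s>t. a s x = b s x)} x * \<theta> x) \<partial>P)"
    unfolding eq
    by (intro Bochner_Integration.integral_add integrable_loss'_mult[OF P ca _ bd]) simp_all
  also have "\<dots> = 0"
  proof -
    have "(\<integral>x. ?M x * (indicator {x. a t x \<noteq> b t x \<and> (\<forall>s>t. a s x = b s x)} x * \<theta> x) \<partial>P) = 0"
      by (rule loss'_orthogonal_last_difference[OF less.prems]) (rule later; assumption)
    thus ?thesis using later[OF less.prems] by simp
  qed
  finally show ?case .
qed

text \<open>Along any bounded adapted direction of perturbation, all optimizers have the same first-order effect.\<close>

lemma direction_invariance:
  assumes \<Psi> [measurable]: "\<Psi> \<in> borel_measurable borel" and dep: "\<And>t. depends_on {..t} (\<lambda>x. \<Psi> x $ t)"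
    and bdd: "\<And>x. norm (\<Psi> x) \<le> B"
  shows "(\<integral>x. deriv loss (payoff X0 g a x) * (\<Sum>t\<in>UNIV. (b t x - a t x) * (\<Psi> x $ t - prev_val 0 (\<Psi> x) t)) \<partial>P) = 0"
proof -
  note ca = optimalD(1)[OF a] and cb = optimalD(1)[OF b]
  note [measurable] = controlsD(1)[OF ca] controlsD(1)[OF cb]
  let ?M = "\<lambda>x. deriv loss (payoff X0 g a x)"
  define \<theta> where "\<theta> t x = (b t x - a t x) * (\<Psi> x $ t - prev_val 0 (\<Psi> x) t)" for t x
  have \<theta>: "\<theta> t \<in> borel_measurable borel" "depends_on {..t} (\<theta> t)" for t
  proof -
    show "\<theta> t \<in> borel_measurable borel" unfolding \<theta>_def by measurable
    have "depends_on {..t} (a t)" "depends_on {..t} (b t)"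
      using controlsD(2)[OF ca, of t] controlsD(2)[OF cb, of t] by (auto elim!: depends_on_mono[rotated])
    moreover have "depends_on {..t} (\<lambda>x. prev_val 0 (\<Psi> x) t)"
    proof (cases "{..<t} = {}")
      case False
      have "Max {..<t} < t" using Max_in[of "{..<t}"] False by simp
      hence "depends_on {..t} (\<lambda>x. \<Psi> x $ Max {..<t})"
        by (intro depends_on_mono[OF _ dep]) auto
      thus ?thesis using False by (simp add: prev_val_def)
    qed (simp add: prev_val_def depends_on_const)
    ultimately show "depends_on {..t} (\<theta> t)"
      using dep[of t] unfolding \<theta>_def by (intro depends_on_mult depends_on_diff)
  qed
  define K where "K = 2 * L * (2 * B)"
  have \<theta>_bdd: "\<bar>\<theta> t x\<bar> \<le> K * (1 + norm x)" for t x
  proof -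
    have B: "B \<ge> 0" using bdd[of x] norm_ge_zero order_trans by blast
    have "\<bar>\<theta> t x\<bar> \<le> 2 * L * (2 * B)"
      unfolding \<theta>_def abs_mult
    proof (intro mult_mono)
      show "\<bar>b t x - a t x\<bar> \<le> 2 * L"
        using controlsD(3)[OF ca, of t x] controlsD(3)[OF cb, of t x] by linarith
      show "\<bar>\<Psi> x $ t - prev_val 0 (\<Psi> x) t\<bar> \<le> 2 * B"
        using component_le_norm_cart[of "\<Psi> x" t] abs_prev_val_le[of 0 "\<Psi> x" t] bdd[of x] by simp
    qed (use L in auto)
    also have "\<dots> \<le> K * (1 + norm x)"
      using L B mult_left_mono[of 1 "1 + norm x" K] by (simp add: K_def)
    finally show ?thesis .
  qed
  have int: "integrable P (\<lambda>x. ?M x * \<theta> t x)" for t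
    by (rule integrable_loss'_mult[OF P ca \<theta>(1) \<theta>_bdd])
  have "(\<integral>x. ?M x * \<theta> t x \<partial>P) = 0" for t
  proof -
    have eq: "indicator {x. \<exists>s\<ge>t. a s x \<noteq> b s x} x * \<theta> t x = \<theta> t x" for x
      by (auto simp: indicator_def \<theta>_def)
    show ?thesis using loss'_orthogonal_difference[OF \<theta> \<theta>_bdd, of t] unfolding eq .
  qed
  hence "(\<integral>x. (\<Sum>t\<in>UNIV. ?M x * \<theta> t x) \<partial>P) = 0" using int by simp
  thus ?thesis by (simp add: sum_distrib_left \<theta>_def)
qed

end

end

section \<open>Compactness of controls\<close>

context hedging
begin

text \<open>A substitute for weak compactness. In a decreasing sequence of midpoint-convex sets, almost minimizers of the
\<open>L\<^sup>2\<close>-norm satisfy a Cauchy estimate by the parallelogram law; a subsequence chosen with a geometric rate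
converges almost surely.\<close>

lemma controls_cluster_point:
  assumes C: "\<And>n. C n \<subseteq> controls L" and dec: "\<And>m n. m \<le> n \<Longrightarrow> C n \<subseteq> C m" and ne: "\<And>n. C n \<noteq> {}"
    and mid: "\<And>n a b. a \<in> C n \<Longrightarrow> b \<in> C n \<Longrightarrow> mix (\<lambda>_ _. 1 / 2) a b \<in> C n"
  obtains u a where "\<And>n::nat. u n \<in> C n" "a \<in> controls L" "AE x in P. \<forall>t. (\<lambda>n. u n t x) \<longlonglongrightarrow> a t x"
proof -
  have bounded_int: "integrable P f" if "f \<in> borel_measurable borel" "\<And>x. \<bar>f x\<bar> \<le> B" for f :: "'n path \<Rightarrow> real" and B
    using that by (intro P.integrable_const_bound[of _ B]) auto
  define sq where "sq a x = (\<Sum>t\<in>UNIV. (a t x)\<^sup>2)" for a :: "'n \<Rightarrow> 'n path \<Rightarrow> real" and x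
  define E where "E a = (\<integral>x. sq a x \<partial>P)" for a
  define B where "B = (\<Sum>t\<in>(UNIV :: 'n set). L\<^sup>2)"
  have sq_int: "integrable P (sq a)" if a [measurable]: "\<And>t. a t \<in> borel_measurable borel" and bd: "\<And>t x. \<bar>a t x\<bar> \<le> K" for a K
  proof (rule bounded_int)
    show "sq a \<in> borel_measurable borel" unfolding sq_def by measurable
    fix x
    have "sq a x \<le> (\<Sum>t\<in>(UNIV :: 'n set). K\<^sup>2)"
      unfolding sq_def using bd by (intro sum_mono) (simp add: abs_le_square_iff[symmetric] order_trans[OF _ abs_ge_self])
    moreover have "sq a x \<ge> 0" by (simp add: sq_def sum_nonneg)
    ultimately show "\<bar>sq a x\<bar> \<le> (\<Sum>t\<in>(UNIV :: 'n set). K\<^sup>2)" by simp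
  qed
  have E_int: "integrable P (sq a)" if "a \<in> controls L" for a
    by (rule sq_int) (use controlsD[OF that] in auto)
  have E: "0 \<le> E a" "E a \<le> B" if a: "a \<in> controls L" for a
  proof -
    show "0 \<le> E a" unfolding E_def by (rule Bochner_Integration.integral_nonneg) (simp add: sq_def sum_nonneg)
    have "E a \<le> (\<integral>x. B \<partial>P)"
      unfolding E_def
    proof (rule integral_mono[OF E_int[OF a]])
      fix x
      show "sq a x \<le> B" unfolding sq_def B_def
        using controlsD(3)[OF a] by (intro sum_mono) (simp add: abs_le_square_iff[symmetric] order_trans[OF _ abs_ge_self])
    qed simp
    thus "E a \<le> B" by (simp add: P.prob_space)
  qed
  \<comment> \<open>The minimal squared norms increase to a finite limit \<open>\<mu>\<close>.\<close>
  define m where "m n = Inf (E ` C n)" for n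
  have bdd: "bdd_below (E ` C n)" for n
    using C E(1) by (intro bdd_belowI2[of _ 0]) auto
  have m_le: "m n \<le> E a" if "a \<in> C n" for n a
    unfolding m_def by (rule cINF_lower[OF bdd that])
  have m_B: "m n \<le> B" for n
  proof -
    obtain a where "a \<in> C n" using ne[of n] by blast
    thus ?thesis using m_le[of a n] E(2)[of a] C[of n] by auto
  qed
  have m_mono: "m k \<le> m n" if "k \<le> n" for k n
    unfolding m_def by (rule cINF_superset_mono[OF ne bdd dec[OF that]]) simp
  define \<mu> where "\<mu> = (SUP n. m n)"
  have bdd_m: "bdd_above (range m)" using m_B by (intro bdd_aboveI2[of _ _ B]) auto
  have m_mu: "m n \<le> \<mu>" for n unfolding \<mu>_def by (rule cSUP_upper[OF _ bdd_m]) simp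
  have "\<exists>k. \<mu> - (1 / 4) ^ j < m k" for j :: nat
  proof -
    have "\<mu> - (1 / 4) ^ j < (SUP n. m n)" by (simp add: \<mu>_def)
    thus ?thesis using less_cSUP_iff[OF _ bdd_m, of "\<mu> - (1 / 4) ^ j"] by auto
  qed
  then obtain k where k: "\<And>j. \<mu> - (1 / 4) ^ j < m (k j)" by metis
  define N where "N j = (\<Sum>i\<le>j. k i) + j" for j
  have N_mono: "N i \<le> N j" if "i \<le> j" for i j
    unfolding N_def using that by (intro add_mono sum_mono2) auto
  have N_ge: "k j \<le> N j" "j \<le> N j" for j
    using member_le_sum[of j "{..j}" k] by (auto simp: N_def)
  have mN: "\<mu> - (1 / 4) ^ j < m (N j)" for j
    using k[of j] m_mono[OF N_ge(1), of j] by linarith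
  have "\<exists>a. a \<in> C (N j) \<and> E a < m (N j) + (1 / 4) ^ j" for j
  proof -
    have "Inf (E ` C (N j)) < m (N j) + (1 / 4) ^ j" by (simp add: m_def)
    thus ?thesis using cINF_less_iff[OF ne bdd] by auto
  qed
  then obtain u where u: "\<And>j. u j \<in> C (N j)" "\<And>j. E (u j) < m (N j) + (1 / 4) ^ j" by metis
  have uc: "u j \<in> controls L" for j using u(1) C by blast
  note [measurable] = controlsD(1)[OF uc]
  \<comment> \<open>The parallelogram law; the midpoint lies in \<open>C (N j)\<close> and has squared norm at least \<open>m (N j)\<close>.\<close>
  have incr: "(\<integral>x. sq (\<lambda>t x. u (Suc j) t x - u j t x) x \<partial>P) \<le> 8 * (1 / 4) ^ j" for j
  proof -
    define v where "v = mix (\<lambda>_ _. 1 / 2) (u j) (u (Suc j))"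
    have "u (Suc j) \<in> C (N j)" using u(1)[of "Suc j"] dec[OF N_mono[of j "Suc j"]] by auto
    hence v: "v \<in> C (N j)" unfolding v_def by (intro mid u(1))
    hence vc: "v \<in> controls L" using C by blast
    have di: "integrable P (sq (\<lambda>t x. u (Suc j) t x - u j t x))"
    proof (rule sq_int)
      show "(\<lambda>x. u (Suc j) t x - u j t x) \<in> borel_measurable borel" for t by measurable
      show "\<bar>u (Suc j) t x - u j t x\<bar> \<le> 2 * L" for t x
        using controlsD(3)[OF uc, of j t x] controlsD(3)[OF uc, of "Suc j" t x] by linarith
    qed
    have "sq (\<lambda>t x. u (Suc j) t x - u j t x) x = 2 * sq (u j) x + 2 * sq (u (Suc j)) x - 4 * sq v x" for x
      unfolding sq_def sum_distrib_left sum.distrib[symmetric] sum_subtractf[symmetric]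
      by (intro sum.cong) (auto simp: v_def mix_def power2_eq_square field_simps)
    hence "(\<integral>x. sq (\<lambda>t x. u (Suc j) t x - u j t x) x \<partial>P) = 2 * E (u j) + 2 * E (u (Suc j)) - 4 * E v"
      using E_int[OF uc] E_int[OF vc] by (simp add: E_def)
    also have "\<dots> \<le> 8 * (1 / 4) ^ j"
      using m_le[OF v] mN[of j] u(2)[of j] u(2)[of "Suc j"] m_mu[of "N j"] m_mu[of "N (Suc j)"] by simp
    finally show ?thesis .
  qed
  have conv: "AE x in P. convergent (\<lambda>j. u j t x)" for t
  proof (rule AE_convergent_of_summable_increments)
    have b: "\<bar>u (Suc j) t x - u j t x\<bar> \<le> 2 * L" for j x
      using controlsD(3)[OF uc, of j t x] controlsD(3)[OF uc, of "Suc j" t x] by linarith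
    show "integrable P (u j t)" for j
      using controlsD[OF uc] by (intro bounded_int) auto
    have "(\<integral>x. \<bar>u (Suc j) t x - u j t x\<bar> \<partial>P) \<le> 5 * (1 / 2) ^ j" for j
    proof -
      let ?e = "(1 / 2 :: real) ^ j"
      have e: "?e > 0" "(1 / 4) ^ j = ?e * ?e" by (simp_all add: power_mult_distrib[symmetric])
      have bd: "\<bar>u (Suc j) t x - u j t x\<bar> \<le> (sq (\<lambda>t x. u (Suc j) t x - u j t x) x / ?e + ?e) / 2" for x
      proof -
        let ?y = "\<bar>u (Suc j) t x - u j t x\<bar>"
        have "0 \<le> (?y - ?e)\<^sup>2" by simp
        hence "2 * ?y * ?e \<le> ?y\<^sup>2 + ?e * ?e" by (simp add: power2_eq_square algebra_simps)
        also have "?y\<^sup>2 \<le> sq (\<lambda>t x. u (Suc j) t x - u j t x) x"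
          unfolding sq_def using member_le_sum[of t UNIV "\<lambda>t. (u (Suc j) t x - u j t x)\<^sup>2"] by simp
        finally show ?thesis using e(1) by (simp add: field_simps)
      qed
      have di: "integrable P (sq (\<lambda>t x. u (Suc j) t x - u j t x))"
      proof (rule sq_int)
        show "(\<lambda>x. u (Suc j) t x - u j t x) \<in> borel_measurable borel" for t by measurable
        show "\<bar>u (Suc j) t x - u j t x\<bar> \<le> 2 * L" for t x
          using controlsD(3)[OF uc, of j t x] controlsD(3)[OF uc, of "Suc j" t x] by linarith
      qed
      have "(\<integral>x. \<bar>u (Suc j) t x - u j t x\<bar> \<partial>P) \<le> (\<integral>x. (sq (\<lambda>t x. u (Suc j) t x - u j t x) x / ?e + ?e) / 2 \<partial>P)"
      proof (rule integral_mono[OF _ _ bd])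
        show "integrable P (\<lambda>x. \<bar>u (Suc j) t x - u j t x\<bar>)"
          by (rule bounded_int[of _ "2 * L"]) (simp_all add: b)
        show "integrable P (\<lambda>x. (sq (\<lambda>t x. u (Suc j) t x - u j t x) x / ?e + ?e) / 2)"
          using di by simp
      qed
      also have "\<dots> = ((\<integral>x. sq (\<lambda>t x. u (Suc j) t x - u j t x) x \<partial>P) / ?e + ?e) / 2"
        using di by (simp add: P.prob_space)
      also have "\<dots> \<le> (8 * (?e * ?e) / ?e + ?e) / 2"
        using incr[of j] e by (intro divide_right_mono add_right_mono) auto
      also have "\<dots> \<le> 5 * ?e" using e(1) by simp
      finally show ?thesis .
    qed
    note bound = this
    show "summable (\<lambda>j. \<integral>x. \<bar>u (Suc j) t x - u j t x\<bar> \<partial>P)"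
    proof (rule summable_comparison_test'[of "\<lambda>j. 5 * (1 / 2 :: real) ^ j" 0])
      show "summable (\<lambda>j. 5 * (1 / 2 :: real) ^ j)"
        by (intro summable_mult summable_geometric) simp
      fix j
      have "0 \<le> (\<integral>x. \<bar>u (Suc j) t x - u j t x\<bar> \<partial>P)"
        by (rule Bochner_Integration.integral_nonneg) (rule abs_ge_zero)
      thus "norm (\<integral>x. \<bar>u (Suc j) t x - u j t x\<bar> \<partial>P) \<le> 5 * (1 / 2) ^ j"
        unfolding real_norm_def by (rule order_trans[OF eq_refl[OF abs_of_nonneg] bound])
    qed
  qed
  \<comment> \<open>Clipping keeps the bound also at paths where the sequence diverges.\<close>
  define a where "a t x = max (- L) (min L (lim (\<lambda>j. u j t x)))" for t x
  have "a \<in> controls L"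
  proof (rule controlsI)
    show "a t \<in> borel_measurable borel" for t unfolding a_def by measurable
    show "\<bar>a t x\<bar> \<le> L" for t x using L by (auto simp: a_def)
    show "depends_on {..<t} (a t)" for t
      unfolding depends_on_def
    proof (intro allI impI)
      fix x y :: "'n path" assume "\<forall>s\<in>{..<t}. x $ s = y $ s"
      hence "u j t x = u j t y" for j using depends_onD[OF controlsD(2)[OF uc], of t x y j] by blast
      thus "a t x = a t y" by (simp add: a_def)
    qed
  qed
  moreover have "AE x in P. \<forall>t\<in>UNIV. convergent (\<lambda>j. u j t x)"
    using conv by (intro AE_ball_countable[THEN iffD2]) (auto simp: countable_finite)
  hence "AE x in P. \<forall>t. (\<lambda>j. u j t x) \<longlonglongrightarrow> a t x"
  proof eventually_elim
    case (elim x)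
    show ?case
    proof
      fix t
      have "(\<lambda>j. u j t x) \<longlonglongrightarrow> lim (\<lambda>j. u j t x)"
        using elim by (simp add: convergent_LIMSEQ_iff)
      hence "(\<lambda>j. max (- L) (min L (u j t x))) \<longlonglongrightarrow> a t x"
        unfolding a_def by (intro tendsto_intros)
      moreover have "max (- L) (min L (u j t x)) = u j t x" for j
        using controlsD(3)[OF uc, of j t x] by (auto simp: abs_le_iff)
      ultimately show "(\<lambda>j. u j t x) \<longlonglongrightarrow> a t x" by simp
    qed
  qed
  moreover have "u j \<in> C j" for j using u(1)[of j] dec[OF N_ge(2), of j] by auto
  ultimately show thesis using that by blast
qed

lemma expected_loss_tendsto:
  assumes u: "\<And>n. u n \<in> controls L" and a: "a \<in> controls L"
    and conv: "AE x in P. \<forall>t. (\<lambda>n::nat. u n t x) \<longlonglongrightarrow> a t x"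
  shows "(\<lambda>n. expected_loss P (u n)) \<longlonglongrightarrow> expected_loss P a"
proof -
  obtain C where C: "\<And>a x. a \<in> controls L \<Longrightarrow> \<bar>loss (payoff X0 g a x)\<bar> \<le> C * (1 + norm x) powr p"
    using payoff_growth by metis
  show ?thesis
    unfolding expected_loss_def
  proof (rule integral_dominated_convergence)
    show "integrable P (\<lambda>x. C * (1 + norm x) powr p)"
      by (rule integrable_growth[OF P, of _ "\<bar>C\<bar>"]) (auto simp: abs_mult)
    show "(\<lambda>x. loss (payoff X0 g a x)) \<in> borel_measurable P" "(\<lambda>x. loss (payoff X0 g (u n) x)) \<in> borel_measurable P" for n
      using a u by measurable
    show "AE x in P. norm (loss (payoff X0 g (u n) x)) \<le> C * (1 + norm x) powr p" for n
      using C[OF u] by simp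
    show "AE x in P. (\<lambda>n. loss (payoff X0 g (u n) x)) \<longlonglongrightarrow> loss (payoff X0 g a x)"
      using conv
    proof eventually_elim
      case (elim x)
      hence "(\<lambda>n. payoff X0 g (u n) x) \<longlonglongrightarrow> payoff X0 g a x"
        unfolding payoff_def by (intro tendsto_intros) auto
      thus ?case by (intro continuous_on_tendsto_compose[OF loss_cont]) auto
    qed
  qed
qed

lemma expected_loss_midpoint:
  assumes a: "a \<in> controls L" and b: "b \<in> controls L"
  shows "mix (\<lambda>_ _. 1 / 2) a b \<in> controls L"
    and "expected_loss P (mix (\<lambda>_ _. 1 / 2) a b) \<le> (expected_loss P a + expected_loss P b) / 2"
proof -
  show m: "mix (\<lambda>_ _. 1 / 2) a b \<in> controls L"
    by (intro mix_controls a b) (auto simp: depends_on_const)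
  have "loss (payoff X0 g (mix (\<lambda>_ _. 1 / 2) a b) x) \<le> (loss (payoff X0 g a x) + loss (payoff X0 g b x)) / 2" for x
  proof -
    let ?u = "payoff X0 g a x" and ?v = "payoff X0 g b x"
    have w: "payoff X0 g (mix (\<lambda>_ _. 1 / 2) a b) x = (?u + ?v) / 2"
      unfolding payoff_mix_const by (simp add: field_simps)
    show ?thesis
      using loss_ge_tangent[of "(?u + ?v) / 2" ?u] loss_ge_tangent[of "(?u + ?v) / 2" ?v]
      unfolding w by (simp add: field_simps)
  qed
  hence "expected_loss P (mix (\<lambda>_ _. 1 / 2) a b) \<le> (\<integral>x. (loss (payoff X0 g a x) + loss (payoff X0 g b x)) / 2 \<partial>P)"
    unfolding expected_loss_def using integrable_loss[OF P] a b m by (intro integral_mono) auto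
  thus "expected_loss P (mix (\<lambda>_ _. 1 / 2) a b) \<le> (expected_loss P a + expected_loss P b) / 2"
    using integrable_loss[OF P] a b by (simp add: expected_loss_def)
qed

lemma optimal_limit:
  assumes u: "\<And>n. u n \<in> controls L" "\<And>n. expected_loss P (u n) \<le> hedging_value L X0 loss g P + 1 / (real n + 1)"
    and a: "a \<in> controls L" and conv: "AE x in P. \<forall>t. (\<lambda>n. u n t x) \<longlonglongrightarrow> a t x"
  shows "optimal a"
proof -
  have "(\<lambda>n. hedging_value L X0 loss g P + 1 / (real n + 1)) \<longlonglongrightarrow> hedging_value L X0 loss g P + 0"
    by (intro tendsto_intros) real_asymp
  hence "expected_loss P a \<le> hedging_value L X0 loss g P"
    using LIMSEQ_le[OF expected_loss_tendsto[OF u(1) a conv]] u(2) by simp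
  thus ?thesis
    using hedging_value_le[OF P a] a by (simp add: optimal_control_def expected_loss_def)
qed

lemma optimal_exists: "\<exists>a. optimal a"
proof -
  let ?hv = "hedging_value L X0 loss g P"
  define C where "C n = {b \<in> controls L. expected_loss P b \<le> ?hv + 1 / (real n + 1)}" for n
  obtain u a where ua: "\<And>n. u n \<in> C n" "a \<in> controls L" "AE x in P. \<forall>t. (\<lambda>n. u n t x) \<longlonglongrightarrow> a t x"
  proof (rule controls_cluster_point[of C])
    show "C n \<subseteq> controls L" for n by (auto simp: C_def)
    show "C n \<subseteq> C m" if "m \<le> n" for m n
      using that frac_le[of 1 1 "real m + 1" "real n + 1"] by (auto simp: C_def)
    show "C n \<noteq> {}" for n
      using hedging_value_approx[OF P, of "1 / (real n + 1)"] by (auto simp: C_def intro: less_imp_le)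
    show "mix (\<lambda>_ _. 1 / 2) a b \<in> C n" if "a \<in> C n" "b \<in> C n" for n a b
      using that expected_loss_midpoint[of a b] by (auto simp: C_def)
  qed blast
  show ?thesis
    using optimal_limit[of u a] ua by (auto simp: C_def)
qed

text \<open>The linear functional comparing the first-order effect of the control \<open>b\<close> with that of \<open>a\<close> when
the path is displaced in direction \<open>\<Psi>\<close>.\<close>

definition drift :: "('n \<Rightarrow> 'n path \<Rightarrow> real) \<Rightarrow> ('n path \<Rightarrow> 'n path) \<Rightarrow> ('n \<Rightarrow> 'n path \<Rightarrow> real) \<Rightarrow> real" where
  "drift a \<Psi> b = (\<integral>x. deriv loss (payoff X0 g a x)
      * (\<Sum>t\<in>UNIV. (b t x - a t x) * (\<Psi> x $ t - prev_val 0 (\<Psi> x) t)) \<partial>P)"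

lemma drift_growth:
  fixes a :: "'n \<Rightarrow> 'n path \<Rightarrow> real" and \<Psi> :: "'n path \<Rightarrow> 'n path"
  assumes a: "a \<in> controls L" and bdd: "\<And>x. norm (\<Psi> x) \<le> B"
  shows "\<exists>K. \<forall>b\<in>controls L. \<forall>x.
    \<bar>\<Sum>t\<in>UNIV. (b t x - a t x) * (\<Psi> x $ t - prev_val 0 (\<Psi> x) t)\<bar> \<le> K * (1 + norm x)"
proof -
  define K where "K = real CARD('n) * (2 * L * (2 * B))"
  have B: "B \<ge> 0" using bdd[of 0] norm_ge_zero order_trans by blast
  show ?thesis
  proof (intro exI[of _ K] ballI allI)
    fix b :: "'n \<Rightarrow> 'n path \<Rightarrow> real" and x assume b: "b \<in> controls L"
    have "\<bar>(b t x - a t x) * (\<Psi> x $ t - prev_val 0 (\<Psi> x) t)\<bar> \<le> 2 * L * (2 * B)" for t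
      unfolding abs_mult
    proof (intro mult_mono)
      show "\<bar>b t x - a t x\<bar> \<le> 2 * L"
        using controlsD(3)[OF a, of t x] controlsD(3)[OF b, of t x] by linarith
      show "\<bar>\<Psi> x $ t - prev_val 0 (\<Psi> x) t\<bar> \<le> 2 * B"
        using component_le_norm_cart[of "\<Psi> x" t] abs_prev_val_le[of 0 "\<Psi> x" t] bdd[of x] by simp
    qed (use L in auto)
    hence "\<bar>\<Sum>t\<in>UNIV. (b t x - a t x) * (\<Psi> x $ t - prev_val 0 (\<Psi> x) t)\<bar> \<le> (\<Sum>t\<in>(UNIV::'n set). 2 * L * (2 * B))"
      by (intro order_trans[OF sum_abs] sum_mono)
    also have "\<dots> = K" by (simp add: K_def)
    also have "\<dots> \<le> K * (1 + norm x)"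
      using L B mult_left_mono[of 1 "1 + norm x" K] by (simp add: K_def)
    finally show "\<bar>\<Sum>t\<in>UNIV. (b t x - a t x) * (\<Psi> x $ t - prev_val 0 (\<Psi> x) t)\<bar> \<le> K * (1 + norm x)" .
  qed
qed

text \<open>The optimizer of a perturbed problem need not be close to \<open>a\<close>. It is nearly optimal, however, and nearly
optimal controls accumulate at optimizers, whose drift vanishes by \<open>direction_invariance\<close>.\<close>

lemma near_optimal_drift:
  assumes a: "optimal a" and \<Psi> [measurable]: "\<Psi> \<in> borel_measurable borel"
    and dep: "\<And>t. depends_on {..t} (\<lambda>x. \<Psi> x $ t)" and bdd: "\<And>x. norm (\<Psi> x) \<le> B" and e: "e > 0"
  shows "\<exists>\<delta>>0. \<forall>b\<in>controls L. expected_loss P b \<le> hedging_value L X0 loss g P + \<delta> \<longrightarrow> - e \<le> drift a \<Psi> b"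
proof (rule ccontr)
  assume contr: "\<not> ?thesis"
  let ?hv = "hedging_value L X0 loss g P"
  note ca = optimalD(1)[OF a]
  define W where "W b x = (\<Sum>t\<in>UNIV. (b t x - a t x) * (\<Psi> x $ t - prev_val 0 (\<Psi> x) t))" for b x
  have drift: "drift a \<Psi> b = (\<integral>x. deriv loss (payoff X0 g a x) * W b x \<partial>P)" for b
    by (simp add: drift_def W_def)
  have Wm: "W b \<in> borel_measurable borel" if "b \<in> controls L" for b
  proof -
    note [measurable] = controlsD(1)[OF that] controlsD(1)[OF ca]
    show ?thesis unfolding W_def by measurable
  qed
  obtain K where "\<forall>b\<in>controls L. \<forall>x. \<bar>W b x\<bar> \<le> K * (1 + norm x)"
    using drift_growth[where \<Psi> = \<Psi>, OF ca bdd] unfolding W_def by (rule exE)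
  hence W: "\<bar>W b x\<bar> \<le> K * (1 + norm x)" if "b \<in> controls L" for b x using that by blast
  have Wi: "integrable P (\<lambda>x. deriv loss (payoff X0 g a x) * W b x)" if "b \<in> controls L" for b
    by (rule integrable_loss'_mult[OF P ca Wm[OF that] W[OF that]])
  define C where "C n = {b \<in> controls L. expected_loss P b \<le> ?hv + 1 / (real n + 1) \<and> drift a \<Psi> b \<le> - e}" for n
  obtain u b where ub: "\<And>n. u n \<in> C n" "b \<in> controls L" "AE x in P. \<forall>t. (\<lambda>n. u n t x) \<longlonglongrightarrow> b t x"
  proof (rule controls_cluster_point[of C])
    show "C n \<subseteq> controls L" for n by (auto simp: C_def)
    show "C n \<subseteq> C m" if "m \<le> n" for m n
      using that frac_le[of 1 1 "real m + 1" "real n + 1"] by (auto simp: C_def)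
    show "C n \<noteq> {}" for n
    proof -
      have "1 / (real n + 1) > 0" by simp
      then obtain b where "b \<in> controls L" "expected_loss P b \<le> ?hv + 1 / (real n + 1)" "\<not> - e \<le> drift a \<Psi> b"
        using contr by blast
      thus ?thesis by (auto simp: C_def)
    qed
    show "mix (\<lambda>_ _. 1 / 2) b b' \<in> C n" if "b \<in> C n" "b' \<in> C n" for n b b'
    proof -
      have c: "b \<in> controls L" "b' \<in> controls L" using that by (auto simp: C_def)
      have "W (mix (\<lambda>_ _. 1 / 2) b b') x = (W b x + W b' x) / 2" for x
        unfolding W_def sum.distrib[symmetric] sum_divide_distrib
        by (intro sum.cong) (auto simp: mix_def field_simps)
      hence "drift a \<Psi> (mix (\<lambda>_ _. 1 / 2) b b') = (drift a \<Psi> b + drift a \<Psi> b') / 2"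
        using Wi[OF c(1)] Wi[OF c(2)] by (simp add: drift algebra_simps add_divide_distrib)
      thus ?thesis using that expected_loss_midpoint[OF c] by (auto simp: C_def)
    qed
  qed blast
  have uc: "u n \<in> controls L" for n using ub(1)[of n] by (simp add: C_def)
  have b: "optimal b"
    using optimal_limit[of u b] ub by (auto simp: C_def)
  obtain D where D: "\<And>a' x. a' \<in> controls L \<Longrightarrow> \<bar>deriv loss (payoff X0 g a' x) * (K * (1 + norm x))\<bar> \<le> D * (1 + norm x) powr p"
    using loss'_mult_growth[of "\<lambda>x. K * (1 + norm x)" "\<bar>K\<bar>"] by (auto simp: abs_mult)
  have "(\<lambda>n. drift a \<Psi> (u n)) \<longlonglongrightarrow> drift a \<Psi> b"
    unfolding drift
  proof (rule integral_dominated_convergence)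
    show "integrable P (\<lambda>x. D * (1 + norm x) powr p)"
      by (rule integrable_growth[OF P, of _ "\<bar>D\<bar>"]) (auto simp: abs_mult)
    show "(\<lambda>x. deriv loss (payoff X0 g a x) * W b x) \<in> borel_measurable P"
      "(\<lambda>x. deriv loss (payoff X0 g a x) * W (u n) x) \<in> borel_measurable P" for n
      using Wi[OF ub(2)] Wi[OF uc] by auto
    show "AE x in P. norm (deriv loss (payoff X0 g a x) * W (u n) x) \<le> D * (1 + norm x) powr p" for n
    proof (rule AE_I2)
      fix x
      have "norm (deriv loss (payoff X0 g a x) * W (u n) x) \<le> \<bar>deriv loss (payoff X0 g a x) * (K * (1 + norm x))\<bar>"
        unfolding real_norm_def abs_mult[of "deriv loss (payoff X0 g a x)"]
        by (rule mult_left_mono[OF order_trans[OF W[OF uc] abs_ge_self]]) simp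
      thus "norm (deriv loss (payoff X0 g a x) * W (u n) x) \<le> D * (1 + norm x) powr p"
        using D[OF ca, of x] by linarith
    qed
    show "AE x in P. (\<lambda>n. deriv loss (payoff X0 g a x) * W (u n) x) \<longlonglongrightarrow> deriv loss (payoff X0 g a x) * W b x"
      using ub(3) by eventually_elim (auto simp: W_def intro!: tendsto_intros)
  qed
  hence "drift a \<Psi> b \<le> - e"
    by (rule LIMSEQ_le_const2) (use ub(1) in \<open>auto simp: C_def\<close>)
  moreover have "drift a \<Psi> b = 0"
    unfolding drift_def by (rule direction_invariance[OF a b \<Psi> dep bdd])
  ultimately show False using e by simp
qed

end

section \<open>The upper bound\<close>

lemma path_eq_sum: "d = (\<Sum>t\<in>UNIV. (d $ t) *\<^sub>R axis t (1 :: real))"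
  by (simp add: vec_eq_iff axis_def if_distrib if_distribR cong: if_cong)

lemma norm_powr_le_sum:
  fixes d :: "real ^ 'n"
  assumes "p > 0"
  shows "norm d powr p \<le> real CARD('n) powr p * (\<Sum>t\<in>UNIV. \<bar>d $ t\<bar> powr p)"
proof -
  define m where "m = Max (range (\<lambda>t. \<bar>d $ t\<bar>))"
  have m: "\<bar>d $ t\<bar> \<le> m" for t unfolding m_def by (rule Max_ge) auto
  have "m \<in> range (\<lambda>t. \<bar>d $ t\<bar>)" unfolding m_def by (rule Max_in) auto
  then obtain t where t: "m = \<bar>d $ t\<bar>" by blast
  have "norm d \<le> (\<Sum>t\<in>UNIV. \<bar>d $ t\<bar>)" by (rule norm_le_l1_cart)
  also have "\<dots> \<le> (\<Sum>t\<in>(UNIV :: 'n set). m)" by (intro sum_mono m)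
  finally have "norm d powr p \<le> (real CARD('n) * m) powr p"
    using assms by (intro powr_mono2) auto
  also have "\<dots> = real CARD('n) powr p * \<bar>d $ t\<bar> powr p" by (simp add: powr_mult t)
  also have "\<dots> \<le> real CARD('n) powr p * (\<Sum>t\<in>UNIV. \<bar>d $ t\<bar> powr p)"
    by (intro mult_left_mono member_le_sum) auto
  finally show ?thesis .
qed

context hedging
begin

lemma conj_exponents: "q > 1" "(p - 1) * q = p" "q > 0"
  using conjugate_exponent[OF p q] by auto

text \<open>The partial derivative of the loss in the coordinate \<open>t\<close> of the path along the control \<open>a\<close>, with the
control values held fixed, and its conditional expectation given the past up to \<open>t\<close>. Up to sign, the latter is
the random variable whose norm is the sensitivity.\<close>

definition grad :: "('n \<Rightarrow> 'n path \<Rightarrow> real) \<Rightarrow> 'n \<Rightarrow> 'n path \<Rightarrow> real" where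
  "grad a t x = blinfun_apply (cost' (ctrl_vec a x, x)) (axis t 1)"

definition proj_grad :: "('n \<Rightarrow> 'n path \<Rightarrow> real) \<Rightarrow> 'n \<Rightarrow> 'n path \<Rightarrow> real" where
  "proj_grad a t = real_cond_exp P (natural_filtration t) (grad a t)"

lemma cost'_eq_grad: "blinfun_apply (cost' (ctrl_vec a x, x)) d = (\<Sum>t\<in>UNIV. d $ t * grad a t x)"
  by (subst path_eq_sum[of d]) (simp add: blinfun.sum_right blinfun.scaleR_right grad_def)

lemma partial_deriv_eq: "partial_deriv t g x = blinfun_apply (g' x) (axis t 1)"
proof -
  have "((\<lambda>h. g (x + h *\<^sub>R axis t 1)) has_derivative (\<lambda>h. blinfun_apply (g' (x + 0 *\<^sub>R axis t 1)) (h *\<^sub>R axis t 1))) (at 0)"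
    by (rule has_derivative_compose[OF _ g_deriv]) (auto intro!: derivative_eq_intros)
  hence "((\<lambda>h. g (x + h *\<^sub>R axis t 1)) has_real_derivative blinfun_apply (g' x) (axis t 1)) (at 0)"
    unfolding has_field_derivative_def by (rule has_derivative_eq_rhs)
      (simp add: fun_eq_iff blinfun.scaleR_right)
  thus ?thesis unfolding partial_deriv_def by (rule DERIV_imp_deriv)
qed

lemma partial_deriv_borel [measurable]: "partial_deriv t g \<in> borel_measurable borel"
  unfolding partial_deriv_eq[abs_def]
  by (intro borel_measurable_continuous_onI continuous_intros g'_cont)

lemma grad_eq:
  "grad a t x = deriv loss (payoff X0 g a x) * (partial_deriv t g x + (a t x - next_ctrl a t x))"
proof -
  have "(\<Sum>s\<in>UNIV. ctrl_vec a x $ s * (axis t 1 $ s - prev_val 0 (axis t 1) s))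
      = (\<Sum>s\<in>UNIV. axis t 1 $ s * (a s x - next_val (\<lambda>s. a s x) s))"
    using summation_by_parts[of "\<lambda>s. a s x" "axis t 1"] by (simp add: ctrl_vec_def)
  also have "\<dots> = a t x - next_ctrl a t x"
    by (simp add: axis_def next_ctrl_eq if_distrib if_distribR cong: if_cong)
  finally show ?thesis
    by (simp add: grad_def cost'_def blinfun.scaleR_left gain'_apply partial_deriv_eq payoff_eq_gain)
qed

context
  fixes a :: "'n \<Rightarrow> 'n path \<Rightarrow> real"
  assumes a: "a \<in> controls L"
begin

lemma ctrl_vec_borel [measurable]: "ctrl_vec a \<in> borel_measurable borel"
  by (rule borel_measurable_vec) (simp add: ctrl_vec_def controlsD[OF a])

lemma grad_borel [measurable]: "grad a t \<in> borel_measurable borel"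
proof -
  have [measurable]: "(\<lambda>z. blinfun_apply (cost' z) (axis t 1)) \<in> borel_measurable borel"
    by (intro borel_measurable_continuous_onI continuous_intros cost'_cont)
  have [measurable]: "(\<lambda>x. (ctrl_vec a x, x)) \<in> borel_measurable borel"
    unfolding borel_prod[symmetric] by measurable
  show ?thesis unfolding grad_def by measurable
qed

lemma grad_bound:
  obtains C where "C > 0" "\<And>t x. \<bar>grad a t x\<bar> \<le> C * (1 + norm x) powr (p - 1)"
proof -
  obtain C where C: "C > 0" "\<And>\<alpha> x. \<alpha> \<in> cube \<Longrightarrow> norm (cost' (\<alpha>, x)) \<le> C * (1 + norm x) powr (p - 1)"
    using growth_bounds by metis
  show thesis
  proof (rule that[OF C(1)])
    fix t x
    have "norm (grad a t x) \<le> norm (cost' (ctrl_vec a x, x)) * norm (axis t (1 :: real))"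
      unfolding grad_def by (rule norm_blinfun)
    hence "\<bar>grad a t x\<bar> \<le> norm (cost' (ctrl_vec a x, x))" by (simp add: norm_axis_1)
    thus "\<bar>grad a t x\<bar> \<le> C * (1 + norm x) powr (p - 1)"
      by (rule order_trans[OF _ C(2)[OF ctrl_vec_cube[OF a]]])
  qed
qed

lemma integrable_powr_growth:
  fixes f :: "'n path \<Rightarrow> real"
  assumes Q: "Q \<in> P_p p" and f [measurable]: "f \<in> borel_measurable borel"
    and bd: "\<And>x. \<bar>f x\<bar> \<le> C * (1 + norm x) powr (p - 1)"
  shows "integrable Q f" "integrable Q (\<lambda>x. \<bar>f x\<bar> powr q)"
proof -
  have "\<bar>f x\<bar> \<le> \<bar>C\<bar> * (1 + norm x) powr p" for x
  proof -
    have "\<bar>f x\<bar> \<le> \<bar>C\<bar> * (1 + norm x) powr (p - 1)"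
      by (rule order_trans[OF bd mult_right_mono]) auto
    also have "\<dots> \<le> \<bar>C\<bar> * (1 + norm x) powr p"
      by (intro mult_left_mono powr_mono) auto
    finally show ?thesis .
  qed
  thus "integrable Q f" by (rule integrable_growth[OF Q f])
  have "\<bar>\<bar>f x\<bar> powr q\<bar> \<le> \<bar>C\<bar> powr q * (1 + norm x) powr p" for x
  proof -
    have "\<bar>f x\<bar> \<le> \<bar>C\<bar> * (1 + norm x) powr (p - 1)"
      by (rule order_trans[OF bd mult_right_mono]) auto
    hence "\<bar>f x\<bar> powr q \<le> (\<bar>C\<bar> * (1 + norm x) powr (p - 1)) powr q"
      using conj_exponents by (intro powr_mono2) auto
    also have "\<dots> = \<bar>C\<bar> powr q * (1 + norm x) powr p"
      using conj_exponents by (simp add: powr_mult powr_powr)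
    finally show ?thesis by simp
  qed
  thus "integrable Q (\<lambda>x. \<bar>f x\<bar> powr q)" by (intro integrable_growth[OF Q]) auto
qed

lemma grad_integrable: "integrable P (grad a t)" "integrable P (\<lambda>x. \<bar>grad a t x\<bar> powr q)"
proof -
  obtain C where C: "\<And>x. \<bar>grad a t x\<bar> \<le> C * (1 + norm x) powr (p - 1)"
    using grad_bound by metis
  show "integrable P (grad a t)" "integrable P (\<lambda>x. \<bar>grad a t x\<bar> powr q)"
    by (rule integrable_powr_growth[OF P grad_borel C])+
qed

lemma finite_measure_subalgebra_natural: "finite_measure_subalgebra P (natural_filtration t)"
  unfolding natural_filtration_def
  by unfold_locales (rule subalgebra_coord_sigma; simp)

lemma proj_grad_borel [measurable]: "proj_grad a t \<in> borel_measurable borel"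
  and proj_grad_depends: "depends_on {..t} (proj_grad a t)"
  using depends_on_natural[of "proj_grad a t" "{..t}"]
  by (simp_all add: proj_grad_def natural_filtration_def)

lemma proj_grad_integrable: "integrable P (proj_grad a t)" "integrable P (\<lambda>x. \<bar>proj_grad a t x\<bar> powr q)"
proof -
  interpret F: finite_measure_subalgebra P "natural_filtration t" by (rule finite_measure_subalgebra_natural)
  show "integrable P (proj_grad a t)"
    unfolding proj_grad_def by (rule F.real_cond_exp_int) (rule grad_integrable)
  show "integrable P (\<lambda>x. \<bar>proj_grad a t x\<bar> powr q)"
    unfolding proj_grad_def
    by (rule F.integrable_convex_cond_exp[where I = UNIV])
      (use grad_integrable conj_exponents convex_on_abs_powr[of q] in auto)
qed

lemma proj_grad_test:
  assumes [measurable]: "\<theta> \<in> borel_measurable borel" and "depends_on {..t} \<theta>"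
    and "integrable P (\<lambda>x. \<theta> x * grad a t x)"
  shows "(\<integral>x. \<theta> x * grad a t x \<partial>P) = (\<integral>x. \<theta> x * proj_grad a t x \<partial>P)"
proof -
  interpret F: finite_measure_subalgebra P "natural_filtration t" by (rule finite_measure_subalgebra_natural)
  show ?thesis
    unfolding proj_grad_def
  proof (rule F.real_cond_exp_intg(2)[symmetric])
    show "\<theta> \<in> borel_measurable (natural_filtration t)"
      unfolding natural_filtration_def by (rule borel_measurable_coord_sigma[OF assms(1,2)])
  qed (fact assms(3), measurable)
qed

lemma sensitivity_eq:
  "sensitivity q X0 loss g P a = (\<Sum>t\<in>UNIV. \<integral>x. \<bar>proj_grad a t x\<bar> powr q \<partial>P) powr (1 / q)"
proof -
  let ?M = "\<lambda>x. deriv loss (payoff X0 g a x)"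
  have "(\<integral>x. \<bar>(next_ctrl a t x - a t x) * real_cond_exp P (natural_filtration t) ?M x
      - real_cond_exp P (natural_filtration t) (\<lambda>y. ?M y * partial_deriv t g y) x\<bar> powr q \<partial>P)
    = (\<integral>x. \<bar>proj_grad a t x\<bar> powr q \<partial>P)" for t
  proof -
    interpret F: finite_measure_subalgebra P "natural_filtration t" by (rule finite_measure_subalgebra_natural)
    obtain C where C: "\<And>x. \<bar>?M x\<bar> \<le> C * (1 + norm x) powr (p - 1)"
    proof -
      obtain C where "\<And>a x. a \<in> controls L \<Longrightarrow> \<bar>deriv loss (payoff X0 g a x)\<bar> \<le> C * (1 + norm x) powr (p - 1)"
        by (rule payoff_growth) blast
      with a that show thesis by blast
    qed
    obtain B where B: "\<And>x. norm (g' x) \<le> B" using g'_bdd by (auto simp: bounded_iff)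
    have B': "\<bar>partial_deriv t g x\<bar> \<le> B" for x
      unfolding partial_deriv_eq
      using norm_blinfun[of "g' x" "axis t 1"] B[of x] by (simp add: norm_axis_1)
    have M [measurable]: "?M \<in> borel_measurable borel" using a by measurable
    have iM: "integrable P ?M" by (rule integrable_powr_growth(1)[OF P M C])
    have iMp: "integrable P (\<lambda>y. ?M y * partial_deriv t g y)"
    proof (rule Bochner_Integration.integrable_bound[of P "\<lambda>y. B * ?M y"])
      show "integrable P (\<lambda>y. B * ?M y)" using iM by simp
      show "AE x in P. norm (?M x * partial_deriv t g x) \<le> norm (B * ?M x)"
      proof (rule AE_I2)
        fix x
        have "\<bar>partial_deriv t g x\<bar> * \<bar>?M x\<bar> \<le> \<bar>B\<bar> * \<bar>?M x\<bar>"
          by (rule mult_right_mono[OF order_trans[OF B' abs_ge_self]]) simp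
        thus "norm (?M x * partial_deriv t g x) \<le> norm (B * ?M x)"
          by (simp add: abs_mult mult.commute)
      qed
    qed measurable
    have nxt: "next_ctrl a t \<in> borel_measurable borel" "depends_on {..t} (next_ctrl a t)"
      "\<And>x. \<bar>next_ctrl a t x\<bar> \<le> L"
    proof -
      have "next_ctrl a t \<in> borel_measurable borel \<and> depends_on {..t} (next_ctrl a t) \<and> (\<forall>x. \<bar>next_ctrl a t x\<bar> \<le> L)"
      proof (cases "{t<..} = {}")
        case True
        thus ?thesis using L by (simp add: next_ctrl_def[abs_def] depends_on_const)
      next
        case False
        have "{..<Min {t<..}} \<subseteq> {..t}"
        proof
          fix s assume "s \<in> {..<Min {t<..}}"
          hence "\<not> Min {t<..} \<le> s" by simp
          hence "s \<notin> {t<..}" using Min_le[of "{t<..}" s] by auto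
          thus "s \<in> {..t}" by simp
        qed
        from depends_on_mono[OF this controlsD(2)[OF a]] show ?thesis
          using False controlsD[OF a] by (simp add: next_ctrl_def[abs_def])
      qed
      thus "next_ctrl a t \<in> borel_measurable borel" "depends_on {..t} (next_ctrl a t)"
        "\<And>x. \<bar>next_ctrl a t x\<bar> \<le> L" by auto
    qed
    have depa: "depends_on {..t} (a t)" by (rule depends_on_mono[OF _ controlsD(2)[OF a]]) auto
    define k where "k x = a t x - next_ctrl a t x" for x
    note [measurable] = controlsD(1)[OF a] nxt(1)
    have k [measurable]: "k \<in> borel_measurable borel" unfolding k_def by measurable
    have kF: "k \<in> borel_measurable (natural_filtration t)"
      unfolding natural_filtration_def
      by (rule borel_measurable_coord_sigma[OF k]) (unfold k_def, rule depends_on_diff[OF depa nxt(2)])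
    have ikM: "integrable P (\<lambda>y. k y * ?M y)"
    proof (rule Bochner_Integration.integrable_bound[of P "\<lambda>y. (2 * L) * ?M y"])
      show "integrable P (\<lambda>y. (2 * L) * ?M y)" using iM by simp
      have "\<bar>k x\<bar> \<le> 2 * L" for x
        using controlsD(3)[OF a, of t x] nxt(3)[of x] by (simp add: k_def)
      thus "AE x in P. norm (k x * ?M x) \<le> norm ((2 * L) * ?M x)"
        using L by (auto simp: abs_mult intro!: mult_right_mono)
    qed measurable
    have "grad a t = (\<lambda>y. ?M y * partial_deriv t g y + k y * ?M y)"
      by (rule ext) (simp add: grad_eq k_def algebra_simps)
    hence "AE x in P. proj_grad a t x = real_cond_exp P (natural_filtration t) (\<lambda>y. ?M y * partial_deriv t g y) x
        + k x * real_cond_exp P (natural_filtration t) ?M x"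
      unfolding proj_grad_def
      using F.real_cond_exp_add[OF iMp ikM] F.real_cond_exp_mult[OF kF _ ikM] iM
      by (auto elim: eventually_elim2)
    hence *: "AE x in P. \<bar>(next_ctrl a t x - a t x) * real_cond_exp P (natural_filtration t) ?M x
        - real_cond_exp P (natural_filtration t) (\<lambda>y. ?M y * partial_deriv t g y) x\<bar> powr q
        = \<bar>proj_grad a t x\<bar> powr q"
    proof eventually_elim
      case (elim x)
      have "(next_ctrl a t x - a t x) * real_cond_exp P (natural_filtration t) ?M x
        - real_cond_exp P (natural_filtration t) (\<lambda>y. ?M y * partial_deriv t g y) x = - proj_grad a t x"
        unfolding elim by (simp add: k_def algebra_simps)
      thus ?case by simp
    qed
    have [measurable]: "real_cond_exp P (natural_filtration t) f \<in> borel_measurable P" for f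
      by (rule measurable_from_subalg[OF F.subalg]) simp
    show ?thesis by (rule integral_cong_AE[OF _ _ *]) measurable
  qed
  thus ?thesis unfolding sensitivity_def by simp
qed

text \<open>The upper estimate for one bicausal coupling. Let \<open>b\<close> be the projection of \<open>a\<close> to \<open>Y\<close>. Convexity
and the tangent at the position produced by \<open>b\<close> show that using \<open>a(X)\<close> on the path \<open>Y\<close> costs at
least as much as using \<open>b(Y)\<close>. This is compared with \<open>a(X)\<close> on the path \<open>X\<close> by
Taylor expansion. The displacement at time \<open>t\<close> is known at time \<open>t\<close>, so by causality \<^term>\<open>grad\<close> may be
replaced by \<^term>\<open>proj_grad\<close>, and Hoelder's inequality gives the sensitivity.\<close>

lemma coupling_estimate:
  assumes \<pi>: "\<pi> \<in> bicausal_couplings P Q" and Q: "Q \<in> P_p p"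
    and \<rho>: "(\<Sum>t\<in>UNIV. \<integral>\<omega>. \<bar>fst \<omega> $ t - snd \<omega> $ t\<bar> powr p \<partial>\<pi>) powr (1 / p) \<le> \<rho>"
    and w [measurable]: "w \<in> borel_measurable borel" and w0: "\<And>x. 0 \<le> w x"
    and wq: "integrable P (\<lambda>x. \<bar>w x\<bar> powr q)" and D: "D \<ge> 0"
    and taylor: "\<And>\<alpha> x d. \<alpha> \<in> cube \<Longrightarrow>
      \<bar>loss (gain (\<alpha>, x + d)) - loss (gain (\<alpha>, x)) - blinfun_apply (cost' (\<alpha>, x)) d\<bar> \<le> norm d * w x + D * norm d powr p"
  shows "hedging_value L X0 loss g Q \<le> expected_loss P a
    + \<rho> * (\<Sum>t\<in>UNIV. \<integral>x. \<bar>proj_grad a t x\<bar> powr q \<partial>P) powr (1 / q)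
    + \<rho> * (\<Sum>t\<in>(UNIV :: 'n set). \<integral>x. \<bar>w x\<bar> powr q \<partial>P) powr (1 / q)
    + D * (real CARD('n) powr p * \<rho> powr p)"
proof -
  have \<pi>c: "\<pi> \<in> couplings P Q" and causal: "causal \<pi> fst snd" "causal \<pi> snd fst"
    using \<pi> by (auto simp: bicausal_couplings_def)
  note c = couplingsD[OF \<pi>c]
  note [measurable_cong] = c(2) and [measurable] = c(4,5)
  interpret prob_space \<pi> by (rule c)
  have sQ [measurable_cong]: "sets Q = sets borel" using Q by (rule P_pD)
  note [measurable] = controlsD(1)[OF a]
  have int_fst: "integrable \<pi> (\<lambda>\<omega>. f (fst \<omega>)) \<longleftrightarrow> integrable P f" "(\<integral>\<omega>. f (fst \<omega>) \<partial>\<pi>) = (\<integral>x. f x \<partial>P)"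
    if "f \<in> borel_measurable borel" for f :: "'n path \<Rightarrow> real"
    using that unfolding c(6)[symmetric] by (simp_all add: integrable_distr_eq integral_distr)
  have int_snd: "integrable \<pi> (\<lambda>\<omega>. f (snd \<omega>)) \<longleftrightarrow> integrable Q f" "(\<integral>\<omega>. f (snd \<omega>) \<partial>\<pi>) = (\<integral>x. f x \<partial>Q)"
    if "f \<in> borel_measurable borel" for f :: "'n path \<Rightarrow> real"
    using that unfolding c(7)[symmetric] by (simp_all add: integrable_distr_eq integral_distr)
  define \<Delta> where "\<Delta> t \<omega> = snd \<omega> $ t - fst \<omega> $ t" for t and \<omega> :: "'n path \<times> 'n path"
  have [measurable]: "\<Delta> t \<in> borel_measurable \<pi>" for t unfolding \<Delta>_def by measurable
  have nth_p: "integrable R (\<lambda>x. \<bar>x $ t\<bar> powr p)" if "R \<in> P_p p" for R and t :: 'n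
  proof (rule integrable_growth[OF that, where C = 1])
    show "\<bar>\<bar>x $ t\<bar> powr p\<bar> \<le> 1 * (1 + norm x) powr p" for x :: "'n path"
      using powr_mono2[of p "\<bar>x $ t\<bar>" "1 + norm x"] p component_le_norm_cart[of x t] by auto
  qed measurable
  have \<Delta>p: "integrable \<pi> (\<lambda>\<omega>. \<bar>\<Delta> t \<omega>\<bar> powr p)" for t
  proof (rule Bochner_Integration.integrable_bound)
    show "integrable \<pi> (\<lambda>\<omega>. 2 powr p * (\<bar>snd \<omega> $ t\<bar> powr p + \<bar>fst \<omega> $ t\<bar> powr p))"
      using int_fst(1)[of "\<lambda>x. \<bar>x $ t\<bar> powr p"] int_snd(1)[of "\<lambda>x. \<bar>x $ t\<bar> powr p"] nth_p[OF P, of t] nth_p[OF Q, of t]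
      by simp
    show "AE \<omega> in \<pi>. norm (\<bar>\<Delta> t \<omega>\<bar> powr p) \<le> norm (2 powr p * (\<bar>snd \<omega> $ t\<bar> powr p + \<bar>fst \<omega> $ t\<bar> powr p))"
    proof (rule AE_I2)
      fix \<omega>
      have "\<bar>\<Delta> t \<omega>\<bar> powr p \<le> (\<bar>snd \<omega> $ t\<bar> + \<bar>fst \<omega> $ t\<bar>) powr p"
        using p by (intro powr_mono2) (auto simp: \<Delta>_def)
      also have "\<dots> \<le> 2 powr p * (\<bar>snd \<omega> $ t\<bar> powr p + \<bar>fst \<omega> $ t\<bar> powr p)"
        using p by (intro powr_add_le) auto
      finally show "norm (\<bar>\<Delta> t \<omega>\<bar> powr p) \<le> norm (2 powr p * (\<bar>snd \<omega> $ t\<bar> powr p + \<bar>fst \<omega> $ t\<bar> powr p))" by simp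
    qed
  qed measurable
  define A where "A = (\<Sum>t\<in>UNIV. \<integral>\<omega>. \<bar>\<Delta> t \<omega>\<bar> powr p \<partial>\<pi>)"
  have A0: "A \<ge> 0" unfolding A_def by (intro sum_nonneg Bochner_Integration.integral_nonneg) simp
  have A: "A powr (1 / p) \<le> \<rho>"
    using \<rho> by (simp add: A_def \<Delta>_def abs_minus_commute)
  have \<rho>0: "\<rho> \<ge> 0" using A powr_ge_zero order_trans by blast
  have A': "A \<le> \<rho> powr p"
  proof -
    have "A = (A powr (1 / p)) powr p" using p A0 by (simp add: powr_powr)
    also have "\<dots> \<le> \<rho> powr p" using p A by (intro powr_mono2) auto
    finally show ?thesis .
  qed
  \<comment> \<open>The factors \<open>s\<close> change at most signs; they allow for both \<open>\<Delta>\<close> and its absolute value.\<close>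
  have holder: "(\<Sum>t\<in>UNIV. \<integral>\<omega>. s t \<omega> * \<Delta> t \<omega> * f t (fst \<omega>) \<partial>\<pi>)
      \<le> \<rho> * (\<Sum>t\<in>UNIV. \<integral>x. \<bar>f t x\<bar> powr q \<partial>P) powr (1 / q)"
    if f [measurable]: "\<And>t. f t \<in> borel_measurable borel" and fq: "\<And>t. integrable P (\<lambda>x. \<bar>f t x\<bar> powr q)"
      and s [measurable]: "\<And>t. s t \<in> borel_measurable \<pi>" and s1: "\<And>t \<omega>. \<bar>s t \<omega> * \<Delta> t \<omega>\<bar> = \<bar>\<Delta> t \<omega>\<bar>" for f s
  proof -
    have "(\<Sum>t\<in>UNIV. \<integral>\<omega>. (s t \<omega> * \<Delta> t \<omega>) * f t (fst \<omega>) \<partial>\<pi>)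
      \<le> (\<Sum>t\<in>UNIV. \<integral>\<omega>. \<bar>s t \<omega> * \<Delta> t \<omega>\<bar> powr p \<partial>\<pi>) powr (1 / p) * (\<Sum>t\<in>UNIV. \<integral>\<omega>. \<bar>f t (fst \<omega>)\<bar> powr q \<partial>\<pi>) powr (1 / q)"
      by (rule Holder_sum[OF p q]) (use \<Delta>p fq in \<open>simp_all add: s1 int_fst(1)[of "\<lambda>x. \<bar>f _ x\<bar> powr q"]\<close>)
    also have "\<dots> = A powr (1 / p) * (\<Sum>t\<in>UNIV. \<integral>x. \<bar>f t x\<bar> powr q \<partial>P) powr (1 / q)"
      by (simp add: s1 A_def int_fst(2)[of "\<lambda>x. \<bar>f _ x\<bar> powr q"])
    also have "\<dots> \<le> \<rho> * (\<Sum>t\<in>UNIV. \<integral>x. \<bar>f t x\<bar> powr q \<partial>P) powr (1 / q)"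
      by (rule mult_right_mono[OF A]) simp
    finally show ?thesis .
  qed
  have \<Delta>_int: "integrable \<pi> (\<lambda>\<omega>. \<Delta> t \<omega> * f (fst \<omega>))"
    if "f \<in> borel_measurable borel" "integrable P (\<lambda>x. \<bar>f x\<bar> powr q)" for f t
    using that \<Delta>p int_fst(1)[of "\<lambda>x. \<bar>f x\<bar> powr q"]
    by (intro integrable_mult_conjugate[OF p q]) auto
  have proj: "(\<integral>\<omega>. \<Delta> t \<omega> * grad a t (fst \<omega>) \<partial>\<pi>) = (\<integral>\<omega>. \<Delta> t \<omega> * proj_grad a t (fst \<omega>) \<partial>\<pi>)" for t
  proof -
    have i: "integrable \<pi> (\<lambda>\<omega>. fst \<omega> $ t * f (fst \<omega>))" "integrable \<pi> (\<lambda>\<omega>. snd \<omega> $ t * f (fst \<omega>))"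
      if "f \<in> borel_measurable borel" "integrable P (\<lambda>x. \<bar>f x\<bar> powr q)" for f
      using that int_fst(1)[of "\<lambda>x. \<bar>f x\<bar> powr q"] int_fst(1)[of "\<lambda>x. \<bar>x $ t\<bar> powr p"] int_snd(1)[of "\<lambda>x. \<bar>x $ t\<bar> powr p"]
        nth_p[OF P, of t] nth_p[OF Q, of t]
      by (auto intro!: integrable_mult_conjugate[OF p q])
    note ig = i[OF grad_borel grad_integrable(2)] and ip = i[OF proj_grad_borel proj_grad_integrable(2)]
    have "(\<integral>\<omega>. snd \<omega> $ t * grad a t (fst \<omega>) \<partial>\<pi>) = (\<integral>\<omega>. snd \<omega> $ t * proj_grad a t (fst \<omega>) \<partial>\<pi>)"
      using causal_integral_cond_exp[OF c(1,3,4,5) causal(1) c(6) grad_integrable(1), of "\<lambda>\<omega>. snd \<omega> $ t" t t]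
        ig(2) ip(2) coord_sigma_nth[of t "{..t}" snd]
      by (simp add: proj_grad_def natural_filtration_def)
    moreover have "(\<integral>\<omega>. fst \<omega> $ t * grad a t (fst \<omega>) \<partial>\<pi>) = (\<integral>\<omega>. fst \<omega> $ t * proj_grad a t (fst \<omega>) \<partial>\<pi>)"
      using proj_grad_test[of "\<lambda>x. x $ t" t] ig(1) int_fst[of "\<lambda>x. x $ t * grad a t x"] int_fst[of "\<lambda>x. x $ t * proj_grad a t x"]
      by (simp add: depends_on_nth)
    ultimately show ?thesis
      using ig ip by (simp add: \<Delta>_def left_diff_distrib)
  qed
  define F where "F \<omega> = loss (gain (ctrl_vec a (fst \<omega>), snd \<omega>))" for \<omega>
  have [measurable]: "gain \<in> borel_measurable borel"
    by (rule borel_measurable_continuous_onI[OF gain_cont])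
  have [measurable]: "(\<lambda>\<omega>. (ctrl_vec a (fst \<omega>), snd \<omega>)) \<in> borel_measurable \<pi>"
    unfolding borel_prod[symmetric] by measurable
  have F_borel [measurable]: "F \<in> borel_measurable \<pi>" unfolding F_def by measurable
  have iF: "integrable \<pi> F"
  proof -
    obtain C where C: "\<And>\<alpha> x. \<alpha> \<in> cube \<Longrightarrow> \<bar>loss (gain (\<alpha>, x))\<bar> \<le> C * (1 + norm x) powr p"
      using growth_bounds by metis
    have "integrable Q (\<lambda>x. C * (1 + norm x) powr p)"
      by (rule integrable_growth[OF Q, of _ "\<bar>C\<bar>"]) (auto simp: abs_mult)
    hence "integrable \<pi> (\<lambda>\<omega>. C * (1 + norm (snd \<omega>)) powr p)"
      using int_snd(1)[of "\<lambda>x. C * (1 + norm x) powr p"] by simp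
    thus ?thesis
      by (rule Bochner_Integration.integrable_bound)
        (auto simp: F_def intro!: order_trans[OF C[OF ctrl_vec_cube[OF a]] abs_ge_self])
  qed
  have hv_F: "hedging_value L X0 loss g Q \<le> (\<integral>\<omega>. F \<omega> \<partial>\<pi>)"
  proof -
    obtain b where b: "b \<in> controls L"
      and proj_b: "\<And>t k. integrable Q k \<Longrightarrow>
        (\<integral>\<omega>. a t (fst \<omega>) * k (snd \<omega>) \<partial>\<pi>) = (\<integral>\<omega>. b t (snd \<omega>) * k (snd \<omega>) \<partial>\<pi>)"
      by (rule causal_predictable_projection[OF \<pi>c causal(2) a]) blast
    note [measurable] = controlsD(1)[OF b]
    define k where "k t y = deriv loss (payoff X0 g b y) * (y $ t - prev_val X0 y t)" for t y
    have k [measurable]: "k t \<in> borel_measurable borel" for t unfolding k_def using b by measurable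
    have ik: "integrable Q (k t)" for t
      unfolding k_def
    proof (rule integrable_loss'_mult[OF Q b, where B = "\<bar>X0\<bar> + 2"])
      fix x :: "'n path"
      show "\<bar>x $ t - prev_val X0 x t\<bar> \<le> (\<bar>X0\<bar> + 2) * (1 + norm x)" by (rule abs_increment_le)
    qed measurable
    have bk: "integrable \<pi> (\<lambda>\<omega>. h \<omega> * k t (snd \<omega>))"
      if "h \<in> borel_measurable \<pi>" "\<And>\<omega>. \<bar>h \<omega>\<bar> \<le> L" for h t
    proof (rule Bochner_Integration.integrable_bound)
      show "integrable \<pi> (\<lambda>\<omega>. L * k t (snd \<omega>))" using ik int_snd(1)[OF k] by simp
      show "AE \<omega> in \<pi>. norm (h \<omega> * k t (snd \<omega>)) \<le> norm (L * k t (snd \<omega>))"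
        using that(2) L by (auto simp: abs_mult intro!: mult_right_mono)
    qed (use that in measurable)
    have ia: "integrable \<pi> (\<lambda>\<omega>. a t (fst \<omega>) * k t (snd \<omega>))" for t
      by (rule bk) (simp_all add: controlsD[OF a])
    have ib: "integrable \<pi> (\<lambda>\<omega>. b t (snd \<omega>) * k t (snd \<omega>))" for t
      by (rule bk) (simp_all add: controlsD[OF b])
    have iL: "integrable \<pi> (\<lambda>\<omega>. loss (payoff X0 g b (snd \<omega>)))"
      using integrable_loss[OF Q b] int_snd(1)[of "\<lambda>x. loss (payoff X0 g b x)"] b by simp
    have pt: "loss (payoff X0 g b (snd \<omega>)) + (\<Sum>t\<in>UNIV. a t (fst \<omega>) * k t (snd \<omega>) - b t (snd \<omega>) * k t (snd \<omega>)) \<le> F \<omega>" for \<omega>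
    proof -
      have "gain (ctrl_vec a (fst \<omega>), snd \<omega>) - payoff X0 g b (snd \<omega>)
          = (\<Sum>t\<in>UNIV. (a t (fst \<omega>) - b t (snd \<omega>)) * (snd \<omega> $ t - prev_val X0 (snd \<omega>) t))"
        by (simp add: gain_def ctrl_vec_def payoff_def left_diff_distrib sum_subtractf)
      hence "(\<Sum>t\<in>UNIV. a t (fst \<omega>) * k t (snd \<omega>) - b t (snd \<omega>) * k t (snd \<omega>))
          = deriv loss (payoff X0 g b (snd \<omega>)) * (gain (ctrl_vec a (fst \<omega>), snd \<omega>) - payoff X0 g b (snd \<omega>))"
        by (simp add: k_def sum_distrib_left algebra_simps)
      thus ?thesis unfolding F_def using loss_ge_tangent by simp
    qed
    have "hedging_value L X0 loss g Q \<le> expected_loss Q b" by (rule hedging_value_le[OF Q b])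
    also have "\<dots> = (\<integral>\<omega>. loss (payoff X0 g b (snd \<omega>)) \<partial>\<pi>)"
      unfolding expected_loss_def using b by (subst int_snd(2)[symmetric]) simp_all
    also have "\<dots> = (\<integral>\<omega>. loss (payoff X0 g b (snd \<omega>))
        + (\<Sum>t\<in>UNIV. a t (fst \<omega>) * k t (snd \<omega>) - b t (snd \<omega>) * k t (snd \<omega>)) \<partial>\<pi>)"
      using iL ia ib proj_b[OF ik] by simp
    also have "\<dots> \<le> (\<integral>\<omega>. F \<omega> \<partial>\<pi>)"
      using iL ia ib iF by (intro integral_mono pt) auto
    finally show ?thesis .
  qed
  have norm_le: "norm (snd \<omega> - fst \<omega>) \<le> (\<Sum>t\<in>UNIV. \<bar>\<Delta> t \<omega>\<bar>)" for \<omega>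
    using norm_le_l1_cart[of "snd \<omega> - fst \<omega>"] by (simp add: \<Delta>_def)
  have F_le: "F \<omega> \<le> loss (payoff X0 g a (fst \<omega>)) + (\<Sum>t\<in>UNIV. \<Delta> t \<omega> * grad a t (fst \<omega>))
      + (\<Sum>t\<in>UNIV. \<bar>\<Delta> t \<omega>\<bar> * w (fst \<omega>)) + D * (real CARD('n) powr p * (\<Sum>t\<in>UNIV. \<bar>\<Delta> t \<omega>\<bar> powr p))" for \<omega>
  proof -
    have "F \<omega> \<le> loss (payoff X0 g a (fst \<omega>)) + blinfun_apply (cost' (ctrl_vec a (fst \<omega>), fst \<omega>)) (snd \<omega> - fst \<omega>)
        + (norm (snd \<omega> - fst \<omega>) * w (fst \<omega>) + D * norm (snd \<omega> - fst \<omega>) powr p)"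
      using taylor[OF ctrl_vec_cube[OF a], of "fst \<omega>" "fst \<omega>" "snd \<omega> - fst \<omega>"]
      by (simp add: F_def payoff_eq_gain abs_le_iff)
    moreover have "norm (snd \<omega> - fst \<omega>) * w (fst \<omega>) \<le> (\<Sum>t\<in>UNIV. \<bar>\<Delta> t \<omega>\<bar> * w (fst \<omega>))"
      using mult_right_mono[OF norm_le w0] by (simp add: sum_distrib_right)
    moreover have "D * norm (snd \<omega> - fst \<omega>) powr p \<le> D * (real CARD('n) powr p * (\<Sum>t\<in>UNIV. \<bar>\<Delta> t \<omega>\<bar> powr p))"
      using norm_powr_le_sum[of p "snd \<omega> - fst \<omega>"] p D by (intro mult_left_mono) (auto simp: \<Delta>_def)
    ultimately show ?thesis by (simp add: cost'_eq_grad \<Delta>_def)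
  qed
  have i1: "integrable \<pi> (\<lambda>\<omega>. loss (payoff X0 g a (fst \<omega>)))"
    using integrable_loss[OF P a] int_fst(1)[of "\<lambda>x. loss (payoff X0 g a x)"] a by simp
  have i2: "integrable \<pi> (\<lambda>\<omega>. \<Delta> t \<omega> * grad a t (fst \<omega>))" for t
    by (rule \<Delta>_int[OF grad_borel grad_integrable(2)])
  have i3: "integrable \<pi> (\<lambda>\<omega>. \<bar>\<Delta> t \<omega>\<bar> * w (fst \<omega>))" for t
    using integrable_abs[OF \<Delta>_int[OF w wq, of t]] w0 by (simp add: abs_mult)
  have "(\<integral>\<omega>. F \<omega> \<partial>\<pi>) \<le> (\<integral>\<omega>. loss (payoff X0 g a (fst \<omega>)) + (\<Sum>t\<in>UNIV. \<Delta> t \<omega> * grad a t (fst \<omega>))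
      + (\<Sum>t\<in>UNIV. \<bar>\<Delta> t \<omega>\<bar> * w (fst \<omega>)) + D * (real CARD('n) powr p * (\<Sum>t\<in>UNIV. \<bar>\<Delta> t \<omega>\<bar> powr p)) \<partial>\<pi>)"
    using i1 i2 i3 \<Delta>p iF by (intro integral_mono F_le) auto
  also have "\<dots> = expected_loss P a + (\<Sum>t\<in>UNIV. \<integral>\<omega>. \<Delta> t \<omega> * grad a t (fst \<omega>) \<partial>\<pi>)
      + (\<Sum>t\<in>UNIV. \<integral>\<omega>. \<bar>\<Delta> t \<omega>\<bar> * w (fst \<omega>) \<partial>\<pi>) + D * (real CARD('n) powr p * A)"
    using i1 i2 i3 \<Delta>p int_fst(2)[of "\<lambda>x. loss (payoff X0 g a x)"] a by (simp add: A_def expected_loss_def)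
  also have "(\<Sum>t\<in>UNIV. \<integral>\<omega>. \<Delta> t \<omega> * grad a t (fst \<omega>) \<partial>\<pi>) = (\<Sum>t\<in>UNIV. \<integral>\<omega>. 1 * \<Delta> t \<omega> * proj_grad a t (fst \<omega>) \<partial>\<pi>)"
    by (simp add: proj)
  also have "\<dots> \<le> \<rho> * (\<Sum>t\<in>UNIV. \<integral>x. \<bar>proj_grad a t x\<bar> powr q \<partial>P) powr (1 / q)"
    by (rule holder) (simp_all add: proj_grad_integrable)
  also have "(\<Sum>t\<in>UNIV. \<integral>\<omega>. \<bar>\<Delta> t \<omega>\<bar> * w (fst \<omega>) \<partial>\<pi>) = (\<Sum>t\<in>UNIV. \<integral>\<omega>. sgn (\<Delta> t \<omega>) * \<Delta> t \<omega> * w (fst \<omega>) \<partial>\<pi>)"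
    by (simp add: abs_sgn mult.commute)
  also have "\<dots> \<le> \<rho> * (\<Sum>t\<in>(UNIV :: 'n set). \<integral>x. \<bar>w x\<bar> powr q \<partial>P) powr (1 / q)"
    by (rule holder) (simp_all add: wq abs_mult abs_sgn_eq)
  also have "D * (real CARD('n) powr p * A) \<le> D * (real CARD('n) powr p * \<rho> powr p)"
    using A' D by (intro mult_left_mono) auto
  finally show ?thesis using hv_F by simp
qed

end

text \<open>The conjugate norm of the remainder weight in \<open>cost_taylor\<close> becomes small by dominated
convergence, since \<open>(p - 1) q = p\<close>.\<close>

lemma remainder_small:
  assumes C: "C > 0" and e: "e > 0"
  obtains \<eta> K where "\<eta> > 0" "K \<ge> 0"
    "integrable P (\<lambda>x. \<bar>\<eta> + C * ((1 + norm x) powr (p - 1) * indicator {x. norm x > K} x)\<bar> powr q)"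
    "(\<Sum>t\<in>(UNIV :: 'n set). \<integral>x. \<bar>\<eta> + C * ((1 + norm x) powr (p - 1) * indicator {x. norm x > K} x)\<bar> powr q \<partial>P) powr (1 / q) < e"
proof -
  note q = conj_exponents
  define f where "f n x = \<bar>1 / (real n + 1) + C * ((1 + norm x) powr (p - 1) * indicator {x. norm x > real n} x)\<bar> powr q"
    for n and x :: "'n path"
  have [measurable]: "f n \<in> borel_measurable borel" for n unfolding f_def by measurable
  have bd: "\<bar>f n x\<bar> \<le> (1 + C) powr q * (1 + norm x) powr p" for n x
  proof -
    have "1 / (real n + 1) \<le> 1 * 1" by simp
    also have "\<dots> \<le> 1 * (1 + norm x) powr (p - 1)"
      using p by (intro mult_left_mono ge_one_powr_ge_zero) auto
    finally have "1 / (real n + 1) \<le> (1 + norm x) powr (p - 1)" by simp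
    moreover have "C * ((1 + norm x) powr (p - 1) * indicator {x. norm x > real n} x) \<le> C * (1 + norm x) powr (p - 1)"
      using C by (intro mult_left_mono) (auto simp: indicator_def)
    moreover have "0 \<le> C * ((1 + norm x) powr (p - 1) * indicator {x. norm x > real n} x)"
      using C by simp
    ultimately have "\<bar>1 / (real n + 1) + C * ((1 + norm x) powr (p - 1) * indicator {x. norm x > real n} x)\<bar>
        \<le> (1 + C) * (1 + norm x) powr (p - 1)" by (simp add: algebra_simps)
    hence "f n x \<le> ((1 + C) * (1 + norm x) powr (p - 1)) powr q"
      unfolding f_def using q by (intro powr_mono2) auto
    also have "\<dots> = (1 + C) powr q * (1 + norm x) powr p"
      using q C by (simp add: powr_mult powr_powr)
    finally show ?thesis by (simp add: f_def)
  qed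
  have fi: "integrable P (f n)" for n by (rule integrable_growth[OF P _ bd]) simp
  have "(\<lambda>n. \<integral>x. f n x \<partial>P) \<longlonglongrightarrow> (\<integral>x. 0 \<partial>P)"
  proof (rule integral_dominated_convergence)
    show "integrable P (\<lambda>x. (1 + C) powr q * (1 + norm x) powr p)"
      by (rule integrable_growth[OF P, of _ "(1 + C) powr q"]) auto
    show "AE x in P. norm (f n x) \<le> (1 + C) powr q * (1 + norm x) powr p" for n
      using bd by simp
    show "AE x in P. (\<lambda>n. f n x) \<longlonglongrightarrow> 0"
    proof (rule AE_I2)
      fix x :: "'n path"
      have "(\<lambda>n. (1 / (real n + 1)) powr q) \<longlonglongrightarrow> 0"
        by (rule tendsto_zero_powrI[OF _ tendsto_const]) (use q in \<open>auto intro!: always_eventually\<close>, real_asymp)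
      moreover obtain m :: nat where "norm x < real m" using reals_Archimedean2 by blast
      hence "\<forall>\<^sub>F n in sequentially. (1 / (real n + 1)) powr q = f n x"
        unfolding eventually_sequentially f_def by (intro exI[of _ m]) auto
      ultimately show "(\<lambda>n. f n x) \<longlonglongrightarrow> 0" by (rule Lim_transform_eventually)
    qed
  qed simp_all
  hence "(\<lambda>n. \<Sum>t\<in>(UNIV :: 'n set). \<integral>x. f n x \<partial>P) \<longlonglongrightarrow> (\<Sum>t\<in>(UNIV :: 'n set). 0)"
    by (intro tendsto_sum) simp
  hence "(\<lambda>n. (\<Sum>t\<in>(UNIV :: 'n set). \<integral>x. f n x \<partial>P) powr (1 / q)) \<longlonglongrightarrow> 0"
    using q by (intro tendsto_zero_powrI[OF _ tendsto_const])
      (auto intro!: always_eventually sum_nonneg mult_nonneg_nonneg simp: f_def)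
  hence "\<forall>\<^sub>F n in sequentially. (\<Sum>t\<in>(UNIV :: 'n set). \<integral>x. f n x \<partial>P) powr (1 / q) < e"
    using e by (rule order_tendstoD(2))
  then obtain n where n: "(\<Sum>t\<in>(UNIV :: 'n set). \<integral>x. f n x \<partial>P) powr (1 / q) < e"
    by (auto simp: eventually_sequentially)
  show thesis
    by (rule that[of "1 / (real n + 1)" "real n"]) (use fi[of n] n in \<open>simp_all add: f_def[abs_def]\<close>)
qed

lemma upper_bound:
  assumes opt: "optimal a" and e: "e > 0"
  shows "\<exists>R>0. \<forall>r. 0 < r \<and> r < R \<longrightarrow> (\<forall>Q\<in>AW_ball p P r.
    hedging_value L X0 loss g Q \<le> hedging_value L X0 loss g P + r * sensitivity q X0 loss g P a + e * r)"
proof -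
  note a = optimalD(1)[OF opt]
  obtain C where C: "C > 0"
    "\<And>e K. e > 0 \<Longrightarrow> K \<ge> 0 \<Longrightarrow> \<exists>D\<ge>0. \<forall>\<alpha>\<in>cube. \<forall>x d.
      \<bar>loss (gain (\<alpha>, x + d)) - loss (gain (\<alpha>, x)) - blinfun_apply (cost' (\<alpha>, x)) d\<bar>
        \<le> norm d * (e + C * ((1 + norm x) powr (p - 1) * indicator {x. norm x > K} x)) + D * norm d powr p"
    using cost_taylor by metis
  define e1 where "e1 = e / 4"
  have e1: "e1 > 0" using e by (simp add: e1_def)
  obtain \<eta> K where \<eta>: "\<eta> > 0" "K \<ge> 0"
    "integrable P (\<lambda>x. \<bar>\<eta> + C * ((1 + norm x) powr (p - 1) * indicator {x. norm x > K} x)\<bar> powr q)"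
    "(\<Sum>t\<in>(UNIV :: 'n set). \<integral>x. \<bar>\<eta> + C * ((1 + norm x) powr (p - 1) * indicator {x. norm x > K} x)\<bar> powr q \<partial>P) powr (1 / q) < e1"
    by (rule remainder_small[OF C(1) e1])
  define w where "w x = \<eta> + C * ((1 + norm x) powr (p - 1) * indicator {x. norm x > K} x)" for x :: "'n path"
  obtain D where D: "D \<ge> 0" "\<And>\<alpha> x d. \<alpha> \<in> cube \<Longrightarrow>
      \<bar>loss (gain (\<alpha>, x + d)) - loss (gain (\<alpha>, x)) - blinfun_apply (cost' (\<alpha>, x)) d\<bar> \<le> norm d * w x + D * norm d powr p"
    using C(2)[OF \<eta>(1,2)] unfolding w_def by blast
  have w [measurable]: "w \<in> borel_measurable borel" unfolding w_def by measurable
  have w0: "w x \<ge> 0" for x using C(1) \<eta>(1) by (simp add: w_def)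
  define V where "V = sensitivity q X0 loss g P a"
  define N where "N = D * real CARD('n) powr p"
  have N: "N \<ge> 0" using D(1) by (simp add: N_def)
  \<comment> \<open>The infimum over couplings need not be attained; a coupling of cost below \<open>r + r\<^sup>2\<close> suffices.\<close>
  define \<rho> where "\<rho> r = r + r * r" for r :: real
  have small: "((\<lambda>r. r * V + (1 + r) * e1 + N * ((1 + r) powr p * r powr (p - 1))) \<longlongrightarrow> 0 * V + (1 + 0) * e1 + N * ((1 + 0) powr p * 0)) (at_right 0)"
  proof (intro tendsto_intros)
    show "((\<lambda>r. r powr (p - 1)) \<longlongrightarrow> 0) (at_right 0)"
      using p by (intro tendsto_zero_powrI[OF _ tendsto_const])
        (auto simp: eventually_at_right_field intro!: exI[of _ 1])
  qed auto
  have "\<forall>\<^sub>F r in at_right 0. r * V + (1 + r) * e1 + N * ((1 + r) powr p * r powr (p - 1)) < e"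
    by (rule order_tendstoD(2)[OF small]) (use e in \<open>simp add: e1_def\<close>)
  then obtain R where R: "R > 0" "\<And>r. 0 < r \<Longrightarrow> r < R \<Longrightarrow> r * V + (1 + r) * e1 + N * ((1 + r) powr p * r powr (p - 1)) < e"
    by (auto simp: eventually_at_right_field)
  show ?thesis
  proof (intro exI[of _ R] conjI R(1) allI impI ballI)
    fix r Q assume r: "0 < r \<and> r < R" and "Q \<in> AW_ball p P r"
    hence Q: "Q \<in> P_p p" "AW p P Q \<le> r" by (auto simp: AW_ball_def)
    have "AW p P Q < \<rho> r" using Q(2) r by (simp add: \<rho>_def add_pos_pos order_le_less_trans)
    then obtain \<pi> where \<pi>: "\<pi> \<in> bicausal_couplings P Q"
      "(\<Sum>t\<in>UNIV. \<integral>\<omega>. \<bar>fst \<omega> $ t - snd \<omega> $ t\<bar> powr p \<partial>\<pi>) powr (1 / p) < \<rho> r"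
      by (rule AW_less_imp_coupling[OF Q(1) P])
    have \<rho>0: "\<rho> r \<ge> 0" using r by (simp add: \<rho>_def)
    have "hedging_value L X0 loss g Q \<le> expected_loss P a
      + \<rho> r * (\<Sum>t\<in>UNIV. \<integral>x. \<bar>proj_grad a t x\<bar> powr q \<partial>P) powr (1 / q)
      + \<rho> r * (\<Sum>t\<in>(UNIV :: 'n set). \<integral>x. \<bar>w x\<bar> powr q \<partial>P) powr (1 / q)
      + D * (real CARD('n) powr p * \<rho> r powr p)"
      using \<eta>(3) by (intro coupling_estimate[OF a \<pi>(1) Q(1) less_imp_le[OF \<pi>(2)] w w0 _ D]) (simp_all add: w_def[abs_def])
    also have "\<dots> \<le> hedging_value L X0 loss g P + \<rho> r * V + \<rho> r * e1 + N * \<rho> r powr p"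
      using \<eta>(4) \<rho>0 unfolding V_def sensitivity_eq[OF a] optimalD(2)[OF opt] N_def w_def
      by (intro add_mono mult_left_mono) auto
    also have "\<dots> = hedging_value L X0 loss g P + r * V + r * (r * V + (1 + r) * e1 + N * ((1 + r) powr p * r powr (p - 1)))"
    proof -
      have "\<rho> r = (1 + r) * r" by (simp add: \<rho>_def algebra_simps)
      hence "\<rho> r powr p = (1 + r) powr p * (r * r powr (p - 1))"
        using r powr_mult_base[of r "p - 1"] by (simp add: powr_mult)
      thus ?thesis by (simp add: \<rho>_def algebra_simps)
    qed
    also have "\<dots> \<le> hedging_value L X0 loss g P + r * V + r * e"
      using R(2)[of r] r by (intro add_left_mono mult_left_mono) auto
    finally show "hedging_value L X0 loss g Q \<le> hedging_value L X0 loss g P + r * sensitivity q X0 loss g P a + e * r"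
      by (simp add: V_def mult.commute)
  qed
qed

end

section \<open>Adapted Lipschitz perturbations\<close>

text \<open>Lipschitz functions are dense in \<open>L\<^sup>1\<close> of a finite Borel measure: a Borel set is approximated by a compact subset,
whose indicator is the limit of decreasing functions of the distance to it.\<close>

lemma lipschitz_dense_L1:
  fixes M :: "'a::euclidean_space measure" and f :: "'a \<Rightarrow> real"
  assumes "finite_measure M" and M [measurable_cong]: "sets M = sets borel" and f: "integrable M f"
  shows "\<forall>e>0. \<exists>\<phi> C. C-lipschitz_on UNIV \<phi> \<and> integrable M \<phi> \<and> (\<integral>x. \<bar>f x - \<phi> x\<bar> \<partial>M) < e"
  using f
proof (induction rule: integrable_induct)
  interpret finite_measure M by fact
  have spM: "space M = UNIV" using sets_eq_imp_space_eq[OF M] by simp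
  case (base A c)
  show ?case
  proof (intro allI impI)
    fix e :: real assume e: "e > 0"
    define e' where "e' = e / (2 * (\<bar>c\<bar> + 1))"
    have e': "e' > 0" using e by (simp add: e'_def add_nonneg_pos)
    have "emeasure M A = (SUP K \<in> {K. K \<subseteq> A \<and> compact K}. emeasure M K)"
      using base(1) M by (intro inner_regular) auto
    moreover have "emeasure M A < emeasure M A + ennreal e'" using e' base(2)
      by (metis ennreal_add_left_cancel_less ennreal_less_zero_iff add.right_neutral less_irrefl infinity_ennreal_def)
    ultimately have *: "ennreal (measure M A) \<le> (SUP K \<in> {K. K \<subseteq> A \<and> compact K}. ennreal (measure M K))"
      by (simp add: emeasure_eq_measure)
    have "\<exists>K. K \<subseteq> A \<and> compact K \<and> measure M A < measure M K + e'"
    proof (rule ccontr)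
      assume contr: "\<not> ?thesis"
      hence "ennreal (measure M K) \<le> ennreal (max 0 (measure M A - e'))" if "K \<subseteq> A" "compact K" for K
        using that by (intro ennreal_leI) (auto simp: not_less le_max_iff_disj)
      hence "(SUP K \<in> {K. K \<subseteq> A \<and> compact K}. ennreal (measure M K)) \<le> ennreal (max 0 (measure M A - e'))"
        by (intro SUP_least) auto
      hence "ennreal (measure M A) \<le> ennreal (max 0 (measure M A - e'))" using * by (rule order_trans[rotated])
      hence "measure M A \<le> max 0 (measure M A - e')" by (subst (asm) ennreal_le_iff) auto
      hence "measure M A = 0" using e' measure_nonneg[of M A] by (intro antisym) (auto simp: max_def split: if_splits)
      moreover have "\<not> ({} \<subseteq> A \<and> compact ({} :: 'a set) \<and> measure M A < measure M {} + e')"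
        using contr by (rule contrapos_nn) (rule exI)
      ultimately show False using e' by simp
    qed
    then obtain K where K: "K \<subseteq> A" "compact K" "measure M A < measure M K + e'" by blast
    have Km [measurable]: "K \<in> sets M" using K(2) M by (auto intro: borel_compact)
    have Am [measurable]: "A \<in> sets M" by fact
    define \<phi> where "\<phi> n x = (if K = {} then 0 else max 0 (1 - real n * infdist x K))" for n x
    have lip: "(real n)-lipschitz_on UNIV (\<phi> n)" for n
    proof (rule lipschitz_onI)
      fix x y :: 'a
      have "\<bar>real n * infdist x K - real n * infdist y K\<bar> \<le> real n * dist x y"
        using mult_left_mono[OF infdist_triangle_abs[of x K y], of "real n"]
        by (simp add: right_diff_distrib[symmetric] abs_mult)
      thus "dist (\<phi> n x) (\<phi> n y) \<le> real n * dist x y"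
        unfolding dist_real_def \<phi>_def by (auto simp: max_def abs_if split: if_splits)
    qed simp
    have [measurable]: "\<phi> n \<in> borel_measurable M" for n
      using borel_measurable_continuous_onI[OF lipschitz_on_continuous_on[OF lip]] M
      by (simp add: measurable_cong_sets[OF M refl])
    have bd: "\<bar>\<phi> n x\<bar> \<le> 1" for n x by (auto simp: \<phi>_def infdist_nonneg)
    have int\<phi>: "integrable M (\<phi> n)" for n by (rule integrable_const_bound[of _ 1]) (auto simp: bd)
    have "(\<lambda>n. \<integral>x. \<bar>indicator K x - \<phi> n x\<bar> \<partial>M) \<longlonglongrightarrow> (\<integral>x. 0 \<partial>M)"
    proof (rule integral_dominated_convergence[where w = "\<lambda>_. 2"])
      show "AE x in M. norm \<bar>indicator K x - \<phi> n x\<bar> \<le> 2" for n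
        using bd[of n] by (auto simp: indicator_def intro!: AE_I2) (smt (verit))+
      show "AE x in M. (\<lambda>n. \<bar>indicator K x - \<phi> n x\<bar>) \<longlonglongrightarrow> 0"
      proof (rule AE_I2)
        fix x
        show "(\<lambda>n. \<bar>indicator K x - \<phi> n x\<bar>) \<longlonglongrightarrow> 0"
        proof (cases "x \<in> K")
          case True
          hence "\<phi> n x = 1" for n by (auto simp: \<phi>_def)
          thus ?thesis using True by simp
        next
          case False
          show ?thesis
          proof (cases "K = {}")
            case True
            thus ?thesis by (simp add: \<phi>_def)
          next
            case ne: False
            have "infdist x K \<noteq> 0"
              using in_closed_iff_infdist_zero[OF compact_imp_closed[OF K(2)] ne, of x] False by simp
            hence d: "infdist x K > 0" using infdist_nonneg[of x K] by simp
            obtain m :: nat where m: "1 / infdist x K < real m" using reals_Archimedean2 by blast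
            have "\<phi> n x = 0" if "n \<ge> m" for n
            proof -
              have "1 / infdist x K < real n" using m that by linarith
              thus ?thesis using d ne by (simp add: \<phi>_def field_simps)
            qed
            hence "\<forall>\<^sub>F n in sequentially. 0 = \<bar>indicator K x - \<phi> n x\<bar>"
              unfolding eventually_sequentially using False by (intro exI[of _ m]) simp
            thus ?thesis by (rule Lim_transform_eventually[OF tendsto_const])
          qed
        qed
      qed
    qed simp_all
    hence "\<forall>\<^sub>F n in sequentially. (\<integral>x. \<bar>indicator K x - \<phi> n x\<bar> \<partial>M) < e'"
      using e' by (intro order_tendstoD(2)) auto
    then obtain n where n: "(\<integral>x. \<bar>indicator K x - \<phi> n x\<bar> \<partial>M) < e'"
      by (auto simp: eventually_sequentially)
    have iK: "integrable M (\<lambda>x. \<bar>indicator K x - \<phi> n x\<bar>)"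
      using int\<phi> by (intro integrable_abs Bochner_Integration.integrable_diff) (auto simp: less_top[symmetric])
    have iAK: "integrable M (\<lambda>x. indicator A x - indicator K x :: real)"
      by (intro Bochner_Integration.integrable_diff) (auto simp: less_top[symmetric])
    have "(\<integral>x. \<bar>indicator A x *\<^sub>R c - c * \<phi> n x\<bar> \<partial>M)
        \<le> (\<integral>x. \<bar>c\<bar> * ((indicator A x - indicator K x) + \<bar>indicator K x - \<phi> n x\<bar>) \<partial>M)"
    proof (rule integral_mono)
      show "integrable M (\<lambda>x. \<bar>indicator A x *\<^sub>R c - c * \<phi> n x\<bar>)"
        using int\<phi> by (intro integrable_abs Bochner_Integration.integrable_diff) (auto simp: less_top[symmetric])
      show "integrable M (\<lambda>x. \<bar>c\<bar> * ((indicator A x - indicator K x) + \<bar>indicator K x - \<phi> n x\<bar>))"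
        using iK iAK by auto
      fix x
      have "\<bar>indicator A x *\<^sub>R c - c * \<phi> n x\<bar> = \<bar>c\<bar> * \<bar>indicator A x - \<phi> n x\<bar>"
        by (simp add: abs_mult[symmetric] algebra_simps)
      also have "\<bar>indicator A x - \<phi> n x\<bar> \<le> (indicator A x - indicator K x) + \<bar>indicator K x - \<phi> n x\<bar>"
        using K(1) by (auto simp: indicator_def)
      finally show "\<bar>indicator A x *\<^sub>R c - c * \<phi> n x\<bar> \<le> \<bar>c\<bar> * ((indicator A x - indicator K x) + \<bar>indicator K x - \<phi> n x\<bar>)"
        by (simp add: mult_left_mono)
    qed
    also have "\<dots> = \<bar>c\<bar> * ((measure M A - measure M K) + (\<integral>x. \<bar>indicator K x - \<phi> n x\<bar> \<partial>M))"
      using iK iAK by (simp add: spM less_top[symmetric])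
    also have "\<dots> \<le> \<bar>c\<bar> * (e' + e')"
      using K(3) n by (intro mult_left_mono add_mono) auto
    also have "\<dots> < (\<bar>c\<bar> + 1) * (e' + e')" using e' by (intro mult_strict_right_mono) auto
    also have "\<dots> = e"
    proof -
      have "d * (e / (2 * d) + e / (2 * d)) = e" if "d > 0" for d :: real using that by (simp add: field_simps)
      moreover have "\<bar>c\<bar> + 1 > 0" by arith
      ultimately show ?thesis unfolding e'_def by blast
    qed
    finally have "(\<integral>x. \<bar>indicator A x *\<^sub>R c - c * \<phi> n x\<bar> \<partial>M) < e" .
    moreover have "(\<bar>c\<bar> * real n)-lipschitz_on UNIV (\<lambda>x. c * \<phi> n x)"
      by (rule lipschitz_on_cmult_real[OF lip])
    ultimately show "\<exists>\<phi> C. C-lipschitz_on UNIV \<phi> \<and> integrable M \<phi> \<and> (\<integral>x. \<bar>indicator A x *\<^sub>R c - \<phi> x\<bar> \<partial>M) < e"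
      using int\<phi> by (intro exI[of _ "\<lambda>x. c * \<phi> n x"] exI[of _ "\<bar>c\<bar> * real n"]) auto
  qed
next
  case (add f h)
  show ?case
  proof (intro allI impI)
    fix e :: real assume "e > 0"
    hence e2: "e / 2 > 0" by simp
    obtain \<phi> C where 1: "C-lipschitz_on UNIV \<phi>" "integrable M \<phi>" "(\<integral>x. \<bar>f x - \<phi> x\<bar> \<partial>M) < e / 2"
      using add(3) e2 by blast
    obtain \<psi> D where 2: "D-lipschitz_on UNIV \<psi>" "integrable M \<psi>" "(\<integral>x. \<bar>h x - \<psi> x\<bar> \<partial>M) < e / 2"
      using add(4) e2 by blast
    have "(\<integral>x. \<bar>f x + h x - (\<phi> x + \<psi> x)\<bar> \<partial>M) \<le> (\<integral>x. \<bar>f x - \<phi> x\<bar> + \<bar>h x - \<psi> x\<bar> \<partial>M)"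
      using add(1,2) 1 2 by (intro integral_mono) auto
    also have "\<dots> < e" using add(1,2) 1 2 by simp
    finally show "\<exists>\<phi> C. C-lipschitz_on UNIV \<phi> \<and> integrable M \<phi> \<and> (\<integral>x. \<bar>f x + h x - \<phi> x\<bar> \<partial>M) < e"
      using 1 2 lipschitz_on_add[OF 1(1) 2(1)]
      by (intro exI[of _ "\<lambda>x. \<phi> x + \<psi> x"] exI[of _ "C + D"]) auto
  qed
next
  case (lim f s)
  show ?case
  proof (intro allI impI)
    fix e :: real assume "e > 0"
    hence e2: "e / 2 > 0" by simp
    have "(\<lambda>i. \<integral>x. \<bar>f x - s i x\<bar> \<partial>M) \<longlonglongrightarrow> (\<integral>x. 0 \<partial>M)"
    proof (rule integral_dominated_convergence[where w = "\<lambda>x. 3 * \<bar>f x\<bar>"])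
      show "AE x in M. (\<lambda>i. \<bar>f x - s i x\<bar>) \<longlonglongrightarrow> 0"
      proof (rule AE_I2)
        fix x assume "x \<in> space M"
        from tendsto_rabs[OF tendsto_diff[OF tendsto_const[of "f x"] lim(2)[OF this]]]
        show "(\<lambda>i. \<bar>f x - s i x\<bar>) \<longlonglongrightarrow> 0" by simp
      qed
      show "AE x in M. norm \<bar>f x - s i x\<bar> \<le> 3 * \<bar>f x\<bar>" for i
      proof (rule AE_I2)
        fix x assume "x \<in> space M"
        from lim(3)[OF this, of i] show "norm \<bar>f x - s i x\<bar> \<le> 3 * \<bar>f x\<bar>" by simp
      qed
    qed (use lim in auto)
    hence "\<forall>\<^sub>F i in sequentially. (\<integral>x. \<bar>f x - s i x\<bar> \<partial>M) < e / 2"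
      using e2 by (intro order_tendstoD(2)) auto
    then obtain i where i: "(\<integral>x. \<bar>f x - s i x\<bar> \<partial>M) < e / 2"
      by (auto simp: eventually_sequentially)
    obtain \<phi> C where 1: "C-lipschitz_on UNIV \<phi>" "integrable M \<phi>" "(\<integral>x. \<bar>s i x - \<phi> x\<bar> \<partial>M) < e / 2"
      using lim(5) e2 by blast
    have "(\<integral>x. \<bar>f x - \<phi> x\<bar> \<partial>M) \<le> (\<integral>x. \<bar>f x - s i x\<bar> + \<bar>s i x - \<phi> x\<bar> \<partial>M)"
      using lim(1,4) 1 by (intro integral_mono) auto
    also have "\<dots> < e" using lim(1,4) 1 i by simp
    finally show "\<exists>\<phi> C. C-lipschitz_on UNIV \<phi> \<and> integrable M \<phi> \<and> (\<integral>x. \<bar>f x - \<phi> x\<bar> \<partial>M) < e"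
      using 1 by blast
  qed
qed

text \<open>A bounded function of some coordinates is an almost sure limit of equally bounded Lipschitz functions of
the same coordinates.\<close>

lemma lipschitz_approx_depends_on:
  fixes f :: "'n::{finite,linorder} path \<Rightarrow> real"
  assumes "prob_space P" and P [measurable_cong]: "sets P = sets borel"
    and f [measurable]: "f \<in> borel_measurable borel" and dep: "depends_on S f" and bd: "\<And>x. \<bar>f x\<bar> \<le> K"
  shows "\<exists>\<phi>. (\<forall>n. (\<exists>C. C-lipschitz_on UNIV (\<phi> n)) \<and> depends_on S (\<phi> n) \<and> (\<forall>x. \<bar>\<phi> n x\<bar> \<le> K))
    \<and> (AE x in P. (\<lambda>n::nat. \<phi> n x) \<longlonglongrightarrow> f x)"
proof -
  interpret prob_space P by fact
  define \<mu> where "\<mu> = distr P borel (keep S)"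
  have s\<mu> [measurable_cong]: "sets \<mu> = sets borel" by (simp add: \<mu>_def)
  interpret \<mu>: prob_space \<mu> unfolding \<mu>_def by (rule prob_space_distr) simp
  have K: "K \<ge> 0" using bd[of 0] by simp
  have "integrable \<mu> f" by (rule \<mu>.integrable_const_bound[of _ K]) (auto simp: bd)
  hence "\<exists>\<phi>. (\<exists>C. C-lipschitz_on UNIV \<phi>) \<and> integrable \<mu> \<phi> \<and> (\<integral>x. \<bar>f x - \<phi> x\<bar> \<partial>\<mu>) < 1 / (real n + 1)" for n :: nat
    using lipschitz_dense_L1[OF _ s\<mu>, of f] \<mu>.finite_measure_axioms by fastforce
  hence "\<exists>\<phi>. \<forall>n::nat. (\<exists>C. C-lipschitz_on UNIV (\<phi> n)) \<and> integrable \<mu> (\<phi> n)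
      \<and> (\<integral>x. \<bar>f x - \<phi> n x\<bar> \<partial>\<mu>) < 1 / (real n + 1)"
    by (intro choice) blast
  then obtain \<phi> where \<phi>: "\<And>n. \<exists>C. C-lipschitz_on UNIV (\<phi> n)" "\<And>n. integrable \<mu> (\<phi> n)"
    "\<And>n::nat. (\<integral>x. \<bar>f x - \<phi> n x\<bar> \<partial>\<mu>) < 1 / (real n + 1)" by blast
  define \<psi> where "\<psi> n x = max (- K) (min K (\<phi> n (keep S x)))" for n x
  have \<phi>m [measurable]: "\<phi> n \<in> borel_measurable borel" for n
    using \<phi>(1)[of n] by (auto intro: borel_measurable_continuous_onI lipschitz_on_continuous_on)
  have \<psi>m [measurable]: "\<psi> n \<in> borel_measurable borel" for n unfolding \<psi>_def by measurable
  have lip: "C-lipschitz_on UNIV (\<psi> n)" if lip\<phi>: "C-lipschitz_on UNIV (\<phi> n)" for n C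
  proof (rule lipschitz_onI)
    show C: "0 \<le> C" using lip\<phi> by (rule lipschitz_on_nonneg)
    fix x y :: "'n path"
    have "dist (\<psi> n x) (\<psi> n y) \<le> dist (\<phi> n (keep S x)) (\<phi> n (keep S y))"
      unfolding \<psi>_def dist_real_def by (auto simp: max_def min_def abs_if)
    also have "\<dots> \<le> C * dist (keep S x) (keep S y)" by (rule lipschitz_onD[OF lip\<phi>]) auto
    also have "dist (keep S x) (keep S y) \<le> dist x y"
      unfolding dist_norm by (rule norm_le_componentwise_cart) simp
    finally show "dist (\<psi> n x) (\<psi> n y) \<le> C * dist x y" using C by (simp add: mult_left_mono)
  qed
  have dep\<psi>: "depends_on S (\<psi> n)" for n
  proof -
    have "keep S x = keep S y" if "\<forall>s\<in>S. x $ s = y $ s" for x y :: "'n path"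
      using that by (simp add: vec_eq_iff)
    thus ?thesis unfolding depends_on_def \<psi>_def by metis
  qed
  have bd\<psi>: "\<bar>\<psi> n x\<bar> \<le> K" for n x using K by (auto simp: \<psi>_def)
  have int: "integrable P (\<lambda>x. f x - \<psi> n x)" for n
    by (intro Bochner_Integration.integrable_diff; rule integrable_const_bound[of _ K]) (auto simp: bd bd\<psi>)
  have le: "(\<integral>x. norm (f x - \<psi> n x) \<partial>P) \<le> 1 / (real n + 1)" for n
  proof -
    have "(\<integral>x. norm (f x - \<psi> n x) \<partial>P) \<le> (\<integral>x. \<bar>f (keep S x) - \<phi> n (keep S x)\<bar> \<partial>P)"
    proof (rule integral_mono)
      show "integrable P (\<lambda>x. norm (f x - \<psi> n x))" using int by simp
      have "integrable \<mu> (\<lambda>x. \<bar>f x - \<phi> n x\<bar>)" using \<open>integrable \<mu> f\<close> \<phi>(2) by auto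
      thus "integrable P (\<lambda>x. \<bar>f (keep S x) - \<phi> n (keep S x)\<bar>)"
        unfolding \<mu>_def by (subst (asm) integrable_distr_eq) auto
      fix x
      show "norm (f x - \<psi> n x) \<le> \<bar>f (keep S x) - \<phi> n (keep S x)\<bar>"
        using bd[of x] by (auto simp: \<psi>_def depends_on_keep[OF dep] max_def min_def abs_if split: if_splits)
    qed
    also have "\<dots> = (\<integral>x. \<bar>f x - \<phi> n x\<bar> \<partial>\<mu>)"
      unfolding \<mu>_def by (subst integral_distr) auto
    finally show ?thesis using \<phi>(3)[of n] by simp
  qed
  have "(\<lambda>n. \<integral>x. norm (f x - \<psi> n x) \<partial>P) \<longlonglongrightarrow> 0"
  proof (rule tendsto_sandwich[OF _ _ tendsto_const])
    show "(\<lambda>n. 1 / (real n + 1)) \<longlonglongrightarrow> 0" by real_asymp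
  qed (use le in \<open>simp_all add: always_eventually\<close>)
  from tendsto_L1_AE_subseq[OF int this]
  obtain r :: "nat \<Rightarrow> nat" where r: "AE x in P. (\<lambda>n. f x - \<psi> (r n) x) \<longlonglongrightarrow> 0" by blast
  have "AE x in P. (\<lambda>n. \<psi> (r n) x) \<longlonglongrightarrow> f x"
    using r
  proof eventually_elim
    case (elim x)
    from tendsto_diff[OF tendsto_const[of "f x"] elim] show ?case by simp
  qed
  moreover have "\<exists>C. C-lipschitz_on UNIV (\<psi> n)" for n using lip \<phi>(1) by blast
  ultimately show ?thesis using dep\<psi> bd\<psi> by (intro exI[of _ "\<lambda>n. \<psi> (r n)"]) blast
qed

context
  fixes \<Psi> :: "'n::{finite,linorder} path \<Rightarrow> 'n path" and r C :: real
  assumes lip: "C-lipschitz_on UNIV \<Psi>" and dep: "\<And>t. depends_on {..t} (\<lambda>x. \<Psi> x $ t)"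
    and r: "r \<ge> 0" "r * C < 1"
begin

text \<open>For an adapted Lipschitz direction \<open>\<Psi>\<close> and small \<open>r\<close>, the map \<open>x + r \<Psi>(x)\<close> is inverted by iterating
the contraction \<open>y - r \<Psi>(x)\<close>. Every iterate is adapted in \<open>y\<close>, hence so is the limit.\<close>

definition inverse_iterate :: "'n path \<Rightarrow> nat \<Rightarrow> 'n path" where
  "inverse_iterate y n = ((\<lambda>x. y - r *\<^sub>R \<Psi> x) ^^ n) 0"

lemma inverse_iterate_simps:
  "inverse_iterate y 0 = 0" "inverse_iterate y (Suc n) = y - r *\<^sub>R \<Psi> (inverse_iterate y n)"
  by (simp_all add: inverse_iterate_def)

lemma inverse_iterate_tendsto: "inverse_iterate (x + r *\<^sub>R \<Psi> x) \<longlonglongrightarrow> x"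
proof -
  let ?y = "x + r *\<^sub>R \<Psi> x"
  have C0: "C \<ge> 0" using lip by (rule lipschitz_on_nonneg)
  have "dist (inverse_iterate ?y n) x \<le> (r * C) ^ n * dist 0 x" for n
  proof (induction n)
    case (Suc n)
    have "dist (inverse_iterate ?y (Suc n)) x = r * dist (\<Psi> (inverse_iterate ?y n)) (\<Psi> x)"
      using r(1) by (simp add: inverse_iterate_simps dist_norm scaleR_diff_right[symmetric] norm_minus_commute)
    also have "\<dots> \<le> r * (C * dist (inverse_iterate ?y n) x)"
      using r(1) by (intro mult_left_mono lipschitz_onD[OF lip]) auto
    also have "\<dots> \<le> r * (C * ((r * C) ^ n * dist 0 x))"
      using r(1) C0 Suc by (intro mult_left_mono) auto
    finally show ?case by (simp add: mult.assoc)
  qed (simp add: inverse_iterate_simps)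
  note bound = this
  have "(\<lambda>n. (r * C) ^ n) \<longlonglongrightarrow> 0"
    by (rule LIMSEQ_power_zero) (use r C0 in \<open>simp add: abs_mult\<close>)
  hence lim: "(\<lambda>n. (r * C) ^ n * dist 0 x) \<longlonglongrightarrow> 0"
    by (rule tendsto_mult_left_zero)
  have "(\<lambda>n. dist (inverse_iterate ?y n) x) \<longlonglongrightarrow> 0"
  proof (rule Lim_null_comparison[OF _ lim])
    show "\<forall>\<^sub>F n in sequentially. norm (dist (inverse_iterate ?y n) x) \<le> (r * C) ^ n * dist 0 x"
      using bound by (intro always_eventually allI) (subst real_norm_def, subst abs_of_nonneg, rule zero_le_dist)
  qed
  thus ?thesis by (subst tendsto_dist_iff)
qed

lemma perturbation_inverse:
  obtains \<Theta> where "\<Theta> \<in> borel_measurable borel" "\<And>t. depends_on {..t} (\<lambda>y. \<Theta> y $ t)"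
    "\<And>x. \<Theta> (x + r *\<^sub>R \<Psi> x) = x"
proof -
  \<comment> \<open>The limit need not exist at points outside the range of the map; its value there is irrelevant.\<close>
  define \<Theta> where "\<Theta> y = (\<chi> t. lim (\<lambda>n. inverse_iterate y n $ t))" for y
  have [measurable]: "\<Psi> \<in> borel_measurable borel"
    by (rule borel_measurable_continuous_onI[OF lipschitz_on_continuous_on[OF lip]])
  have [measurable]: "(\<lambda>y. inverse_iterate y n) \<in> borel_measurable borel" for n
    by (induction n) (simp_all add: inverse_iterate_simps)
  have iter_dep: "inverse_iterate y n $ t = inverse_iterate y' n $ t" if "\<forall>s\<in>{..t}. y $ s = y' $ s" for y y' n t
    using that
  proof (induction n arbitrary: t)
    case (Suc n)
    have "\<Psi> (inverse_iterate y n) $ t = \<Psi> (inverse_iterate y' n) $ t"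
    proof (rule depends_onD[OF dep])
      fix s assume "s \<in> {..t}"
      thus "inverse_iterate y n $ s = inverse_iterate y' n $ s"
        using Suc.prems by (intro Suc.IH) auto
    qed
    thus ?case using Suc.prems by (simp add: inverse_iterate_simps)
  qed (simp add: inverse_iterate_simps)
  show thesis
  proof (rule that[of \<Theta>])
    show "\<Theta> \<in> borel_measurable borel"
    proof (rule borel_measurable_vec)
      show "(\<lambda>y. \<Theta> y $ t) \<in> borel_measurable borel" for t
        unfolding \<Theta>_def vec_lambda_beta by measurable
    qed
    show "depends_on {..t} (\<lambda>y. \<Theta> y $ t)" for t
      unfolding depends_on_def
    proof (intro allI impI)
      fix y y' :: "'n path" assume "\<forall>s\<in>{..t}. y $ s = y' $ s"
      from iter_dep[OF this] show "\<Theta> y $ t = \<Theta> y' $ t" by (simp add: \<Theta>_def)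
    qed
    show "\<Theta> (x + r *\<^sub>R \<Psi> x) = x" for x
    proof -
      have "(\<lambda>n. inverse_iterate (x + r *\<^sub>R \<Psi> x) n $ t) \<longlonglongrightarrow> x $ t" for t
        by (rule tendsto_vec_nth[OF inverse_iterate_tendsto])
      thus ?thesis by (simp add: \<Theta>_def vec_eq_iff limI)
    qed
  qed
qed

lemma perturbation_AW:
  assumes P: "P \<in> P_p p" and p: "p > 0" and bdd: "\<And>x. norm (\<Psi> x) \<le> B"
    and norm: "(\<Sum>t\<in>UNIV. \<integral>x. \<bar>\<Psi> x $ t\<bar> powr p \<partial>P) \<le> 1"
  shows "distr P borel (\<lambda>x. x + r *\<^sub>R \<Psi> x) \<in> AW_ball p P r"
proof -
  note PD = P_pD[OF P]
  interpret prob_space P by (rule PD)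
  note [measurable_cong] = PD(2)
  have \<Psi> [measurable]: "\<Psi> \<in> borel_measurable borel"
    by (rule borel_measurable_continuous_onI[OF lipschitz_on_continuous_on[OF lip]])
  let ?\<Phi> = "\<lambda>x. x + r *\<^sub>R \<Psi> x"
  have B: "B \<ge> 0" using bdd[of 0] norm_ge_zero order_trans by blast
  have "integrable P (\<lambda>x. norm (?\<Phi> x) powr p)"
  proof (rule Bochner_Integration.integrable_bound)
    show "integrable P (\<lambda>x. 2 powr p * (norm x powr p + (r * B) powr p))" using PD(4) by simp
    show "AE x in P. norm (norm (?\<Phi> x) powr p) \<le> norm (2 powr p * (norm x powr p + (r * B) powr p))"
    proof (rule AE_I2)
      fix x
      have "norm (?\<Phi> x) \<le> norm x + r * B"
        using r(1) bdd[of x] by (intro norm_triangle_le add_left_mono) (simp add: mult_left_mono)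
      hence "norm (?\<Phi> x) powr p \<le> (norm x + r * B) powr p" using p by (intro powr_mono2) auto
      also have "\<dots> \<le> 2 powr p * (norm x powr p + (r * B) powr p)"
        using p r(1) B by (intro powr_add_le) auto
      finally show "norm (norm (?\<Phi> x) powr p) \<le> norm (2 powr p * (norm x powr p + (r * B) powr p))" by simp
    qed
  qed measurable
  hence Q: "distr P borel ?\<Phi> \<in> P_p p"
    by (simp add: P_p_def prob_space_distr integrable_distr_eq)
  obtain \<Theta> where \<Theta>: "\<Theta> \<in> borel_measurable borel" "\<And>t. depends_on {..t} (\<lambda>y. \<Theta> y $ t)"
    "\<And>x. \<Theta> (x + r *\<^sub>R \<Psi> x) = x" using perturbation_inverse by blast
  have dep\<Phi>: "depends_on {..t} (\<lambda>x. ?\<Phi> x $ t)" for t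
    unfolding depends_on_def
  proof (intro allI impI)
    fix x y :: "'n path" assume eq: "\<forall>s\<in>{..t}. x $ s = y $ s"
    hence "\<Psi> x $ t = \<Psi> y $ t" by (intro depends_onD[OF dep]) auto
    thus "?\<Phi> x $ t = ?\<Phi> y $ t" using eq by simp
  qed
  have \<pi>: "distr P borel (\<lambda>x. (x, ?\<Phi> x)) \<in> bicausal_couplings P (distr P borel ?\<Phi>)"
    by (rule graph_bicausal[OF PD(1,2) _ \<Theta>(1) dep\<Phi> \<Theta>(2,3)]) measurable
  have m [measurable]: "(\<lambda>x. (x, ?\<Phi> x)) \<in> borel_measurable P"
    unfolding borel_prod[symmetric] by measurable
  have m2 [measurable]: "(\<lambda>\<omega> :: 'n path \<times> 'n path. \<bar>fst \<omega> $ t - snd \<omega> $ t\<bar> powr p) \<in> borel_measurable borel" for t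
    unfolding borel_prod[symmetric] by measurable
  have "AW p P (distr P borel ?\<Phi>) \<le>
      (\<Sum>t\<in>UNIV. \<integral>\<omega>. \<bar>fst \<omega> $ t - snd \<omega> $ t\<bar> powr p \<partial>distr P borel (\<lambda>x. (x, ?\<Phi> x))) powr (1 / p)"
    by (rule AW_le[OF \<pi>])
  also have "(\<Sum>t\<in>UNIV. \<integral>\<omega>. \<bar>fst \<omega> $ t - snd \<omega> $ t\<bar> powr p \<partial>distr P borel (\<lambda>x. (x, ?\<Phi> x)))
      = (\<Sum>t\<in>UNIV. \<integral>x. r powr p * \<bar>\<Psi> x $ t\<bar> powr p \<partial>P)"
    using r(1) by (simp add: integral_distr[OF m m2] abs_mult powr_mult)
  also have "\<dots> = r powr p * (\<Sum>t\<in>UNIV. \<integral>x. \<bar>\<Psi> x $ t\<bar> powr p \<partial>P)"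
    by (simp add: sum_distrib_left)
  also have "(r powr p * (\<Sum>t\<in>UNIV. \<integral>x. \<bar>\<Psi> x $ t\<bar> powr p \<partial>P)) powr (1 / p) \<le> (r powr p * 1) powr (1 / p)"
    using p norm by (intro powr_mono2 mult_left_mono mult_nonneg_nonneg sum_nonneg) auto
  also have "\<dots> = r" using p r(1) by (simp add: powr_powr)
  finally show ?thesis using Q by (simp add: AW_ball_def)
qed

end

section \<open>The lower bound and the expansion\<close>

context hedging
begin

text \<open>The sensitivity is nearly attained by a normalized, bounded, adapted Lipschitz direction. If every such
direction missed it by \<open>e\<close>, the resulting homogeneous inequality would pass to almost sure limits, first
to truncations of the Hoelder extremal \<open>sgn h \<bar>h\<bar>\<^sup>q\<^sup>-\<^sup>1\<close> and then to that function itself, which attains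
equality.\<close>

lemma sensitivity_direction:
  assumes a: "a \<in> controls L" and e: "e > 0"
  obtains \<Psi> C B where "C-lipschitz_on UNIV \<Psi>" "\<And>t. depends_on {..t} (\<lambda>x. \<Psi> x $ t)"
    "\<And>x. norm (\<Psi> x) \<le> B" "(\<Sum>t\<in>UNIV. \<integral>x. \<bar>\<Psi> x $ t\<bar> powr p \<partial>P) \<le> 1"
    "sensitivity q X0 loss g P a - e \<le> (\<Sum>t\<in>UNIV. \<integral>x. \<Psi> x $ t * proj_grad a t x \<partial>P)"
proof -
  define h where "h = proj_grad a"
  have h [measurable]: "h t \<in> borel_measurable borel" for t unfolding h_def by (rule proj_grad_borel[OF a])
  have hd: "depends_on {..t} (h t)" for t unfolding h_def by (rule proj_grad_depends[OF a])
  have hi: "integrable P (h t)" "integrable P (\<lambda>x. \<bar>h t x\<bar> powr q)" for t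
    unfolding h_def by (rule proj_grad_integrable[OF a])+
  define A where "A = (\<Sum>t\<in>UNIV. \<integral>x. \<bar>h t x\<bar> powr q \<partial>P)"
  define V where "V = A powr (1 / q)"
  have V: "sensitivity q X0 loss g P a = V"
    unfolding V_def A_def h_def by (rule sensitivity_eq[OF a])
  have A0: "A \<ge> 0" unfolding A_def by (intro sum_nonneg Bochner_Integration.integral_nonneg) simp
  show thesis
  proof (cases "A = 0")
    case True
    hence "V = 0" by (simp add: V_def)
    show thesis
    proof (rule that[of 0 "\<lambda>_. 0" 0])
      show "0-lipschitz_on UNIV (\<lambda>_. 0 :: 'n path)" by (rule lipschitz_onI) auto
    qed (use e p \<open>V = 0\<close> V in \<open>auto simp: depends_on_const\<close>)
  next
    case False
    hence A: "A > 0" using A0 by simp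
    define adm where "adm \<Psi> \<longleftrightarrow> (\<exists>C. C-lipschitz_on UNIV \<Psi>) \<and> (\<forall>t. depends_on {..t} (\<lambda>x. \<Psi> x $ t)) \<and> (\<exists>B. \<forall>x. norm (\<Psi> x) \<le> B)"
      for \<Psi> :: "'n path \<Rightarrow> 'n path"
    define nrm where "nrm \<Psi> = (\<Sum>t\<in>UNIV. \<integral>x. \<bar>\<Psi> x $ t\<bar> powr p \<partial>P)" for \<Psi> :: "'n path \<Rightarrow> 'n path"
    define pair where "pair \<Psi> = (\<Sum>t\<in>UNIV. \<integral>x. \<Psi> x $ t * h t x \<partial>P)" for \<Psi> :: "'n path \<Rightarrow> 'n path"
    have "\<exists>\<Psi>. adm \<Psi> \<and> (V - e) * nrm \<Psi> powr (1 / p) < pair \<Psi>"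
    proof (rule ccontr)
      assume "\<not> ?thesis"
      hence le: "pair \<Psi> \<le> (V - e) * nrm \<Psi> powr (1 / p)" if "adm \<Psi>" for \<Psi>
        using that by (auto simp: not_less)
      define \<Psi> where "\<Psi> k x = (\<chi> t. sgn (h t x) * min (\<bar>h t x\<bar> powr (q - 1)) (real k))" for k :: nat and x
      have [measurable]: "\<Psi> k \<in> borel_measurable borel" for k
        by (rule borel_measurable_vec) (simp add: \<Psi>_def)
      have \<Psi>_bd: "\<bar>\<Psi> k x $ t\<bar> \<le> real k" for k x t
        by (auto simp: \<Psi>_def abs_mult abs_sgn_eq min_def)
      have bounded_le: "pair (\<Psi> k) \<le> (V - e) * nrm (\<Psi> k) powr (1 / p)" for k
      proof -
        have "\<exists>\<phi>. (\<forall>n. (\<exists>C. C-lipschitz_on UNIV (\<phi> n)) \<and> depends_on {..t} (\<phi> n) \<and> (\<forall>x. \<bar>\<phi> n x\<bar> \<le> real k))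
            \<and> (AE x in P. (\<lambda>n::nat. \<phi> n x) \<longlonglongrightarrow> \<Psi> k x $ t)" for t
        proof (rule lipschitz_approx_depends_on[OF P.prob_space_axioms sets_P])
          show "depends_on {..t} (\<lambda>x. \<Psi> k x $ t)"
            unfolding \<Psi>_def vec_lambda_beta by (rule depends_on_compose[OF hd])
        qed (simp_all add: \<Psi>_bd)
        hence "\<exists>\<phi>. \<forall>t. (\<forall>n. (\<exists>C. C-lipschitz_on UNIV (\<phi> t n)) \<and> depends_on {..t} (\<phi> t n) \<and> (\<forall>x. \<bar>\<phi> t n x\<bar> \<le> real k))
            \<and> (AE x in P. (\<lambda>n::nat. \<phi> t n x) \<longlonglongrightarrow> \<Psi> k x $ t)"
          by (intro choice) blast
        then obtain \<phi> where \<phi>: "\<And>t n. \<exists>C. C-lipschitz_on UNIV (\<phi> t n)" "\<And>t n. depends_on {..t} (\<phi> t n)"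
          "\<And>t n x. \<bar>\<phi> t n x\<bar> \<le> real k" "\<And>t. AE x in P. (\<lambda>n::nat. \<phi> t n x) \<longlonglongrightarrow> \<Psi> k x $ t"
          by blast
        have [measurable]: "\<phi> t n \<in> borel_measurable borel" for t n
          using \<phi>(1)[of t n] by (auto intro: borel_measurable_continuous_onI lipschitz_on_continuous_on)
        define \<Phi> where "\<Phi> n x = (\<chi> t. \<phi> t n x)" for n x
        have "adm (\<Phi> n)" for n
        proof -
          have "\<exists>C. \<forall>t. (C t)-lipschitz_on UNIV (\<phi> t n)" using \<phi>(1) by (intro choice) blast
          then obtain C where C: "\<And>t. (C t)-lipschitz_on UNIV (\<phi> t n)" by blast
          have "(\<Sum>t\<in>UNIV. C t)-lipschitz_on UNIV (\<Phi> n)"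
          proof (rule lipschitz_onI)
            fix x y :: "'n path"
            have "dist (\<Phi> n x) (\<Phi> n y) \<le> (\<Sum>t\<in>UNIV. \<bar>(\<Phi> n x - \<Phi> n y) $ t\<bar>)"
              unfolding dist_norm by (rule norm_le_l1_cart)
            also have "\<dots> \<le> (\<Sum>t\<in>UNIV. C t * dist x y)"
              using lipschitz_onD[OF C] by (intro sum_mono) (auto simp: \<Phi>_def dist_real_def)
            finally show "dist (\<Phi> n x) (\<Phi> n y) \<le> (\<Sum>t\<in>UNIV. C t) * dist x y" by (simp add: sum_distrib_right)
          qed (auto intro!: sum_nonneg lipschitz_on_nonneg[OF C])
          moreover have "norm (\<Phi> n x) \<le> (\<Sum>t\<in>(UNIV :: 'n set). real k)" for x
            by (rule order_trans[OF norm_le_l1_cart sum_mono]) (simp add: \<Phi>_def \<phi>(3))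
          ultimately show ?thesis unfolding adm_def using \<phi>(2) by (auto simp: \<Phi>_def)
        qed
        hence le\<Phi>: "pair (\<Phi> n) \<le> (V - e) * nrm (\<Phi> n) powr (1 / p)" for n by (rule le)
        have "(\<lambda>n. \<integral>x. \<Phi> n x $ t * h t x \<partial>P) \<longlonglongrightarrow> (\<integral>x. \<Psi> k x $ t * h t x \<partial>P)" for t
        proof (rule integral_dominated_convergence[where w = "\<lambda>x. real k * \<bar>h t x\<bar>"])
          show "AE x in P. (\<lambda>n. \<Phi> n x $ t * h t x) \<longlonglongrightarrow> \<Psi> k x $ t * h t x"
            using \<phi>(4)[of t] by eventually_elim (auto simp: \<Phi>_def intro!: tendsto_intros)
          show "AE x in P. norm (\<Phi> n x $ t * h t x) \<le> real k * \<bar>h t x\<bar>" for n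
            using \<phi>(3) by (auto simp: \<Phi>_def abs_mult intro!: mult_right_mono)
        qed (use hi in \<open>simp_all add: \<Phi>_def\<close>)
        hence lim1: "(\<lambda>n. pair (\<Phi> n)) \<longlonglongrightarrow> pair (\<Psi> k)"
          unfolding pair_def by (intro tendsto_sum)
        have "(\<lambda>n. \<integral>x. \<bar>\<Phi> n x $ t\<bar> powr p \<partial>P) \<longlonglongrightarrow> (\<integral>x. \<bar>\<Psi> k x $ t\<bar> powr p \<partial>P)" for t
        proof (rule integral_dominated_convergence[where w = "\<lambda>x. real k powr p"])
          show "AE x in P. (\<lambda>n. \<bar>\<Phi> n x $ t\<bar> powr p) \<longlonglongrightarrow> \<bar>\<Psi> k x $ t\<bar> powr p"
            using \<phi>(4)[of t]
          proof eventually_elim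
            case (elim x)
            have "(\<lambda>n. \<bar>\<phi> t n x\<bar> powr p) \<longlonglongrightarrow> \<bar>\<Psi> k x $ t\<bar> powr p"
              by (rule tendsto_powr'[OF tendsto_rabs[OF elim] tendsto_const]) (use p in auto)
            thus ?case by (simp add: \<Phi>_def)
          qed
          show "AE x in P. norm (\<bar>\<Phi> n x $ t\<bar> powr p) \<le> real k powr p" for n
            using \<phi>(3) p by (auto simp: \<Phi>_def intro!: powr_mono2)
        qed (simp_all add: \<Phi>_def)
        hence "(\<lambda>n. nrm (\<Phi> n)) \<longlonglongrightarrow> nrm (\<Psi> k)"
          unfolding nrm_def by (intro tendsto_sum)
        hence "(\<lambda>n. (V - e) * nrm (\<Phi> n) powr (1 / p)) \<longlonglongrightarrow> (V - e) * nrm (\<Psi> k) powr (1 / p)"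
          using p by (intro tendsto_mult tendsto_const tendsto_powr') (auto simp: nrm_def intro!: always_eventually sum_nonneg)
        thus ?thesis using le\<Phi> by (intro LIMSEQ_le[OF lim1]) auto
      qed
      \<comment> \<open>By \<open>(q - 1) p = q\<close>, numerator and norm of the extremal are both given by the \<open>q\<close>-th moment.\<close>
      have q1: "\<bar>y\<bar> * \<bar>y\<bar> powr (q - 1) = \<bar>y\<bar> powr q" "(\<bar>y\<bar> powr (q - 1)) powr p = \<bar>y\<bar> powr q" for y
        using powr_mult_base[of "\<bar>y\<bar>" "q - 1"] conjugate_exponent(4)[OF p q] by (simp_all add: powr_powr)
      have min_lim: "\<forall>\<^sub>F k in sequentially. min z (real k) = z" for z
      proof -
        obtain m :: nat where "z < real m" using reals_Archimedean2 by blast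
        thus ?thesis unfolding eventually_sequentially by (intro exI[of _ m]) auto
      qed
      have "(\<lambda>k. \<integral>x. \<Psi> k x $ t * h t x \<partial>P) \<longlonglongrightarrow> (\<integral>x. \<bar>h t x\<bar> powr q \<partial>P)" for t
      proof (rule integral_dominated_convergence[where w = "\<lambda>x. \<bar>h t x\<bar> powr q"])
        have eq: "\<Psi> k x $ t * h t x = \<bar>h t x\<bar> * min (\<bar>h t x\<bar> powr (q - 1)) (real k)" for k x
          by (simp add: \<Psi>_def abs_sgn)
        show "AE x in P. (\<lambda>k. \<Psi> k x $ t * h t x) \<longlonglongrightarrow> \<bar>h t x\<bar> powr q"
        proof (rule AE_I2)
          fix x
          have "\<forall>\<^sub>F k in sequentially. \<bar>h t x\<bar> powr q = \<Psi> k x $ t * h t x"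
            using min_lim[of "\<bar>h t x\<bar> powr (q - 1)"] by eventually_elim (simp add: eq q1)
          thus "(\<lambda>k. \<Psi> k x $ t * h t x) \<longlonglongrightarrow> \<bar>h t x\<bar> powr q"
            by (rule Lim_transform_eventually[OF tendsto_const])
        qed
        show "AE x in P. norm (\<Psi> k x $ t * h t x) \<le> \<bar>h t x\<bar> powr q" for k
        proof (rule AE_I2)
          fix x
          have "\<bar>h t x\<bar> * min (\<bar>h t x\<bar> powr (q - 1)) (real k) \<le> \<bar>h t x\<bar> * \<bar>h t x\<bar> powr (q - 1)"
            by (intro mult_left_mono) auto
          thus "norm (\<Psi> k x $ t * h t x) \<le> \<bar>h t x\<bar> powr q" unfolding eq by (simp add: q1 abs_mult)
        qed
      qed (use hi in simp_all)
      hence lim1: "(\<lambda>k. pair (\<Psi> k)) \<longlonglongrightarrow> A"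
        unfolding pair_def A_def by (intro tendsto_sum)
      have "(\<lambda>k. \<integral>x. \<bar>\<Psi> k x $ t\<bar> powr p \<partial>P) \<longlonglongrightarrow> (\<integral>x. \<bar>h t x\<bar> powr q \<partial>P)" for t
      proof (rule integral_dominated_convergence[where w = "\<lambda>x. \<bar>h t x\<bar> powr q"])
        have eq: "\<bar>\<Psi> k x $ t\<bar> = min (\<bar>h t x\<bar> powr (q - 1)) (real k)" for k x
          by (cases "h t x = 0") (simp_all add: \<Psi>_def abs_mult abs_sgn_eq)
        show "AE x in P. (\<lambda>k. \<bar>\<Psi> k x $ t\<bar> powr p) \<longlonglongrightarrow> \<bar>h t x\<bar> powr q"
        proof (rule AE_I2)
          fix x
          have "\<forall>\<^sub>F k in sequentially. \<bar>h t x\<bar> powr q = \<bar>\<Psi> k x $ t\<bar> powr p"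
            using min_lim[of "\<bar>h t x\<bar> powr (q - 1)"] by eventually_elim (simp only: eq q1)
          thus "(\<lambda>k. \<bar>\<Psi> k x $ t\<bar> powr p) \<longlonglongrightarrow> \<bar>h t x\<bar> powr q"
            by (rule Lim_transform_eventually[OF tendsto_const])
        qed
        show "AE x in P. norm (\<bar>\<Psi> k x $ t\<bar> powr p) \<le> \<bar>h t x\<bar> powr q" for k
        proof (rule AE_I2)
          fix x
          have "\<bar>\<Psi> k x $ t\<bar> powr p \<le> (\<bar>h t x\<bar> powr (q - 1)) powr p"
            unfolding eq using p by (intro powr_mono2) auto
          thus "norm (\<bar>\<Psi> k x $ t\<bar> powr p) \<le> \<bar>h t x\<bar> powr q" by (simp only: q1) simp
        qed
      qed (use hi in simp_all)
      hence "(\<lambda>k. nrm (\<Psi> k)) \<longlonglongrightarrow> A"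
        unfolding nrm_def A_def by (intro tendsto_sum)
      hence "(\<lambda>k. (V - e) * nrm (\<Psi> k) powr (1 / p)) \<longlonglongrightarrow> (V - e) * A powr (1 / p)"
        using A by (intro tendsto_intros) auto
      hence "A \<le> (V - e) * A powr (1 / p)"
        using bounded_le by (intro LIMSEQ_le[OF lim1]) auto
      moreover have "A = V * A powr (1 / p)"
        using A conjugate_exponent(2)[OF p q] powr_add[of A "1 / q" "1 / p"] by (simp add: V_def add.commute)
      ultimately have "e * A powr (1 / p) \<le> 0" by (simp add: left_diff_distrib)
      moreover have "e * A powr (1 / p) > 0" using e A by simp
      ultimately show False by simp
    qed
    then obtain \<Psi> where adm: "adm \<Psi>" and gt: "(V - e) * nrm \<Psi> powr (1 / p) < pair \<Psi>" by blast
    obtain C B where \<Psi>: "C-lipschitz_on UNIV \<Psi>" "\<And>t. depends_on {..t} (\<lambda>x. \<Psi> x $ t)" "\<And>x. norm (\<Psi> x) \<le> B"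
      using adm unfolding adm_def by blast
    have \<Psi>m [measurable]: "\<Psi> \<in> borel_measurable borel"
      by (rule borel_measurable_continuous_onI[OF lipschitz_on_continuous_on[OF \<Psi>(1)]])
    have \<Psi>p: "integrable P (\<lambda>x. \<bar>\<Psi> x $ t\<bar> powr p)" for t
    proof (rule P.integrable_const_bound[of _ "B powr p"])
      have "\<bar>\<Psi> x $ t\<bar> \<le> B" for x using component_le_norm_cart[of "\<Psi> x" t] \<Psi>(3)[of x] by linarith
      thus "AE x in P. norm (\<bar>\<Psi> x $ t\<bar> powr p) \<le> B powr p" using p by (auto intro!: powr_mono2)
    qed measurable
    define N where "N = nrm \<Psi> powr (1 / p)"
    have nrm0: "nrm \<Psi> \<ge> 0" unfolding nrm_def by (intro sum_nonneg Bochner_Integration.integral_nonneg) simp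
    have "pair \<Psi> \<le> nrm \<Psi> powr (1 / p) * A powr (1 / q)"
      unfolding pair_def nrm_def A_def by (rule Holder_sum[OF p q]) (use hi \<Psi>p in simp_all)
    hence "N \<noteq> 0" using gt unfolding N_def by auto
    hence N: "N > 0" by (simp add: N_def)
    have NP: "N powr p = nrm \<Psi>" using nrm0 p by (simp add: N_def powr_powr)
    show thesis
    proof (rule that[of "\<bar>1 / N\<bar> * C" "\<lambda>x. (1 / N) *\<^sub>R \<Psi> x" "B / N"])
      show "(\<bar>1 / N\<bar> * C)-lipschitz_on UNIV (\<lambda>x. (1 / N) *\<^sub>R \<Psi> x)"
        by (rule lipschitz_on_cmult[OF \<Psi>(1)])
      show "depends_on {..t} (\<lambda>x. ((1 / N) *\<^sub>R \<Psi> x) $ t)" for t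
        using depends_on_compose[OF \<Psi>(2), of t "\<lambda>y. y / N"] by simp
      show "norm ((1 / N) *\<^sub>R \<Psi> x) \<le> B / N" for x
        using \<Psi>(3)[of x] N by (simp add: divide_right_mono)
      have "(\<Sum>t\<in>UNIV. \<integral>x. \<bar>((1 / N) *\<^sub>R \<Psi> x) $ t\<bar> powr p \<partial>P) = (\<Sum>t\<in>UNIV. \<integral>x. \<bar>\<Psi> x $ t\<bar> powr p / N powr p \<partial>P)"
        using N by (simp add: abs_mult powr_divide)
      also have "\<dots> = nrm \<Psi> / N powr p" by (simp add: nrm_def sum_divide_distrib)
      also have "\<dots> \<le> 1" using NP nrm0 by (cases "nrm \<Psi> = 0") auto
      finally show "(\<Sum>t\<in>UNIV. \<integral>x. \<bar>((1 / N) *\<^sub>R \<Psi> x) $ t\<bar> powr p \<partial>P) \<le> 1" .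
      have "(V - e) \<le> pair \<Psi> / N" using gt N unfolding N_def[symmetric] by (simp add: field_simps)
      also have "\<dots> = (\<Sum>t\<in>UNIV. \<integral>x. ((1 / N) *\<^sub>R \<Psi> x) $ t * h t x \<partial>P)"
        by (simp add: pair_def sum_divide_distrib)
      finally show "sensitivity q X0 loss g P a - e \<le> (\<Sum>t\<in>UNIV. \<integral>x. ((1 / N) *\<^sub>R \<Psi> x) $ t * proj_grad a t x \<partial>P)"
        by (simp add: V h_def)
    qed
  qed
qed

context
  fixes a :: "'n \<Rightarrow> 'n path \<Rightarrow> real" and \<Psi> :: "'n path \<Rightarrow> 'n path" and B :: real
  assumes a: "optimal a"
    and \<Psi> [measurable]: "\<Psi> \<in> borel_measurable borel"
    and dep: "\<And>t. depends_on {..t} (\<lambda>x. \<Psi> x $ t)" and bdd: "\<And>x. norm (\<Psi> x) \<le> B"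
begin

text \<open>The expected loss of a control that depends on the original path but trades on the displaced path.\<close>

definition shifted_loss :: "real \<Rightarrow> ('n \<Rightarrow> 'n path \<Rightarrow> real) \<Rightarrow> real" where
  "shifted_loss r b = (\<integral>x. loss (gain (ctrl_vec b x, x + r *\<^sub>R \<Psi> x)) \<partial>P)"

lemma g_remainder_tendsto:
  "((\<lambda>r. (\<integral>x. \<bar>deriv loss (payoff X0 g a x) * (g (x + r *\<^sub>R \<Psi> x) - g x - r * blinfun_apply (g' x) (\<Psi> x))\<bar> \<partial>P) / r) \<longlongrightarrow> 0) (at_right 0)"
  unfolding tendsto_at_iff_sequentially
proof (intro allI impI)
  note ca = optimalD(1)[OF a]
  have B0: "B \<ge> 0" using bdd[of 0] norm_ge_zero order_trans by blast
  obtain G where G: "\<And>x. norm (g' x) \<le> G" using g'_bdd by (auto simp: bounded_iff)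
  have G0: "G \<ge> 0" using G[of 0] norm_ge_zero order_trans by blast
  have [measurable]: "(\<lambda>x. blinfun_apply (g' x) (\<Psi> x)) \<in> borel_measurable borel"
  proof -
    have "(\<lambda>x. blinfun_apply (g' x) (\<Psi> x)) = (\<lambda>x. \<Sum>t\<in>UNIV. \<Psi> x $ t * partial_deriv t g x)"
      by (rule ext, subst path_eq_sum[of "\<Psi> _"]) (simp add: blinfun.sum_right blinfun.scaleR_right partial_deriv_eq)
    thus ?thesis by simp
  qed
  define M where "M x = deriv loss (payoff X0 g a x)" for x
  have M [measurable]: "M \<in> borel_measurable borel" unfolding M_def using ca by measurable
  have iM: "integrable P M"
    using integrable_loss'_mult[OF P ca, of "\<lambda>_. 1" 1] unfolding M_def by simp
  fix R :: "nat \<Rightarrow> real" assume "\<forall>i. R i \<in> {0<..} - {0}" and R0: "R \<longlonglongrightarrow> 0"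
  hence R: "R i > 0" for i by auto
  define \<rho> where "\<rho> r x = g (x + r *\<^sub>R \<Psi> x) - g x - r * blinfun_apply (g' x) (\<Psi> x)" for r x
  have [measurable]: "\<rho> r \<in> borel_measurable borel" for r unfolding \<rho>_def by measurable
  have "(\<lambda>i. \<integral>x. \<bar>M x * (\<rho> (R i) x / R i)\<bar> \<partial>P) \<longlonglongrightarrow> (\<integral>x. 0 \<partial>P)"
  proof (rule integral_dominated_convergence[where w = "\<lambda>x. \<bar>M x\<bar> * (2 * (G * B))"])
    show "integrable P (\<lambda>x. \<bar>M x\<bar> * (2 * (G * B)))" using iM by simp
    show "AE x in P. norm \<bar>M x * (\<rho> (R i) x / R i)\<bar> \<le> \<bar>M x\<bar> * (2 * (G * B))" for i
    proof (rule AE_I2)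
      fix x
      have "norm (g (x + R i *\<^sub>R \<Psi> x) - g x) \<le> G * norm (x + R i *\<^sub>R \<Psi> x - x)"
        by (rule differentiable_bound[of UNIV g "\<lambda>x. blinfun_apply (g' x)"])
          (use g_deriv G in \<open>auto simp: norm_blinfun.rep_eq[symmetric]\<close>)
      also have "\<dots> \<le> G * (R i * B)"
        using R[of i] bdd[of x] G0 by (intro mult_left_mono) auto
      finally have 1: "\<bar>g (x + R i *\<^sub>R \<Psi> x) - g x\<bar> \<le> R i * (G * B)" by (simp add: algebra_simps)
      have "norm (blinfun_apply (g' x) (\<Psi> x)) \<le> G * B"
        using G0 by (intro order_trans[OF norm_blinfun] mult_mono G bdd) auto
      hence "\<bar>R i * blinfun_apply (g' x) (\<Psi> x)\<bar> \<le> R i * (G * B)"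
        using R[of i] by (simp add: abs_mult)
      hence "\<bar>\<rho> (R i) x\<bar> \<le> R i * (2 * (G * B))"
        unfolding \<rho>_def using 1 by linarith
      hence "\<bar>\<rho> (R i) x / R i\<bar> \<le> 2 * (G * B)"
        using R[of i] by (simp add: field_simps abs_le_iff)
      thus "norm \<bar>M x * (\<rho> (R i) x / R i)\<bar> \<le> \<bar>M x\<bar> * (2 * (G * B))"
        unfolding real_norm_def abs_idempotent unfolding abs_mult[of "M x"] by (rule mult_left_mono) simp
    qed
    show "AE x in P. (\<lambda>i. \<bar>M x * (\<rho> (R i) x / R i)\<bar>) \<longlonglongrightarrow> 0"
    proof (rule AE_I2)
      fix x
      have "((\<lambda>s. g (x + s *\<^sub>R \<Psi> x)) has_derivative (\<lambda>s. blinfun_apply (g' (x + 0 *\<^sub>R \<Psi> x)) (s *\<^sub>R \<Psi> x))) (at 0)"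
        by (rule has_derivative_compose[OF _ g_deriv]) (auto intro!: derivative_eq_intros)
      hence "((\<lambda>s. g (x + s *\<^sub>R \<Psi> x)) has_real_derivative blinfun_apply (g' x) (\<Psi> x)) (at 0)"
        unfolding has_field_derivative_def by (rule has_derivative_eq_rhs)
          (simp add: fun_eq_iff blinfun.scaleR_right)
      hence "((\<lambda>s. (g (x + s *\<^sub>R \<Psi> x) - g x) / s) \<longlongrightarrow> blinfun_apply (g' x) (\<Psi> x)) (at 0)"
        by (simp add: DERIV_def)
      hence "(\<lambda>i. (g (x + R i *\<^sub>R \<Psi> x) - g x) / R i) \<longlonglongrightarrow> blinfun_apply (g' x) (\<Psi> x)"
        by (rule filterlim_compose) (use R R0 in \<open>auto simp: filterlim_at less_imp_neq[symmetric] intro!: always_eventually\<close>)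
      hence "(\<lambda>i. \<bar>M x * ((g (x + R i *\<^sub>R \<Psi> x) - g x) / R i - blinfun_apply (g' x) (\<Psi> x))\<bar>)
          \<longlonglongrightarrow> \<bar>M x * (blinfun_apply (g' x) (\<Psi> x) - blinfun_apply (g' x) (\<Psi> x))\<bar>"
        by (intro tendsto_intros)
      moreover have "(g (x + R i *\<^sub>R \<Psi> x) - g x) / R i - blinfun_apply (g' x) (\<Psi> x) = \<rho> (R i) x / R i" for i
        using R[of i] by (simp add: \<rho>_def field_simps)
      ultimately show "(\<lambda>i. \<bar>M x * (\<rho> (R i) x / R i)\<bar>) \<longlonglongrightarrow> 0" by simp
    qed
  qed simp_all
  moreover have "(\<integral>x. \<bar>M x * (\<rho> (R i) x / R i)\<bar> \<partial>P) = (\<integral>x. \<bar>M x * \<rho> (R i) x\<bar> \<partial>P) / R i" for i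
  proof -
    have "\<bar>M x * (\<rho> (R i) x / R i)\<bar> = \<bar>M x * \<rho> (R i) x\<bar> / R i" for x
      using R[of i] by (simp add: abs_mult)
    thus ?thesis by (simp only: integral_divide_zero)
  qed
  ultimately have "(\<lambda>i. (\<integral>x. \<bar>M x * \<rho> (R i) x\<bar> \<partial>P) / R i) \<longlonglongrightarrow> (\<integral>x. 0 \<partial>P)"
    by (simp only:)
  thus "((\<lambda>r. (\<integral>x. \<bar>deriv loss (payoff X0 g a x) * (g (x + r *\<^sub>R \<Psi> x) - g x - r * blinfun_apply (g' x) (\<Psi> x))\<bar> \<partial>P) / r) \<circ> R) \<longlonglongrightarrow> 0"
    by (simp add: comp_def M_def \<rho>_def)
qed

lemma shifted_loss_integrable:
  assumes b: "b \<in> controls L" and r: "0 \<le> r"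
  shows "integrable P (\<lambda>x. loss (gain (ctrl_vec b x, x + r *\<^sub>R \<Psi> x)))"
proof -
  note [measurable] = ctrl_vec_borel[OF b]
  have [measurable]: "gain \<in> borel_measurable borel"
    by (rule borel_measurable_continuous_onI[OF gain_cont])
  have [measurable]: "(\<lambda>x. (ctrl_vec b x, x + r *\<^sub>R \<Psi> x)) \<in> borel_measurable borel"
    unfolding borel_prod[symmetric] by measurable
  have B0: "B \<ge> 0" using bdd[of 0] norm_ge_zero order_trans by blast
  obtain C where C: "C > 0" "\<And>\<alpha> x. \<alpha> \<in> cube \<Longrightarrow> \<bar>loss (gain (\<alpha>, x))\<bar> \<le> C * (1 + norm x) powr p"
    using growth_bounds by metis
  show ?thesis
  proof (rule integrable_growth[OF P])
    fix x
    have "\<bar>loss (gain (ctrl_vec b x, x + r *\<^sub>R \<Psi> x))\<bar> \<le> C * (1 + norm (x + r *\<^sub>R \<Psi> x)) powr p"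
      by (rule C(2)[OF ctrl_vec_cube[OF b]])
    also have "\<dots> \<le> C * ((1 + r * B) * (1 + norm x)) powr p"
    proof (intro mult_left_mono powr_mono2)
      have "norm (x + r *\<^sub>R \<Psi> x) \<le> norm x + r * B"
        using r bdd[of x] by (intro norm_triangle_le add_left_mono) (simp add: mult_left_mono)
      moreover have "0 \<le> r * B * norm x" using r B0 by simp
      ultimately show "1 + norm (x + r *\<^sub>R \<Psi> x) \<le> (1 + r * B) * (1 + norm x)" by (simp add: algebra_simps)
    qed (use p C(1) in auto)
    also have "\<dots> = (C * (1 + r * B) powr p) * (1 + norm x) powr p"
      using r B0 by (simp add: powr_mult)
    finally show "\<bar>loss (gain (ctrl_vec b x, x + r *\<^sub>R \<Psi> x))\<bar> \<le> (C * (1 + r * B) powr p) * (1 + norm x) powr p" .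
  qed measurable
qed

text \<open>The tangent of the loss at the unperturbed optimal position bounds the shifted loss from below, for every
control \<open>b\<close>. The contribution of changing the control on the original path is nonnegative by the
first-order condition, and its contribution on the displacement is the drift.\<close>

lemma shifted_loss_first_order:
  assumes b: "b \<in> controls L" and r: "0 \<le> r"
  shows "hedging_value L X0 loss g P + r * (\<Sum>t\<in>UNIV. \<integral>x. \<Psi> x $ t * grad a t x \<partial>P) + r * drift a \<Psi> b
    - (\<integral>x. \<bar>deriv loss (payoff X0 g a x) * (g (x + r *\<^sub>R \<Psi> x) - g x - r * blinfun_apply (g' x) (\<Psi> x))\<bar> \<partial>P)
    \<le> shifted_loss r b"
proof -
  note ca = optimalD(1)[OF a]
  note [measurable] = controlsD(1)[OF ca] controlsD(1)[OF b]
  have B0: "B \<ge> 0" using bdd[of 0] norm_ge_zero order_trans by blast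
  obtain G where G: "\<And>x. norm (g' x) \<le> G" using g'_bdd by (auto simp: bounded_iff)
  have G0: "G \<ge> 0" using G[of 0] norm_ge_zero order_trans by blast
  define M where "M x = deriv loss (payoff X0 g a x)" for x
  have M [measurable]: "M \<in> borel_measurable borel" unfolding M_def using ca by measurable
  define w where "w x = payoff X0 g b x - payoff X0 g a x" for x
  define \<rho> where "\<rho> x = g (x + r *\<^sub>R \<Psi> x) - g x - r * blinfun_apply (g' x) (\<Psi> x)" for x
  define W where "W x = (\<Sum>t\<in>UNIV. (b t x - a t x) * (\<Psi> x $ t - prev_val 0 (\<Psi> x) t))" for x
  have wm [measurable]: "w \<in> borel_measurable borel" unfolding w_def using ca b by measurable
  have Wm [measurable]: "W \<in> borel_measurable borel" unfolding W_def by measurable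
  have g'\<Psi>: "blinfun_apply (g' x) (\<Psi> x) = (\<Sum>t\<in>UNIV. \<Psi> x $ t * partial_deriv t g x)" for x
    by (subst path_eq_sum[of "\<Psi> x"]) (simp add: blinfun.sum_right blinfun.scaleR_right partial_deriv_eq)
  have \<rho>m [measurable]: "\<rho> \<in> borel_measurable borel" unfolding \<rho>_def g'\<Psi> by measurable
  obtain K1 where K1: "\<And>x. \<bar>w x\<bar> \<le> K1 * (1 + norm x)"
    unfolding w_def using payoff_diff_growth[OF ca b] by blast
  obtain K2 where "\<forall>b\<in>controls L. \<forall>x.
    \<bar>\<Sum>t\<in>UNIV. (b t x - a t x) * (\<Psi> x $ t - prev_val 0 (\<Psi> x) t)\<bar> \<le> K2 * (1 + norm x)"
    using drift_growth[where \<Psi> = \<Psi>, OF ca bdd] by (rule exE)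
  hence K2: "\<bar>W x\<bar> \<le> K2 * (1 + norm x)" for x unfolding W_def using b by blast
  have K3: "\<bar>\<rho> x\<bar> \<le> (2 * (G * (r * B))) * (1 + norm x)" for x
  proof -
    have "norm (g (x + r *\<^sub>R \<Psi> x) - g x) \<le> G * norm (x + r *\<^sub>R \<Psi> x - x)"
      by (rule differentiable_bound[of UNIV g "\<lambda>x. blinfun_apply (g' x)"])
        (use g_deriv G in \<open>auto simp: norm_blinfun.rep_eq[symmetric]\<close>)
    also have "\<dots> \<le> G * (r * B)"
      using r bdd[of x] G0 by (intro mult_left_mono) (auto simp: mult_left_mono)
    finally have 1: "\<bar>g (x + r *\<^sub>R \<Psi> x) - g x\<bar> \<le> G * (r * B)" by simp
    have "norm (blinfun_apply (g' x) (\<Psi> x)) \<le> G * B"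
      using G0 by (intro order_trans[OF norm_blinfun] mult_mono G bdd) auto
    hence "\<bar>r * blinfun_apply (g' x) (\<Psi> x)\<bar> \<le> r * (G * B)"
      using r by (simp add: abs_mult mult_left_mono)
    hence "\<bar>\<rho> x\<bar> \<le> 2 * (G * (r * B))" unfolding \<rho>_def using 1 by (simp add: algebra_simps)
    also have "\<dots> \<le> (2 * (G * (r * B))) * (1 + norm x)"
      using r G0 B0 mult_left_mono[of 1 "1 + norm x" "2 * (G * (r * B))"] by simp
    finally show ?thesis .
  qed
  note iw = integrable_loss'_mult[OF P ca wm K1, folded M_def]
    and iW = integrable_loss'_mult[OF P ca Wm K2, folded M_def]
    and i\<rho> = integrable_loss'_mult[OF P ca \<rho>m K3, folded M_def]
  have ig: "integrable P (\<lambda>x. \<Psi> x $ t * grad a t x)" for t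
  proof (rule Bochner_Integration.integrable_bound)
    show "integrable P (\<lambda>x. B * grad a t x)" using grad_integrable(1)[OF ca] by simp
    have "\<bar>\<Psi> x $ t\<bar> \<le> B" for x using component_le_norm_cart[of "\<Psi> x" t] bdd[of x] by linarith
    thus "AE x in P. norm (\<Psi> x $ t * grad a t x) \<le> norm (B * grad a t x)"
      using B0 by (auto simp: abs_mult intro!: mult_right_mono)
    show "(\<lambda>x. \<Psi> x $ t * grad a t x) \<in> borel_measurable P"
      using grad_borel[OF ca] by measurable
  qed
  have decomp: "M x * (gain (ctrl_vec b x, x + r *\<^sub>R \<Psi> x) - payoff X0 g a x)
      = M x * w x + M x * \<rho> x + r * (\<Sum>t\<in>UNIV. \<Psi> x $ t * grad a t x) + r * (M x * W x)" for x
  proof -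
    have 1: "gain (ctrl_vec b x, x + r *\<^sub>R \<Psi> x) - payoff X0 g a x
        = w x + (g (x + r *\<^sub>R \<Psi> x) - g x) + r * (\<Sum>t\<in>UNIV. b t x * (\<Psi> x $ t - prev_val 0 (\<Psi> x) t))"
      unfolding gain_add by (simp add: w_def payoff_eq_gain prev_val_scaleR ctrl_vec_def sum_distrib_left algebra_simps)
    have 2: "(\<Sum>t\<in>UNIV. \<Psi> x $ t * grad a t x)
        = M x * (blinfun_apply (g' x) (\<Psi> x) + (\<Sum>t\<in>UNIV. a t x * (\<Psi> x $ t - prev_val 0 (\<Psi> x) t)))"
      unfolding cost'_eq_grad[symmetric]
      by (simp add: cost'_def blinfun.scaleR_left gain'_apply payoff_eq_gain M_def ctrl_vec_def)
    have 3: "W x = (\<Sum>t\<in>UNIV. b t x * (\<Psi> x $ t - prev_val 0 (\<Psi> x) t)) - (\<Sum>t\<in>UNIV. a t x * (\<Psi> x $ t - prev_val 0 (\<Psi> x) t))"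
      by (simp add: W_def left_diff_distrib sum_subtractf)
    show ?thesis unfolding 1 2 3 \<rho>_def by (simp add: algebra_simps)
  qed
  have pt: "loss (payoff X0 g a x) + (M x * w x - \<bar>M x * \<rho> x\<bar> + r * (\<Sum>t\<in>UNIV. \<Psi> x $ t * grad a t x) + r * (M x * W x))
      \<le> loss (gain (ctrl_vec b x, x + r *\<^sub>R \<Psi> x))" for x
  proof -
    have "loss (payoff X0 g a x) + M x * (gain (ctrl_vec b x, x + r *\<^sub>R \<Psi> x) - payoff X0 g a x)
        \<le> loss (gain (ctrl_vec b x, x + r *\<^sub>R \<Psi> x))"
      unfolding M_def by (rule loss_ge_tangent)
    thus ?thesis unfolding decomp by linarith
  qed
  have "hedging_value L X0 loss g P + ((\<integral>x. M x * w x \<partial>P) - (\<integral>x. \<bar>M x * \<rho> x\<bar> \<partial>P)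
      + r * (\<Sum>t\<in>UNIV. \<integral>x. \<Psi> x $ t * grad a t x \<partial>P) + r * drift a \<Psi> b)
    = (\<integral>x. loss (payoff X0 g a x) + (M x * w x - \<bar>M x * \<rho> x\<bar> + r * (\<Sum>t\<in>UNIV. \<Psi> x $ t * grad a t x) + r * (M x * W x)) \<partial>P)"
    using integrable_loss[OF P ca] iw iW i\<rho> ig optimalD(2)[OF a]
    by (simp add: expected_loss_def drift_def M_def[symmetric] W_def[symmetric])
  also have "\<dots> \<le> shifted_loss r b"
    unfolding shifted_loss_def
    by (rule integral_mono[OF _ shifted_loss_integrable[OF b r] pt])
      (use integrable_loss[OF P ca] iw iW i\<rho> ig in auto)
  finally show ?thesis
    using first_order_condition[OF a b] by (simp add: M_def w_def \<rho>_def)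
qed

lemma shifted_loss_lipschitz:
  obtains K where "\<And>r b. 0 \<le> r \<Longrightarrow> r \<le> 1 \<Longrightarrow> b \<in> controls L \<Longrightarrow> expected_loss P b - K * r \<le> shifted_loss r b"
proof -
  have B0: "B \<ge> 0" using bdd[of 0] norm_ge_zero order_trans by blast
  obtain C where C: "C > 0"
    "\<And>\<alpha> x d. \<alpha> \<in> cube \<Longrightarrow> \<bar>loss (gain (\<alpha>, x + d)) - loss (gain (\<alpha>, x))\<bar> \<le> C * (1 + norm x + norm d) powr (p - 1) * norm d"
    using cost_lipschitz by metis
  define D where "D = C * (1 + B) powr (p - 1) * B"
  have D0: "D \<ge> 0" using C(1) B0 by (simp add: D_def)
  have iD: "integrable P (\<lambda>x. D * (1 + norm x) powr p)"
    by (rule integrable_growth[OF P, of _ D]) (use D0 in auto)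
  show thesis
  proof (rule that[of "\<integral>x. D * (1 + norm x) powr p \<partial>P"])
    fix r :: real and b :: "'n \<Rightarrow> 'n path \<Rightarrow> real" assume r: "0 \<le> r" "r \<le> 1" and b: "b \<in> controls L"
    have "loss (payoff X0 g b x) - r * (D * (1 + norm x) powr p) \<le> loss (gain (ctrl_vec b x, x + r *\<^sub>R \<Psi> x))" for x
    proof -
      have n: "norm (r *\<^sub>R \<Psi> x) \<le> r * B" using r bdd[of x] by (simp add: mult_left_mono)
      have rB: "r * B \<le> B" using r B0 by (simp add: mult_left_le_one_le)
      have "C * (1 + norm x + norm (r *\<^sub>R \<Psi> x)) powr (p - 1) * norm (r *\<^sub>R \<Psi> x)
          \<le> C * ((1 + B) * (1 + norm x)) powr (p - 1) * (r * B)"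
      proof (intro mult_mono mult_left_mono powr_mono2 n)
        have "0 \<le> B * norm x" using B0 by simp
        thus "1 + norm x + norm (r *\<^sub>R \<Psi> x) \<le> (1 + B) * (1 + norm x)"
          using n rB by (simp add: algebra_simps)
      qed (use p C(1) in auto)
      also have "\<dots> = r * (D * (1 + norm x) powr (p - 1))"
        unfolding D_def powr_mult by (simp only: mult_ac)
      also have "\<dots> \<le> r * (D * (1 + norm x) powr p)"
        using r D0 by (intro mult_left_mono powr_mono) auto
      finally show ?thesis
        using C(2)[OF ctrl_vec_cube[OF b], of x x "r *\<^sub>R \<Psi> x"] by (simp add: payoff_eq_gain)
    qed
    hence "(\<integral>x. loss (payoff X0 g b x) - r * (D * (1 + norm x) powr p) \<partial>P) \<le> shifted_loss r b"
      unfolding shifted_loss_def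
      using integrable_loss[OF P b] iD by (intro integral_mono shifted_loss_integrable b r) auto
    thus "expected_loss P b - (\<integral>x. D * (1 + norm x) powr p \<partial>P) * r \<le> shifted_loss r b"
      using integrable_loss[OF P b] iD by (simp add: expected_loss_def mult.commute)
  qed
qed

text \<open>Nearly optimal controls have almost nonnegative drift. The remaining controls lose a fixed amount \<open>\<delta>\<close>,
which a displacement of order \<open>r\<close> cannot compensate.\<close>

lemma shifted_loss_lower_bound:
  assumes e: "e > 0"
  shows "\<exists>R>0. \<forall>r. 0 < r \<and> r < R \<longrightarrow> (\<forall>b\<in>controls L.
    hedging_value L X0 loss g P + r * (\<Sum>t\<in>UNIV. \<integral>x. \<Psi> x $ t * grad a t x \<partial>P) - e * r \<le> shifted_loss r b)"
proof -
  let ?hv = "hedging_value L X0 loss g P"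
  define S where "S = (\<Sum>t\<in>UNIV. \<integral>x. \<Psi> x $ t * grad a t x \<partial>P)"
  define rem where "rem r = (\<integral>x. \<bar>deriv loss (payoff X0 g a x) * (g (x + r *\<^sub>R \<Psi> x) - g x - r * blinfun_apply (g' x) (\<Psi> x))\<bar> \<partial>P)" for r
  obtain \<delta> where \<delta>: "\<delta> > 0" "\<And>b. b \<in> controls L \<Longrightarrow> expected_loss P b \<le> ?hv + \<delta> \<Longrightarrow> - (e / 2) \<le> drift a \<Psi> b"
    using near_optimal_drift[OF a \<Psi> dep bdd, of "e / 2"] e by auto
  obtain K where K: "\<And>r b. 0 \<le> r \<Longrightarrow> r \<le> 1 \<Longrightarrow> b \<in> controls L \<Longrightarrow> expected_loss P b - K * r \<le> shifted_loss r b"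
    using shifted_loss_lipschitz by blast
  have "\<forall>\<^sub>F r in at_right 0. rem r / r < e / 2"
    using g_remainder_tendsto e unfolding rem_def by (intro order_tendstoD(2)) auto
  then obtain R1 where R1: "R1 > 0" "\<And>r. 0 < r \<Longrightarrow> r < R1 \<Longrightarrow> rem r / r < e / 2"
    by (auto simp: eventually_at_right_field)
  define R2 where "R2 = \<delta> / (\<bar>K\<bar> + \<bar>S\<bar> + 1)"
  have R2: "R2 > 0" using \<delta>(1) by (simp add: R2_def add_nonneg_pos)
  define R where "R = min 1 (min R1 R2)"
  show ?thesis
  proof (intro exI[of _ R] conjI allI impI ballI)
    show "R > 0" using R1(1) R2 by (simp add: R_def)
    fix r and b :: "'n \<Rightarrow> 'n path \<Rightarrow> real" assume r: "0 < r \<and> r < R" and b: "b \<in> controls L"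
    show "?hv + r * (\<Sum>t\<in>UNIV. \<integral>x. \<Psi> x $ t * grad a t x \<partial>P) - e * r \<le> shifted_loss r b"
      unfolding S_def[symmetric]
    proof (cases "expected_loss P b \<le> ?hv + \<delta>")
      case True
      have "?hv + r * S + r * drift a \<Psi> b - rem r \<le> shifted_loss r b"
        using shifted_loss_first_order[OF b, of r] r by (simp add: S_def rem_def)
      moreover have "r * drift a \<Psi> b \<ge> r * - (e / 2)"
        using \<delta>(2)[OF b True] r by (intro mult_left_mono) auto
      moreover have "rem r \<le> r * (e / 2)"
        using R1(2)[of r] r by (simp add: R_def field_simps)
      ultimately show "?hv + r * S - e * r \<le> shifted_loss r b" by (simp add: algebra_simps)
    next
      case False
      have "r * (\<bar>K\<bar> + \<bar>S\<bar> + 1) \<le> \<delta>"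
        using r by (simp add: R_def R2_def field_simps add_nonneg_pos)
      moreover have "K * r \<le> r * \<bar>K\<bar>" "r * S \<le> r * \<bar>S\<bar>" "0 \<le> e * r"
        using r e by (auto simp: mult.commute)
      ultimately have "?hv + r * S - e * r \<le> ?hv + \<delta> - K * r"
        using r unfolding distrib_left mult_1_right by linarith
      also have "\<dots> \<le> expected_loss P b - K * r" using False by simp
      also have "\<dots> \<le> shifted_loss r b" using r b by (intro K) (auto simp: R_def)
      finally show "?hv + r * S - e * r \<le> shifted_loss r b" .
    qed
  qed
qed

text \<open>An adapted displacement turns predictable controls of the displaced path into predictable controls of the
original one.\<close>

lemma expected_loss_perturbed:
  assumes b: "b \<in> controls L" and r: "0 \<le> r"
  shows "\<exists>b'\<in>controls L. expected_loss (distr P borel (\<lambda>x. x + r *\<^sub>R \<Psi> x)) b = shifted_loss r b'"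
proof -
  define b' where "b' t x = b t (x + r *\<^sub>R \<Psi> x)" for t x
  note [measurable] = controlsD(1)[OF b]
  have "b' \<in> controls L"
  proof (rule controlsI)
    show "b' t \<in> borel_measurable borel" for t unfolding b'_def by measurable
    show "\<bar>b' t x\<bar> \<le> L" for t x unfolding b'_def by (rule controlsD(3)[OF b])
    show "depends_on {..<t} (b' t)" for t
      unfolding depends_on_def b'_def
    proof (intro allI impI depends_onD[OF controlsD(2)[OF b]])
      fix x y :: "'n path" and s assume eq: "\<forall>s\<in>{..<t}. x $ s = y $ s" and s: "s \<in> {..<t}"
      have "\<Psi> x $ s = \<Psi> y $ s" using eq s by (intro depends_onD[OF dep]) auto
      thus "(x + r *\<^sub>R \<Psi> x) $ s = (y + r *\<^sub>R \<Psi> y) $ s" using eq s by simp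
    qed
  qed
  moreover have "expected_loss (distr P borel (\<lambda>x. x + r *\<^sub>R \<Psi> x)) b = shifted_loss r b'"
  proof -
    have m: "(\<lambda>x. loss (payoff X0 g b x)) \<in> borel_measurable borel" using b by measurable
    have "payoff X0 g b (x + r *\<^sub>R \<Psi> x) = gain (ctrl_vec b' x, x + r *\<^sub>R \<Psi> x)" for x
      by (simp add: payoff_eq_gain ctrl_vec_def b'_def)
    thus ?thesis
      unfolding expected_loss_def shifted_loss_def by (subst integral_distr[OF _ m]) simp_all
  qed
  ultimately show ?thesis by blast
qed

end

lemma lower_bound:
  assumes a: "optimal a" and e: "e > 0"
  shows "\<exists>R>0. \<forall>r. 0 < r \<and> r < R \<longrightarrow> (\<exists>Q\<in>AW_ball p P r.
    hedging_value L X0 loss g P + r * sensitivity q X0 loss g P a - e * r \<le> hedging_value L X0 loss g Q)"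
proof -
  let ?hv = "hedging_value L X0 loss g P"
  note ca = optimalD(1)[OF a]
  have e2: "e / 2 > 0" using e by simp
  obtain \<Psi> C B where \<Psi>: "C-lipschitz_on UNIV \<Psi>" "\<And>t. depends_on {..t} (\<lambda>x. \<Psi> x $ t)"
    "\<And>x. norm (\<Psi> x) \<le> B" "(\<Sum>t\<in>UNIV. \<integral>x. \<bar>\<Psi> x $ t\<bar> powr p \<partial>P) \<le> 1"
    and S: "sensitivity q X0 loss g P a - e / 2 \<le> (\<Sum>t\<in>UNIV. \<integral>x. \<Psi> x $ t * proj_grad a t x \<partial>P)"
    by (rule sensitivity_direction[OF ca e2]) blast
  have \<Psi>m [measurable]: "\<Psi> \<in> borel_measurable borel"
    by (rule borel_measurable_continuous_onI[OF lipschitz_on_continuous_on[OF \<Psi>(1)]])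
  have C0: "C \<ge> 0" using \<Psi>(1) by (rule lipschitz_on_nonneg)
  have B: "B \<ge> 0" using \<Psi>(3)[of 0] norm_ge_zero order_trans by blast
  have "(\<integral>x. \<Psi> x $ t * grad a t x \<partial>P) = (\<integral>x. \<Psi> x $ t * proj_grad a t x \<partial>P)" for t
  proof (rule proj_grad_test[OF ca _ \<Psi>(2)])
    show "integrable P (\<lambda>x. \<Psi> x $ t * grad a t x)"
    proof (rule Bochner_Integration.integrable_bound)
      show "integrable P (\<lambda>x. B * grad a t x)" using grad_integrable(1)[OF ca] by simp
      have "\<bar>\<Psi> x $ t\<bar> \<le> B" for x using component_le_norm_cart[of "\<Psi> x" t] \<Psi>(3)[of x] by linarith
      thus "AE x in P. norm (\<Psi> x $ t * grad a t x) \<le> norm (B * grad a t x)"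
        using B by (auto simp: abs_mult intro!: mult_right_mono)
      show "(\<lambda>x. \<Psi> x $ t * grad a t x) \<in> borel_measurable P"
        using grad_borel[OF ca] by measurable
    qed
  qed measurable
  hence S: "sensitivity q X0 loss g P a - e / 2 \<le> (\<Sum>t\<in>UNIV. \<integral>x. \<Psi> x $ t * grad a t x \<partial>P)"
    using S by simp
  obtain R where R: "R > 0" "\<And>r b. 0 < r \<Longrightarrow> r < R \<Longrightarrow> b \<in> controls L \<Longrightarrow>
    ?hv + r * (\<Sum>t\<in>UNIV. \<integral>x. \<Psi> x $ t * grad a t x \<partial>P) - e / 2 * r \<le> shifted_loss \<Psi> r b"
    using shifted_loss_lower_bound[OF a \<Psi>m \<Psi>(2,3) e2] by blast
  define R' where "R' = min R (1 / (C + 1))"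
  show ?thesis
  proof (intro exI[of _ R'] conjI allI impI)
    show "R' > 0" using R(1) C0 by (simp add: R'_def)
    fix r assume r: "0 < r \<and> r < R'"
    have "r * (C + 1) < 1" using r C0 by (simp add: R'_def field_simps)
    hence rC: "r * C < 1" using r by (simp add: algebra_simps)
    show "\<exists>Q\<in>AW_ball p P r. ?hv + r * sensitivity q X0 loss g P a - e * r \<le> hedging_value L X0 loss g Q"
    proof (rule bexI)
      show "distr P borel (\<lambda>x. x + r *\<^sub>R \<Psi> x) \<in> AW_ball p P r"
        using perturbation_AW[OF \<Psi>(1,2) _ rC P _ \<Psi>(3,4)] r p by simp
      show "?hv + r * sensitivity q X0 loss g P a - e * r \<le> hedging_value L X0 loss g (distr P borel (\<lambda>x. x + r *\<^sub>R \<Psi> x))"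
      proof (rule hedging_value_greatest)
        fix b :: "'n \<Rightarrow> 'n path \<Rightarrow> real" assume b: "b \<in> controls L"
        then obtain b' where b': "b' \<in> controls L"
          "expected_loss (distr P borel (\<lambda>x. x + r *\<^sub>R \<Psi> x)) b = shifted_loss \<Psi> r b'"
          using expected_loss_perturbed[OF a \<Psi>m \<Psi>(2,3) b, of r] r by auto
        have "r * (sensitivity q X0 loss g P a - e / 2) \<le> r * (\<Sum>t\<in>UNIV. \<integral>x. \<Psi> x $ t * grad a t x \<partial>P)"
          using S r by (intro mult_left_mono) auto
        thus "?hv + r * sensitivity q X0 loss g P a - e * r \<le> expected_loss (distr P borel (\<lambda>x. x + r *\<^sub>R \<Psi> x)) b"
          using R(2)[of r b'] r b' by (simp add: R'_def algebra_simps)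
      qed
    qed
  qed
qed

theorem sensitivity_expansion:
  assumes a: "optimal a"
  shows "(\<lambda>r. (SUP Q \<in> AW_ball p P r. hedging_value L X0 loss g Q)
      - (hedging_value L X0 loss g P + r * sensitivity q X0 loss g P a)) \<in> o[at_right 0](\<lambda>r. r)"
proof (rule landau_o.smallI)
  fix e :: real assume e: "e > 0"
  let ?hv = "hedging_value L X0 loss g" and ?V = "sensitivity q X0 loss g P a"
  obtain R1 where R1: "R1 > 0" "\<And>r Q. 0 < r \<Longrightarrow> r < R1 \<Longrightarrow> Q \<in> AW_ball p P r \<Longrightarrow> ?hv Q \<le> ?hv P + r * ?V + e * r"
    using upper_bound[OF a e] by blast
  obtain R2 where R2: "R2 > 0" "\<And>r. 0 < r \<Longrightarrow> r < R2 \<Longrightarrow> \<exists>Q\<in>AW_ball p P r. ?hv P + r * ?V - e * r \<le> ?hv Q"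
    using lower_bound[OF a e] by blast
  have "norm ((SUP Q \<in> AW_ball p P r. ?hv Q) - (?hv P + r * ?V)) \<le> e * norm r" if r: "0 < r" "r < min R1 R2" for r
  proof -
    obtain Q where Q: "Q \<in> AW_ball p P r" "?hv P + r * ?V - e * r \<le> ?hv Q" using R2(2)[of r] r by auto
    have up: "?hv Q \<le> ?hv P + r * ?V + e * r" if "Q \<in> AW_ball p P r" for Q
      using R1(2)[of r Q] r that by simp
    have "(SUP Q \<in> AW_ball p P r. ?hv Q) \<le> ?hv P + r * ?V + e * r"
      using Q(1) by (intro cSUP_least up) auto
    moreover have "?hv Q \<le> (SUP Q \<in> AW_ball p P r. ?hv Q)"
      by (rule cSUP_upper[OF Q(1)]) (use up in \<open>auto intro!: bdd_aboveI2\<close>)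
    ultimately show ?thesis using Q(2) r by (simp add: abs_le_iff)
  qed
  thus "\<forall>\<^sub>F r in at_right 0. norm ((SUP Q \<in> AW_ball p P r. ?hv Q) - (?hv P + r * ?V)) \<le> e * norm r"
    unfolding eventually_at_right_field using R1(1) R2(1) by (intro exI[of _ "min R1 R2"]) auto
qed

end

theorem corollary2p7:
  fixes p q L X0 c :: real
    and P :: "'n::{finite,linorder} path measure"
    and loss :: "real \<Rightarrow> real"
    and g :: "'n path \<Rightarrow> real"
    and g' :: "'n path \<Rightarrow> 'n path \<Rightarrow>\<^sub>L real"
  assumes "p > 1" and "q = p / (p - 1)"
    and "P \<in> P_p p"
    and "L \<ge> 0"
    and "convex_on UNIV loss"
    and "bdd_below (range loss)"
    and "\<And>u. loss differentiable (at u)"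
    and "\<And>u. deriv loss differentiable (at u)"
    and "continuous_on UNIV (deriv (deriv loss))"
    and "\<And>u. deriv (deriv loss) u > 0"
    and "c > 0"
    and "\<And>u. \<bar>deriv loss u\<bar> \<le> c * (1 + \<bar>u\<bar> powr (p - 1))"
    and "\<And>x. (g has_derivative blinfun_apply (g' x)) (at x)"
    and "continuous_on UNIV g'"
    and "bounded (range g')"
    and "\<And>t. measure P {x. prev_val X0 x t = x $ t} = 0"
  shows "(\<exists>a. optimal_control L X0 loss g P a) \<and>
    (\<forall>a. optimal_control L X0 loss g P a \<longrightarrow>
      (\<lambda>r. (SUP Q \<in> AW_ball p P r. hedging_value L X0 loss g Q)
            - (hedging_value L X0 loss g P + r * sensitivity q X0 loss g P a))
        \<in> o[at_right 0](\<lambda>r. r))"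
proof -
  interpret hedging p q L X0 c P loss g g'
    by unfold_locales (fact assms)+
  show ?thesis
    using optimal_exists sensitivity_expansion by blast
qed

end
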